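(* Let $L,v_m,q^\star>0$ and, for $i\in\{1,2\}$, let $\gamma_i,\rho_{m,i},\tau_i,\rho_i^\star,v_i^\star,p_i^\star>0$ be traffic parameters and steady-state values, and let $r_i$ and $c_i(\cdot)$ be the associated coefficients, all as specified in the context (congested regime, so that $\gamma_ip_i^\star-v_i^\star>0$). Consider the system with states $\bar w_1,\tilde v_1$ on $[0,L]\times[0,\infty)$ and $\bar w_2,\tilde v_2$ on $[-L,0]\times[0,\infty)$, for $i\in\{1,2\}$: $$\partial_t \bar w_i+v_i^\star\,\partial_x\bar w_i=0,\qquad \partial_t\tilde v_i-(\gamma_ip_i^\star-v_i^\star)\,\partial_x\tilde v_i=c_i(x)\,\bar w_i,$$ $$\tilde v_1(L,t)=r_1\exp\Big(-\frac{L}{\tau_1v_1^\star}\Big)\bar w_1(L,t),\qquad \bar w_1(0,t)=\bar w_2(0,t),$$ $$\bar w_2(-L,t)=\exp\Big(-\frac{L}{\tau_2v_2^\star}\Big)\frac1{r_2}\,\tilde v_2(-L,t),$$ $$\tilde v_2(0,t)=\frac{r_2}{r_1}\tilde v_1(0,t)+\frac{r_1-r_2}{1-r_1}\bar w_2(0,t)+\frac{v_2^\star(1-r_2)}{q^\star}U_0(t),$$ in closed loop with the state feedback law $$U_0(t)=\frac{q^\star}{v_2^\star(1-r_2)}\Bigg(\int_{-L}^0\Big[K_2^{vw}(0,\xi)\bar w_2(\xi,t)+K_2^{vv}(0,\xi)\tilde v_2(\xi,t)\Big]d\xi-\frac{r_2}{r_1}\int_0^L\Big[K_1^{vw}(0,\xi)\bar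 w_1(\xi,t)+K_1^{vv}(0,\xi)\tilde v_1(\xi,t)\Big]d\xi\Bigg),$$ where the kernels $K_i^{vw},K_i^{vv}$ are those defined in the context. Assume that $$\mathrm{Sp}_1\begin{pmatrix}0&0&0&1\\[2pt] 0&0&\frac{r_2}{r_1}&\frac{r_1-r_2}{1-r_1}\\[2pt] r_1\exp\big(-\frac{L}{\tau_1v_1^\star}\big)&0&0&0\\[2pt] 0&\frac1{r_2}\exp\big(-\frac{L}{\tau_2v_2^\star}\big)&0&0\end{pmatrix}<1 ,$$ with $\mathrm{Sp}_1$ as defined in the context. Then for any $L^2$ initial condition $(\bar w_i(\cdot,0),\tilde v_i(\cdot,0))_{i=1,2}$, the solution of the closed-loop system converges exponentially to $0$ in the $L^2$-norm, i.e. there exist $C,\nu>0$ such that for all $t\ge 0$ $$\|\bar w_1(\cdot,t)\|_{L^2(0,L)}+\|\tilde v_1(\cdot,t)\|_{L^2(0,L)}+\|\bar w_2(\cdot,t)\|_{L^2(-L,0)}+\|\tilde v_2(\cdot,t)\|_{L^2(-L,0)}\le C e^{-\nu t}.$$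
   Context: Origin and parameters. The system is the linearization, in rescaled Riemann coordinates, of Aw-Rascle-Zhang traffic models on two connected roads of equal length $L>0$: index $1$ is the outgoing (downstream) road on $[0,L]$, index $2$ the incoming (upstream) road on $[-L,0]$, and $U_0$ is the control at the junction $x=0$. For $i\in\{1,2\}$: $\gamma_i>0$, maximum density $\rho_{m,i}>0$ with $\rho_{m,2}>\rho_{m,1}$, relaxation time $\tau_i>0$; the maximum velocity $v_m>0$ is common to both roads. Steady states. The steady-state densities $0<\rho_i^\star<\rho_{m,i}$ have velocities and pressures $$v_i^\star=v_m\Big(1-\Big(\frac{\rho_i^\star}{\rho_{m,i}}\Big)^{\gamma_i}\Big),\qquad p_i^\star=v_m\Big(\frac{\rho_i^\star}{\rho_{m,i}}\Big)^{\gamma_i},$$ and are chosen so that $\rho_1^\star v_1^\star=\rho_2^\star v_2^\star=q^\star$. (Hence $v_i^\star+p_i^\star=v_m$.) Both are in the congested regime: $\rho_i^\star>\rho_{m,i}/(1+\gamma_i)^{1/\gamma_i}$, equivalently $\gamma_ip_i^\star-v_i^\star>0$. Coefficients. $$r_i=-\frac{v_i^\star}{\gamma_ip_i^\star-v_i^\star},\qquad c_i(x)=-\frac1{\tau_i}\exp\Big(-\frac{x}{\tau_iv_i^\star}\Big).$$ The quantity $\mathrm{Sp}_1$. For a real $4\times4$ matrix $H$, $\mathrm{Sp}_1(H)=\inf\{\|\Delta H\Delta^{-1}\|:\Delta\in\mathcal D_{4,+}\}$, where $\mathcal D_{4,+}$ is the set of real diagonal $4\times 4$ matrices with strictly positive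 diagonal entries and $\|\cdot\|$ is the operator norm induced by the Euclidean norm. Kernels. Let $\mathcal T_1=\{(x,\xi)\in[0,L]^2:\xi\ge x\}$ and $\mathcal T_2=\{(x,\xi)\in[-L,0]^2:\xi\le x\}$. The kernels $K_i^{vw},K_i^{vv}\in L^\infty(\mathcal T_i)$ are the unique solution (understood along characteristics; existence and uniqueness are known) on $\mathcal T_i$ of $$(\gamma_ip_i^\star-v_i^\star)\,\partial_xK_i^{vw}(x,\xi)-v_i^\star\,\partial_\xi K_i^{vw}(x,\xi)=c_i(\xi)K_i^{vv}(x,\xi),\qquad \partial_xK_i^{vv}(x,\xi)+\partial_\xi K_i^{vv}(x,\xi)=0,$$ with boundary conditions $$K_1^{vw}(x,x)=\frac{c_1(x)}{\gamma_1p_1^\star},\qquad K_2^{vw}(x,x)=-\frac{c_2(x)}{\gamma_2p_2^\star},$$ $$K_1^{vv}(x,L)=-\exp\Big(\frac{L}{\tau_1v_1^\star}\Big)K_1^{vw}(x,L),\qquad K_2^{vv}(x,-L)=-\exp\Big(-\frac{L}{\tau_2v_2^\star}\Big)K_2^{vw}(x,-L).$$ Solutions of the linear hyperbolic system with $L^2$ initial data are understood in the usual weak (mild) $L^2$ sense. *)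

theory Defs
  imports "HOL-Analysis.Analysis"
begin

text \<open>
  Index \<open>1\<close> is the outgoing road \<open>[0, L]\<close>, index \<open>2\<close> the incoming road \<open>[-L, 0]\<close>.
  Families indexed by the road are functions on \<open>nat\<close> of which only the values at \<open>1\<close> and \<open>2\<close>
  are ever used.
\<close>

definition road :: "real \<Rightarrow> nat \<Rightarrow> real set" where
  "road L i = (if i = 1 then {0..L} else {-L..0})"


subsection \<open>Steady states and coefficients\<close>

definition steady_velocity :: "real \<Rightarrow> real \<Rightarrow> real \<Rightarrow> real \<Rightarrow> real" where
  "steady_velocity vm \<gamma> \<rho>m \<rho> = vm * (1 - (\<rho> / \<rho>m) powr \<gamma>)"

definition steady_pressure :: "real \<Rightarrow> real \<Rightarrow> real \<Rightarrow> real \<Rightarrow> real" where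
  "steady_pressure vm \<gamma> \<rho>m \<rho> = vm * (\<rho> / \<rho>m) powr \<gamma>"

definition refl_coeff :: "real \<Rightarrow> real \<Rightarrow> real \<Rightarrow> real" where
  "refl_coeff \<gamma> v p = - v / (\<gamma> * p - v)"

definition source_coeff :: "real \<Rightarrow> real \<Rightarrow> real \<Rightarrow> real" where
  "source_coeff \<tau> v x = - (1 / \<tau>) * exp (- x / (\<tau> * v))"


subsection \<open>The quantity $\mathrm{Sp}_1$\<close>

definition pos_diag :: "(real ^ 'n ^ 'n) set" where
  "pos_diag = {D. (\<forall>i j. i \<noteq> j \<longrightarrow> D $ i $ j = 0) \<and> (\<forall>i. D $ i $ i > 0)}"

definition Sp1 :: "real ^ 'n ^ 'n \<Rightarrow> real" where
  "Sp1 H = Inf {onorm (\<lambda>x. (D ** H ** matrix_inv D) *v x) | D. D \<in> pos_diag}"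


subsection \<open>Square-integrable functions\<close>

definition in_L2 :: "real set \<Rightarrow> (real \<Rightarrow> real) \<Rightarrow> bool" where
  "in_L2 X f \<longleftrightarrow> set_borel_measurable lborel X f \<and> set_integrable lborel X (\<lambda>x. (f x)\<^sup>2)"

definition L2_norm :: "real set \<Rightarrow> (real \<Rightarrow> real) \<Rightarrow> real" where
  "L2_norm X f = sqrt (LINT x:X|lborel. (f x)\<^sup>2)"

text \<open>
  \<open>u \<in> C([0,\<infinity>); L\<^sup>2(X))\<close>, where \<open>u x t\<close> is the value at position \<open>x\<close> and time \<open>t\<close>.
\<close>

definition continuous_in_L2 :: "real set \<Rightarrow> (real \<Rightarrow> real \<Rightarrow> real) \<Rightarrow> bool" where
  "continuous_in_L2 X u \<longleftrightarrow>
     (\<forall>t\<ge>0. in_L2 X (\<lambda>x. u x t)) \<and>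
     (\<forall>t0\<ge>0. ((\<lambda>t. L2_norm X (\<lambda>x. u x t - u x t0)) \<longlongrightarrow> 0) (at t0 within {0..}))"


subsection \<open>Kernels\<close>

definition kernel_domain :: "real \<Rightarrow> nat \<Rightarrow> (real \<times> real) set" where
  "kernel_domain L i =
     (if i = 1 then {(x, \<xi>). x \<in> road L 1 \<and> \<xi> \<in> road L 1 \<and> x \<le> \<xi>}
      else {(x, \<xi>). x \<in> road L 2 \<and> \<xi> \<in> road L 2 \<and> \<xi> \<le> x})"

definition bounded_measurable_on :: "(real \<times> real) set \<Rightarrow> (real \<Rightarrow> real \<Rightarrow> real) \<Rightarrow> bool" where
  "bounded_measurable_on T K \<longleftrightarrow>
     set_borel_measurable borel T (\<lambda>(x, \<xi>). K x \<xi>) \<and> (\<exists>B. \<forall>(x, \<xi>)\<in>T. \<bar>K x \<xi>\<bar> \<le> B)"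

text \<open>
  The system \<open>b \<partial>\<^sub>x Kvw - a \<partial>\<^sub>\<xi> Kvw = c(\<xi>) Kvv\<close>, \<open>\<partial>\<^sub>x Kvv + \<partial>\<^sub>\<xi> Kvv = 0\<close> on \<open>T\<close>,
  integrated along its characteristic directions \<open>(b, -a)\<close> and \<open>(1, 1)\<close>.  The equations are
  imposed on every characteristic, up to and including its end points on the boundary of \<open>T\<close>:
  the boundary conditions, and the traces at \<open>x = 0\<close> used by the feedback law, need
  pointwise values.
\<close>

definition kernel_equations ::
  "(real \<times> real) set \<Rightarrow> real \<Rightarrow> real \<Rightarrow> (real \<Rightarrow> real) \<Rightarrow>
   (real \<Rightarrow> real \<Rightarrow> real) \<Rightarrow> (real \<Rightarrow> real \<Rightarrow> real) \<Rightarrow> bool" where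
  "kernel_equations T b a c Kvw Kvv \<longleftrightarrow>
     (\<forall>x \<xi> s. (x, \<xi>) \<in> T \<and> 0 \<le> s \<and> (x + b * s, \<xi> - a * s) \<in> T \<longrightarrow>
        Kvw (x + b * s) (\<xi> - a * s) - Kvw x \<xi> =
        (LINT \<sigma>:{0..s}|lborel. c (\<xi> - a * \<sigma>) * Kvv (x + b * \<sigma>) (\<xi> - a * \<sigma>))) \<and>
     (\<forall>x \<xi> s. (x, \<xi>) \<in> T \<and> 0 \<le> s \<and> (x + s, \<xi> + s) \<in> T \<longrightarrow>
        Kvv (x + s) (\<xi> + s) = Kvv x \<xi>)"

definition is_kernel_solution ::
  "real \<Rightarrow> (nat \<Rightarrow> real) \<Rightarrow> (nat \<Rightarrow> real) \<Rightarrow> (nat \<Rightarrow> real) \<Rightarrow> (nat \<Rightarrow> real) \<Rightarrow>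
   (nat \<Rightarrow> real \<Rightarrow> real) \<Rightarrow>
   (nat \<Rightarrow> real \<Rightarrow> real \<Rightarrow> real) \<Rightarrow> (nat \<Rightarrow> real \<Rightarrow> real \<Rightarrow> real) \<Rightarrow> bool" where
  "is_kernel_solution L \<gamma> \<tau> v p c Kvw Kvv \<longleftrightarrow>
     (\<forall>i\<in>{1, 2}.
        bounded_measurable_on (kernel_domain L i) (Kvw i) \<and>
        bounded_measurable_on (kernel_domain L i) (Kvv i) \<and>
        kernel_equations (kernel_domain L i) (\<gamma> i * p i - v i) (v i) (c i) (Kvw i) (Kvv i)) \<and>
     (\<forall>x\<in>road L 1. Kvw 1 x x = c 1 x / (\<gamma> 1 * p 1)) \<and>
     (\<forall>x\<in>road L 2. Kvw 2 x x = - c 2 x / (\<gamma> 2 * p 2)) \<and>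
     (\<forall>x\<in>road L 1. Kvv 1 x L = - exp (L / (\<tau> 1 * v 1)) * Kvw 1 x L) \<and>
     (\<forall>x\<in>road L 2. Kvv 2 x (- L) = - exp (- L / (\<tau> 2 * v 2)) * Kvw 2 x (- L))"


subsection \<open>Mild solutions of the controlled system\<close>

text \<open>
  Mild solutions of \<open>\<partial>\<^sub>t u + a \<partial>\<^sub>x u = g\<close> on \<open>X \<times> [0,\<infinity>)\<close>, integrated along almost every
  characteristic \<open>x = y + a t\<close>, up to and including its end points on the boundary of
  \<open>X \<times> [0,\<infinity>)\<close>.  All lines \<open>t = const\<close> and (for \<open>a \<noteq> 0\<close>) \<open>x = const\<close> are
  transversal to the characteristics.  Hence, up to null sets, the restrictions of \<open>u\<close> to
  \<open>t = 0\<close> and to the end points of \<open>X\<close> are its initial value and its boundary traces.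
\<close>

definition mild_transport ::
  "real set \<Rightarrow> real \<Rightarrow> (real \<Rightarrow> real \<Rightarrow> real) \<Rightarrow> (real \<Rightarrow> real \<Rightarrow> real) \<Rightarrow> bool" where
  "mild_transport X a g u \<longleftrightarrow>
     set_borel_measurable borel (X \<times> {0..}) (\<lambda>(x, t). u x t) \<and>
     continuous_in_L2 X u \<and>
     (AE y in lborel. \<forall>s t. 0 \<le> s \<and> s \<le> t \<and> y + a * s \<in> X \<and> y + a * t \<in> X \<longrightarrow>
        set_integrable lborel {s..t} (\<lambda>\<sigma>. g (y + a * \<sigma>) \<sigma>) \<and>
        u (y + a * t) t - u (y + a * s) s = (LINT \<sigma>:{s..t}|lborel. g (y + a * \<sigma>) \<sigma>))"

definition is_mild_solution ::
  "real \<Rightarrow> real \<Rightarrow> (nat \<Rightarrow> real) \<Rightarrow> (nat \<Rightarrow> real) \<Rightarrow> (nat \<Rightarrow> real) \<Rightarrow> (nat \<Rightarrow> real) \<Rightarrow> (nat \<Rightarrow> real) \<Rightarrow>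
   (nat \<Rightarrow> real \<Rightarrow> real) \<Rightarrow> (real \<Rightarrow> real) \<Rightarrow>
   (nat \<Rightarrow> real \<Rightarrow> real) \<Rightarrow> (nat \<Rightarrow> real \<Rightarrow> real) \<Rightarrow>
   (nat \<Rightarrow> real \<Rightarrow> real \<Rightarrow> real) \<Rightarrow> (nat \<Rightarrow> real \<Rightarrow> real \<Rightarrow> real) \<Rightarrow> bool" where
  "is_mild_solution L q \<gamma> \<tau> v p r c U\<^sub>0 winit uinit w u \<longleftrightarrow>
     (\<forall>i\<in>{1, 2}.
        mild_transport (road L i) (v i) (\<lambda>x t. 0) (w i) \<and>
        mild_transport (road L i) (- (\<gamma> i * p i - v i)) (\<lambda>x t. c i x * w i x t) (u i) \<and>
        (AE x in lborel. x \<in> road L i \<longrightarrow> w i x 0 = winit i x \<and> u i x 0 = uinit i x)) \<and>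
     (AE t in lborel. 0 \<le> t \<longrightarrow>
        u 1 L t = r 1 * exp (- L / (\<tau> 1 * v 1)) * w 1 L t \<and>
        w 1 0 t = w 2 0 t \<and>
        w 2 (- L) t = exp (- L / (\<tau> 2 * v 2)) * (1 / r 2) * u 2 (- L) t \<and>
        u 2 0 t = r 2 / r 1 * u 1 0 t + (r 1 - r 2) / (1 - r 1) * w 2 0 t
                  + v 2 * (1 - r 2) / q * U\<^sub>0 t)"

definition feedback_law ::
  "real \<Rightarrow> real \<Rightarrow> (nat \<Rightarrow> real) \<Rightarrow> (nat \<Rightarrow> real) \<Rightarrow>
   (nat \<Rightarrow> real \<Rightarrow> real \<Rightarrow> real) \<Rightarrow> (nat \<Rightarrow> real \<Rightarrow> real \<Rightarrow> real) \<Rightarrow>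
   (nat \<Rightarrow> real \<Rightarrow> real \<Rightarrow> real) \<Rightarrow> (nat \<Rightarrow> real \<Rightarrow> real \<Rightarrow> real) \<Rightarrow> real \<Rightarrow> real" where
  "feedback_law L q v r Kvw Kvv w u t =
     q / (v 2 * (1 - r 2)) *
       ((LINT \<xi>:road L 2|lborel. Kvw 2 0 \<xi> * w 2 \<xi> t + Kvv 2 0 \<xi> * u 2 \<xi> t)
        - r 2 / r 1 * (LINT \<xi>:road L 1|lborel. Kvw 1 0 \<xi> * w 1 \<xi> t + Kvv 1 0 \<xi> * u 1 \<xi> t))"

end

theory Submission
  imports Defs
begin

text \<open>
  On each road \<open>w\<close> is constant along its characteristics, so it is described by one profile \<open>G\<close>, its
  inflow boundary value as a function of time, continued to negative times by the initial value.  The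
  coordinate \<open>u\<close> is recovered from \<open>G\<close> by integrating the source along its own characteristics.
  Instead of establishing the target system of the backstepping transformation, it suffices to
  know the transformed coordinate at \<open>x = 0\<close>: it equals \<open>u\<close> at the other end of the road, one transit
  time earlier (downstream) or later (upstream).  In terms of \<open>G\<close> this is a linear identity which,
  after Fubini, reduces to the kernel equation integrated along each characteristic from the diagonal
  to the boundary.  The feedback law then turns the closed loop into the scalar delay equation
  \<open>G\<^sub>2(t) = \<alpha> G\<^sub>2(t - \<theta>\<^sub>1) + \<beta> G\<^sub>2(t - \<theta>\<^sub>2)\<close>, whose coefficients are the gains of the two cycles of the matrix in the
  hypothesis.  Its \<open>Sp\<^sub>1\<close> being less than \<open>1\<close> forces \<open>\<bar>\<alpha>\<bar> + \<bar>\<beta>\<bar> < 1\<close>, hence \<open>exp (\<mu> t / 2) G\<^sub>2(t)\<close> is square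
  integrable for some \<open>\<mu> > 0\<close>, and all norms decay.
\<close>

section \<open>Integrals over intervals\<close>

text \<open>The kernels are chosen so that \<open>u\<close> minus the kernel integral is transported
  freely, and the integral vanishes at the end of the road away from the junction. At x = L, where
  \<open>u\<close> enters, this gives the earlier time; at x = -L, where \<open>u\<close> leaves,
  the later one. The feedback removes both integrals from the junction condition, so each remaining
  term is a shifted value of a profile. The two delays are round trips:
  \<open>\<theta>\<^sub>1\<close> adds the four travel times of the loop through both roads,
  \<open>\<theta>\<^sub>2\<close> the two travel times on the incoming road. Solutions are known
  only almost everywhere, hence the affine substitutions of non-zero slope that carry statements
  from labels of characteristics to positions and times. On the incoming road all of
  \<open>u\<close> is read off at its later exit; on the outgoing road the initial values of
  \<open>u\<close> persist up to one transit time, unseen by the profile, and there continuity in L2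
  supplies the bound.\<close>

lemma AE_lborel_affine:
  fixes t c :: real
  assumes "c \<noteq> 0" and "AE x in lborel. P x"
  shows "AE x in lborel. P (t + c * x)"
proof -
  obtain N where N: "{x. \<not> P x} \<subseteq> N" "N \<in> sets borel" "emeasure lborel N = 0"
    using assms(2) by (elim AE_E) auto
  have "{x. t + c * x \<in> N} \<in> sets lborel"
    using N(2) by measurable
  moreover have "emeasure lborel {x. t + c * x \<in> N} = 0"
  proof -
    have "0 = (\<integral>\<^sup>+x. indicator N x \<partial>lborel)"
      using N by simp
    also have "\<dots> = ennreal \<bar>c\<bar> * (\<integral>\<^sup>+x. indicator N (t + c * x) \<partial>lborel)"
      using N by (subst nn_integral_real_affine[OF _ assms(1), of _ t]) auto
    also have "(\<integral>\<^sup>+x. indicator N (t + c * x) \<partial>lborel)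
        = (\<integral>\<^sup>+x. indicator {x. t + c * x \<in> N} x \<partial>lborel)"
      by (intro nn_integral_cong) (auto simp: indicator_def)
    also have "\<dots> = emeasure lborel {x. t + c * x \<in> N}"
      using \<open>{x. t + c * x \<in> N} \<in> sets lborel\<close> by (rule nn_integral_indicator)
    finally show ?thesis
      using assms(1) by simp
  qed
  ultimately show ?thesis
    using N(1) by (intro AE_I[of _ _ "{x. t + c * x \<in> N}"]) auto
qed

lemma set_integral_affine:
  fixes f :: "real \<Rightarrow> real"
  assumes "c \<noteq> 0" and "\<And>x. t + c * x \<in> B \<longleftrightarrow> x \<in> A"
  shows "(LINT y:B|lborel. f y) = \<bar>c\<bar> * (LINT x:A|lborel. f (t + c * x))"
  using assms unfolding set_lebesgue_integral_def
  by (subst lborel_integral_real_affine[OF assms(1), of _ t]) (simp add: indicator_def)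

lemma set_integrable_affine:
  fixes f :: "real \<Rightarrow> real"
  assumes "c \<noteq> 0" and "\<And>x. t + c * x \<in> B \<longleftrightarrow> x \<in> A"
  shows "set_integrable lborel A (\<lambda>x. f (t + c * x)) \<longleftrightarrow> set_integrable lborel B f"
  using assms unfolding set_integrable_def
  by (subst lborel_integrable_real_affine_iff[OF assms(1), of _ t, symmetric])
     (simp add: indicator_def)

lemma L2_norm_square:
  "in_L2 X f \<Longrightarrow> (L2_norm X f)\<^sup>2 = (LINT x:X|lborel. (f x)\<^sup>2)"
  unfolding L2_norm_def set_lebesgue_integral_def
  by (subst real_sqrt_pow2) (auto intro!: Bochner_Integration.integral_nonneg)

lemma set_integral_nonneg_real:
  fixes f :: "real \<Rightarrow> real"
  assumes "\<And>x. 0 \<le> f x"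
  shows "0 \<le> (LINT x:A|lborel. f x)"
  unfolding set_lebesgue_integral_def using assms by (intro Bochner_Integration.integral_nonneg) simp

lemma set_integral_mono_set:
  fixes f :: "real \<Rightarrow> real"
  assumes "set_integrable lborel B f" "set_integrable lborel A f" "A \<subseteq> B" "\<And>x. 0 \<le> f x"
  shows "(LINT x:A|lborel. f x) \<le> (LINT x:B|lborel. f x)"
  unfolding set_lebesgue_integral_def using assms
  by (intro integral_mono) (auto simp: set_integrable_def indicator_def)

lemma set_integrable_mult_bounded:
  fixes g V :: "real \<Rightarrow> real"
  assumes "set_integrable lborel A V" "g \<in> borel_measurable borel"
    and "\<And>x. x \<in> A \<Longrightarrow> \<bar>g x\<bar> \<le> M"
  shows "set_integrable lborel A (\<lambda>x. g x * V x)"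
proof -
  have "integrable lborel (\<lambda>x. M * (indicator A x *\<^sub>R V x))"
    using assms(1) unfolding set_integrable_def by simp
  then show ?thesis unfolding set_integrable_def
  proof (rule Bochner_Integration.integrable_bound)
    have "(\<lambda>x. g x * (indicator A x *\<^sub>R V x)) \<in> borel_measurable lborel"
      using assms(2) borel_measurable_integrable[OF assms(1)[unfolded set_integrable_def]]
      by (intro borel_measurable_times) auto
    then show "(\<lambda>x. indicator A x *\<^sub>R (g x * V x)) \<in> borel_measurable lborel"
      by (simp add: mult.left_commute)
    show "AE x in lborel. norm (indicator A x *\<^sub>R (g x * V x)) \<le> norm (M * (indicator A x *\<^sub>R V x))"
    proof (intro AE_I2)
      fix x
      show "norm (indicator A x *\<^sub>R (g x * V x)) \<le> norm (M * (indicator A x *\<^sub>R V x))"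
        using assms(3)[of x] by (auto simp: indicator_def abs_mult intro!: mult_right_mono)
    qed
  qed
qed

text \<open>The interval has finite length, so 1 + y^2 \<ge> |y| is an integrable majorant.\<close>

lemma set_integrable_of_square:
  fixes V :: "real \<Rightarrow> real"
  assumes "V \<in> borel_measurable borel" "set_integrable lborel {l..h} (\<lambda>x. (V x)\<^sup>2)"
  shows "set_integrable lborel {l..h} V"
proof (rule set_integrable_bound)
  have "set_integrable lborel {l..h} (\<lambda>_. 1 :: real)"
    using borel_integrable_atLeastAtMost'[of l h "\<lambda>_. 1"] by simp
  then show "set_integrable lborel {l..h} (\<lambda>x. 1 + (V x)\<^sup>2)"
    using assms(2) by (intro set_integral_add)
  show "set_borel_measurable lborel {l..h} V"
    using assms(1) unfolding set_borel_measurable_def by measurable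
  have "\<bar>y\<bar> \<le> 1 + y\<^sup>2" for y :: real
  proof -
    have "0 \<le> (\<bar>y\<bar> - 1/2)\<^sup>2" by simp
    then show ?thesis by (simp add: power2_eq_square algebra_simps)
  qed
  then show "AE x in lborel. x \<in> {l..h} \<longrightarrow> norm (V x) \<le> norm (1 + (V x)\<^sup>2)"
    by (intro AE_I2) (simp add: abs_of_nonneg add_nonneg_nonneg)
qed

lemma Cauchy_Schwarz_interval:
  fixes V :: "real \<Rightarrow> real"
  assumes "l < h" "V \<in> borel_measurable borel" "set_integrable lborel {l..h} (\<lambda>x. (V x)\<^sup>2)"
  shows "(LINT x:{l..h}|lborel. \<bar>V x\<bar>)\<^sup>2 \<le> (h - l) * (LINT x:{l..h}|lborel. (V x)\<^sup>2)"
proof -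
  let ?I = "LINT x:{l..h}|lborel. \<bar>V x\<bar>"
  \<comment> \<open>\<open>m\<close> is the mean of |V|; expanding the nonnegative integral of (|V|
    - m)^2 leaves exactly the Cauchy-Schwarz inequality.\<close>
  define m where "m = ?I / (h - l)"
  have 1: "set_integrable lborel {l..h} (\<lambda>x. \<bar>V x\<bar>)"
    using set_integrable_of_square[OF assms(2,3)] by (rule set_integrable_abs)
  have 2: "set_integrable lborel {l..h} (\<lambda>_. m\<^sup>2)"
    using borel_integrable_atLeastAtMost'[of l h "\<lambda>_. m\<^sup>2"] by simp
  have c: "(LINT x:{l..h}|lborel. m\<^sup>2) = (h - l) * m\<^sup>2"
    using assms(1) by (simp add: set_lebesgue_integral_def)
  have "0 \<le> (LINT x:{l..h}|lborel. (\<bar>V x\<bar> - m)\<^sup>2)"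
    by (rule set_integral_nonneg_real) simp
  also have "\<dots> = (LINT x:{l..h}|lborel. ((V x)\<^sup>2 + m\<^sup>2) - 2 * m * \<bar>V x\<bar>)"
    by (simp add: power2_diff algebra_simps)
  also have "\<dots> = (LINT x:{l..h}|lborel. (V x)\<^sup>2) + (h - l) * m\<^sup>2 - 2 * m * ?I"
    using 1 2 assms(3) by (simp add: set_integral_diff set_integral_add c)
  also have "\<dots> = (LINT x:{l..h}|lborel. (V x)\<^sup>2) - ?I\<^sup>2 / (h - l)"
  proof -
    have "?I = m * (h - l)" using assms(1) by (simp add: m_def)
    then show ?thesis using assms(1) by (simp add: power2_eq_square)
  qed
  finally show ?thesis using assms(1) by (simp add: field_simps)
qed

text \<open>Monotone convergence along integer end points. It turns a bound on the weighted energy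
  that is uniform over finite windows into a finite total energy.\<close>

lemma set_integrable_atLeast_bounded:
  fixes f :: "real \<Rightarrow> real"
  assumes "\<And>T. set_integrable lborel {t0..T} f" "\<And>t. 0 \<le> f t"
    and "\<And>T. (LINT t:{t0..T}|lborel. f t) \<le> C"
  shows "set_integrable lborel {t0..} f"
proof -
  have U: "(\<Union>n::nat. {t0..real n}) = {t0..}"
    by (auto intro: real_arch_simple)
  have inc: "incseq (\<lambda>n::nat. {t0..real n})"
    by (auto simp: incseq_def)
  have "convergent (\<lambda>n::nat. LINT t:{t0..real n}|lborel. f t)"
  proof (rule Bseq_monoseq_convergent)
    have m: "(LINT t:{t0..real m}|lborel. f t) \<le> (LINT t:{t0..real n}|lborel. f t)" if "m \<le> n" for m n
      using assms(1)[of "real m"] assms(1)[of "real n"] assms(2) that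
      unfolding set_lebesgue_integral_def
      by (intro integral_mono) (auto simp: set_integrable_def indicator_def)
    then show "monoseq (\<lambda>n::nat. LINT t:{t0..real n}|lborel. f t)"
      by (auto simp: monoseq_def)
    have "0 \<le> (LINT t:{t0..T}|lborel. f t)" for T
      unfolding set_lebesgue_integral_def using assms(2)
      by (intro Bochner_Integration.integral_nonneg) simp
    then show "Bseq (\<lambda>n::nat. LINT t:{t0..real n}|lborel. f t)"
      using assms(3) by (intro BseqI'[of _ C]) simp
  qed
  then obtain l where l: "(\<lambda>n::nat. LINT t:{t0..real n}|lborel. f t) \<longlonglongrightarrow> l"
    by (auto simp: convergent_def)
  show ?thesis unfolding set_integrable_def
  proof (rule integrable_monotone_convergence)
    show "integrable lborel (\<lambda>x. indicator {t0..real i} x *\<^sub>R f x)" for i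
      using assms(1)[of "real i"] by (simp add: set_integrable_def)
    show "AE x in lborel. mono (\<lambda>n. indicator {t0..real n} x *\<^sub>R f x)"
      using assms(2) by (intro AE_I2) (auto simp: mono_def indicator_def)
    show "AE x in lborel. (\<lambda>i. indicator {t0..real i} x *\<^sub>R f x) \<longlonglongrightarrow> indicator {t0..} x *\<^sub>R f x"
    proof (intro AE_I2 tendsto_eventually)
      fix x :: real
      obtain n :: nat where "x \<le> real n" using real_arch_simple by blast
      then show "\<forall>\<^sub>F i in sequentially. indicator {t0..real i} x *\<^sub>R f x = indicator {t0..} x *\<^sub>R f x"
        by (intro eventually_sequentiallyI[of n]) (auto simp: indicator_def)
    qed
    show "(\<lambda>i. \<integral>x. indicator {t0..real i} x *\<^sub>R f x \<partial>lborel) \<longlonglongrightarrow> l"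
      using l by (simp add: set_lebesgue_integral_def)
    show "(\<lambda>x. indicator {t0..} x *\<^sub>R f x) \<in> borel_measurable lborel"
    proof (rule borel_measurable_LIMSEQ_real)
      show "(\<lambda>i. indicator {t0..real i} x *\<^sub>R f x) \<longlonglongrightarrow> indicator {t0..} x *\<^sub>R f x" for x
      proof (intro tendsto_eventually)
        obtain n :: nat where "x \<le> real n" using real_arch_simple by blast
        then show "\<forall>\<^sub>F i in sequentially. indicator {t0..real i} x *\<^sub>R f x = indicator {t0..} x *\<^sub>R f x"
          by (intro eventually_sequentiallyI[of n]) (auto simp: indicator_def)
      qed
      show "(\<lambda>x. indicator {t0..real i} x *\<^sub>R f x) \<in> borel_measurable lborel" for i
        using assms(1)[of "real i"] unfolding set_integrable_def by (rule borel_measurable_integrable)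
    qed
  qed
qed

text \<open>Supplies the dominating function for Fubini in the kernel computation.\<close>

lemma integrable_lborel_pair_mult:
  fixes g h :: "real \<Rightarrow> real"
  assumes "integrable lborel g" "integrable lborel h"
  shows "integrable (lborel \<Otimes>\<^sub>M lborel) (\<lambda>(x, y). g x * h y)"
proof (rule lborel_pair.Fubini_integrable)
  have [measurable]: "g \<in> borel_measurable borel" "h \<in> borel_measurable borel"
    using assms[THEN borel_measurable_integrable] by auto
  show "(\<lambda>(x, y). g x * h y) \<in> borel_measurable (lborel \<Otimes>\<^sub>M lborel)"
    by measurable
  show "integrable lborel (\<lambda>x. \<integral>y. norm (case (x, y) of (x, y) \<Rightarrow> g x * h y) \<partial>lborel)"
    using assms by (simp add: abs_mult)
  show "AE x in lborel. integrable lborel (\<lambda>y. case (x, y) of (x, y) \<Rightarrow> g x * h y)"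
    using assms by simp
qed

section \<open>Delay equations\<close>

text \<open>By convexity (\<alpha> x + \<beta> y)^2 \<le> (|\<alpha>| + |\<beta>|) (|\<alpha>| x^2 +
  |\<beta>| y^2), so the gain |\<alpha>| + |\<beta>| enters the energy twice. One factor pays for
  the weight lost in shifting by a delay, the other remains as a contraction. The condition on
  \<open>t1\<close> keeps both delayed arguments above \<open>t0\<close>, where \<open>G\<close> is
  locally square integrable.\<close>

lemma delay_equation_bound:
  fixes G :: "real \<Rightarrow> real"
  assumes G: "\<And>T. set_integrable lborel {t0..T} (\<lambda>t. (G t)\<^sup>2)"
    and meas: "G \<in> borel_measurable borel"
    and t1: "t0 + \<theta>1 \<le> t1" "0 < \<theta>2" "\<theta>2 \<le> \<theta>1"
    and eq: "AE t in lborel. t1 \<le> t \<longrightarrow> G t = \<alpha> * G (t - \<theta>1) + \<beta> * G (t - \<theta>2)"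
    and lt: "\<bar>\<alpha>\<bar> + \<bar>\<beta>\<bar> < 1"
  shows "\<exists>\<mu> C. 0 < \<mu> \<and> (\<forall>T. (LINT t:{t0..T}|lborel. exp (\<mu> * t) * (G t)\<^sup>2) \<le> C)"
proof -
  \<comment> \<open>The lower bound 1/2 keeps \<open>\<delta>\<close> positive when both
    coefficients vanish, so that ln (1 / \<delta>) is meaningful.\<close>
  define \<delta> where "\<delta> = max (1/2) (\<bar>\<alpha>\<bar> + \<bar>\<beta>\<bar>)"
  have \<delta>: "0 < \<delta>" "\<delta> < 1" "\<bar>\<alpha>\<bar> + \<bar>\<beta>\<bar> \<le> \<delta>"
    using lt by (auto simp: \<delta>_def)
  \<comment> \<open>The rate at which the weight grows by exactly 1 / \<delta> over the longest
    delay \<open>\<theta>1\<close>; the shorter delay costs less.\<close>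
  define \<mu> where "\<mu> = ln (1 / \<delta>) / \<theta>1"
  have \<theta>1: "0 < \<theta>1" using t1 by simp
  have \<mu>: "0 < \<mu>" "exp (\<mu> * \<theta>1) = 1 / \<delta>"
    using \<delta> \<theta>1 by (auto simp: \<mu>_def divide_simps)
  define J where "J = (\<lambda>T. LINT t:{t0..T}|lborel. exp (\<mu> * t) * (G t)\<^sup>2)"
  have int: "set_integrable lborel {s..T} (\<lambda>t. exp (\<mu> * t) * (G t)\<^sup>2)" if "t0 \<le> s" for s T
  proof (rule set_integrable_bound)
    have "set_integrable lborel {s..T} (\<lambda>t. (G t)\<^sup>2)"
      using that by (intro set_integrable_subset[OF G[of T]]) auto
    then show "set_integrable lborel {s..T} (\<lambda>t. exp (\<mu> * T) * (G t)\<^sup>2)"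
      by simp
    show "set_borel_measurable lborel {s..T} (\<lambda>t. exp (\<mu> * t) * (G t)\<^sup>2)"
      using meas unfolding set_borel_measurable_def by measurable
    show "AE x in lborel. x \<in> {s..T} \<longrightarrow>
        norm (exp (\<mu> * x) * (G x)\<^sup>2) \<le> norm (exp (\<mu> * T) * (G x)\<^sup>2)"
      using \<mu> by (intro AE_I2) (auto simp: abs_mult intro!: mult_right_mono)
  qed
  have nonneg: "0 \<le> (LINT t:A|lborel. exp (\<mu> * t) * (G t)\<^sup>2)" for A
    unfolding set_lebesgue_integral_def by (intro Bochner_Integration.integral_nonneg) simp
  have mono: "(LINT t:{s..T}|lborel. exp (\<mu> * t) * (G t)\<^sup>2) \<le> J T'" if "t0 \<le> s" "T \<le> T'" for s T T'
    unfolding J_def set_lebesgue_integral_def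
    using int[OF that(1), of T] int[of t0 T'] that
    by (intro integral_mono) (auto simp: set_integrable_def indicator_def)
  have shift: "set_integrable lborel {t1..T} (\<lambda>t. exp (\<mu> * t) * (G (t - \<theta>))\<^sup>2)"
    "(LINT t:{t1..T}|lborel. exp (\<mu> * t) * (G (t - \<theta>))\<^sup>2) \<le> 1 / \<delta> * J T"
    if "0 < \<theta>" "\<theta> \<le> \<theta>1" for \<theta> T
  proof -
    have e: "exp (\<mu> * t) * (G (t - \<theta>))\<^sup>2
        = exp (\<mu> * \<theta>) * (exp (\<mu> * (- \<theta> + 1 * t)) * (G (- \<theta> + 1 * t))\<^sup>2)" for t
      by (simp add: exp_add[symmetric] algebra_simps)
    have s: "(- \<theta> + 1 * x \<in> {t1 - \<theta>..T - \<theta>}) \<longleftrightarrow> x \<in> {t1..T}" for x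
      by auto
    have t0: "t0 \<le> t1 - \<theta>" using t1 that by simp
    have "set_integrable lborel {t1..T} (\<lambda>t. exp (\<mu> * (- \<theta> + 1 * t)) * (G (- \<theta> + 1 * t))\<^sup>2)"
      using int[OF t0, of "T - \<theta>"]
      by (subst set_integrable_affine[OF _ s, of "\<lambda>t. exp (\<mu> * t) * (G t)\<^sup>2"]) auto
    then show "set_integrable lborel {t1..T} (\<lambda>t. exp (\<mu> * t) * (G (t - \<theta>))\<^sup>2)"
      unfolding e by simp
    have "(LINT t:{t1..T}|lborel. exp (\<mu> * t) * (G (t - \<theta>))\<^sup>2)
        = exp (\<mu> * \<theta>) * (LINT t:{t1 - \<theta>..T - \<theta>}|lborel. exp (\<mu> * t) * (G t)\<^sup>2)"
      unfolding e
      by (subst set_integral_affine[OF _ s, of "\<lambda>t. exp (\<mu> * t) * (G t)\<^sup>2"]) auto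
    also have "\<dots> \<le> exp (\<mu> * \<theta>1) * J T"
      using that \<mu>(1) nonneg by (intro mult_mono mono t0) auto
    finally show "(LINT t:{t1..T}|lborel. exp (\<mu> * t) * (G (t - \<theta>))\<^sup>2) \<le> 1 / \<delta> * J T"
      using \<mu> by simp
  qed
  have rec: "J T \<le> J t1 + \<delta> * J T" if "t1 \<le> T" for T
  proof -
    let ?g = "\<lambda>t. exp (\<mu> * t) * (G t)\<^sup>2"
    let ?h = "\<lambda>t. \<bar>\<alpha>\<bar> * (exp (\<mu> * t) * (G (t - \<theta>1))\<^sup>2) + \<bar>\<beta>\<bar> * (exp (\<mu> * t) * (G (t - \<theta>2))\<^sup>2)"
    have t01: "t0 \<le> t1" using t1 by simp
    have split: "J T = J t1 + (LINT t:{t1..T}|lborel. ?g t)"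
    proof -
      have "{t0..T} = {t0..t1} \<union> {t1..T}" using t01 that by auto
      then show ?thesis
        unfolding J_def using int[of t0 t1] int[OF t01, of T]
        by (simp, intro set_integral_Un_AE) (auto intro!: AE_I[of _ _ "{t1}"])
    qed
    have contract: "(LINT t:{t1..T}|lborel. ?g t) \<le> (LINT t:{t1..T}|lborel. \<delta> * ?h t)"
    proof (rule set_integral_mono_AE)
      show "set_integrable lborel {t1..T} ?g" using int[OF t01] .
      show "set_integrable lborel {t1..T} (\<lambda>t. \<delta> * ?h t)"
        using shift(1)[of \<theta>1 T] shift(1)[of \<theta>2 T] t1 by (auto intro!: set_integral_add)
      show "AE t\<in>{t1..T} in lborel. ?g t \<le> \<delta> * ?h t"
        using eq
      proof (eventually_elim, intro impI)
        fix t assume a: "t1 \<le> t \<longrightarrow> G t = \<alpha> * G (t - \<theta>1) + \<beta> * G (t - \<theta>2)" "t \<in> {t1..T}"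
        let ?x = "G (t - \<theta>1)" and ?y = "G (t - \<theta>2)"
        \<comment> \<open>The defect in the weighted Cauchy-Schwarz inequality for two terms,
          written as one square.\<close>
        have "(\<bar>\<alpha>\<bar> + \<bar>\<beta>\<bar>) * (\<bar>\<alpha>\<bar> * ?x\<^sup>2 + \<bar>\<beta>\<bar> * ?y\<^sup>2) - (\<bar>\<alpha>\<bar> * \<bar>?x\<bar> + \<bar>\<beta>\<bar> * \<bar>?y\<bar>)\<^sup>2
            = \<bar>\<alpha>\<bar> * \<bar>\<beta>\<bar> * (\<bar>?x\<bar> - \<bar>?y\<bar>)\<^sup>2"
          by (simp add: power2_eq_square algebra_simps)
        moreover have "0 \<le> \<bar>\<alpha>\<bar> * \<bar>\<beta>\<bar> * (\<bar>?x\<bar> - \<bar>?y\<bar>)\<^sup>2" by simp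
        moreover have "(\<alpha> * ?x + \<beta> * ?y)\<^sup>2 \<le> (\<bar>\<alpha>\<bar> * \<bar>?x\<bar> + \<bar>\<beta>\<bar> * \<bar>?y\<bar>)\<^sup>2"
        proof -
          have "\<bar>\<alpha> * ?x + \<beta> * ?y\<bar> \<le> \<bar>\<alpha>\<bar> * \<bar>?x\<bar> + \<bar>\<beta>\<bar> * \<bar>?y\<bar>"
            using abs_triangle_ineq[of "\<alpha> * ?x" "\<beta> * ?y"] by (simp only: abs_mult)
          from power_mono[OF this abs_ge_zero, of 2] show ?thesis by (simp only: power2_abs)
        qed
        moreover have "(\<bar>\<alpha>\<bar> + \<bar>\<beta>\<bar>) * (\<bar>\<alpha>\<bar> * ?x\<^sup>2 + \<bar>\<beta>\<bar> * ?y\<^sup>2) \<le> \<delta> * (\<bar>\<alpha>\<bar> * ?x\<^sup>2 + \<bar>\<beta>\<bar> * ?y\<^sup>2)"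
          using \<delta> by (intro mult_right_mono) auto
        ultimately have "(G t)\<^sup>2 \<le> \<delta> * (\<bar>\<alpha>\<bar> * ?x\<^sup>2 + \<bar>\<beta>\<bar> * ?y\<^sup>2)"
          using a by (simp only: atLeastAtMost_iff)
        then have "exp (\<mu> * t) * (G t)\<^sup>2 \<le> exp (\<mu> * t) * (\<delta> * (\<bar>\<alpha>\<bar> * ?x\<^sup>2 + \<bar>\<beta>\<bar> * ?y\<^sup>2))"
          by (intro mult_left_mono) auto
        then show "?g t \<le> \<delta> * ?h t"
          by (simp add: algebra_simps)
      qed
    qed
    have "(LINT t:{t1..T}|lborel. \<delta> * ?h t) = \<delta> *
         (\<bar>\<alpha>\<bar> * (LINT t:{t1..T}|lborel. exp (\<mu> * t) * (G (t - \<theta>1))\<^sup>2)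
        + \<bar>\<beta>\<bar> * (LINT t:{t1..T}|lborel. exp (\<mu> * t) * (G (t - \<theta>2))\<^sup>2))"
      using shift(1)[of \<theta>1 T] shift(1)[of \<theta>2 T] t1 by (simp add: set_integral_add)
    also have "\<dots> \<le> \<delta> * (\<bar>\<alpha>\<bar> * (1 / \<delta> * J T) + \<bar>\<beta>\<bar> * (1 / \<delta> * J T))"
      using shift(2)[of \<theta>1 T] shift(2)[of \<theta>2 T] t1 \<delta>
      by (intro mult_left_mono add_mono) auto
    also have "\<dots> = (\<bar>\<alpha>\<bar> + \<bar>\<beta>\<bar>) * J T"
      using \<delta> by (simp add: algebra_simps)
    also have "\<dots> \<le> \<delta> * J T"
      using \<delta> nonneg by (intro mult_right_mono) (auto simp: J_def)
    finally show ?thesis using split contract by linarith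
  qed
  have "J T \<le> J t1 / (1 - \<delta>)" for T
  proof -
    \<comment> \<open>\<open>rec\<close> requires an end point beyond \<open>t1\<close>; smaller end
      points follow because \<open>J\<close> is monotone.\<close>
    have "J T \<le> J (max t1 T)" unfolding J_def using mono[of t0 T "max t1 T"] by (simp add: J_def)
    also have "J (max t1 T) \<le> J t1 / (1 - \<delta>)"
      using rec[of "max t1 T"] \<delta> by (simp add: field_simps)
    finally show ?thesis .
  qed
  then show ?thesis using \<mu>(1) unfolding J_def by blast
qed

section \<open>The quantity $\mathrm{Sp}_1$\<close>

text \<open>The infimum need not be attained, but some admissible \<open>D\<close> already has norm
  below 1. Applying its operator to \<open>D *v x\<close> removes the inverse and leaves a
  contraction of \<open>H\<close> in the Euclidean norm with weights \<open>d\<close>.\<close>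

lemma Sp1_lessE:
  fixes H :: "real ^ 'n ^ 'n"
  assumes "Sp1 H < 1"
  obtains d :: "'n \<Rightarrow> real" and \<kappa> where "\<And>i. 0 < d i" "0 \<le> \<kappa>" "\<kappa> < 1"
    "\<And>x. (\<Sum>i\<in>UNIV. (d i * (H *v x) $ i)\<^sup>2) \<le> \<kappa>\<^sup>2 * (\<Sum>i\<in>UNIV. (d i * x $ i)\<^sup>2)"
proof -
  have "mat 1 \<in> (pos_diag :: (real^'n^'n) set)"
    by (simp add: pos_diag_def mat_def)
  then have ne: "{onorm (\<lambda>x. (D ** H ** matrix_inv D) *v x) | D. D \<in> pos_diag} \<noteq> {}"
    by blast
  obtain D where D: "D \<in> pos_diag" and lt: "onorm (\<lambda>x. (D ** H ** matrix_inv D) *v x) < 1"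
    using cInf_lessD[OF ne] assms unfolding Sp1_def by blast
  let ?\<kappa> = "onorm (\<lambda>x. (D ** H ** matrix_inv D) *v x)"
  have Dv: "(D *v x) $ i = D $ i $ i * x $ i" for x i
  proof -
    have "(D *v x) $ i = (\<Sum>j\<in>UNIV. if j = i then D $ i $ i * x $ i else 0)"
      unfolding matrix_vector_mult_def vec_lambda_beta using D unfolding pos_diag_def
      by (intro sum.cong) auto
    then show ?thesis by simp
  qed
  have bl: "bounded_linear (\<lambda>x. (D ** H ** matrix_inv D) *v x)"
    by (simp add: linear_linear matrix_vector_mul_linear)
  \<comment> \<open>A trivial kernel makes \<open>D\<close> invertible; only then does the choice
    behind \<open>matrix_inv\<close> yield a genuine inverse.\<close>
  have "D *v x = 0 \<Longrightarrow> x = 0" for x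
    using D by (auto simp: vec_eq_iff Dv pos_diag_def) (metis less_irrefl)
  then have "invertible D"
    by (metis invertible_left_inverse matrix_left_invertible_ker)
  then have inv: "matrix_inv D ** D = mat 1"
    unfolding invertible_def matrix_inv_def by (rule someI2_ex) auto
  have "norm (D *v (H *v x)) \<le> ?\<kappa> * norm (D *v x)" for x
  proof -
    have "(D ** H ** matrix_inv D) *v (D *v x) = (D ** H ** (matrix_inv D ** D)) *v x"
      by (simp add: matrix_vector_mul_assoc matrix_mul_assoc)
    also have "\<dots> = D *v (H *v x)"
      by (simp add: inv matrix_vector_mul_assoc)
    finally show ?thesis using onorm[OF bl, of "D *v x"] by simp
  qed
  then have "(norm (D *v (H *v x)))\<^sup>2 \<le> (?\<kappa> * norm (D *v x))\<^sup>2" for x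
    by (intro power_mono) auto
  then have "(\<Sum>i\<in>UNIV. (D $ i $ i * (H *v x) $ i)\<^sup>2) \<le> ?\<kappa>\<^sup>2 * (\<Sum>i\<in>UNIV. (D $ i $ i * x $ i)\<^sup>2)" for x
    by (simp add: norm_vec_def L2_set_def Dv power_mult_distrib sum_nonneg)
  moreover have "0 < D $ i $ i" for i using D by (simp add: pos_diag_def)
  ultimately show thesis using that[of "\<lambda>i. D $ i $ i" ?\<kappa>] lt onorm_pos_le[OF bl] by blast
qed

lemma vector_4:
  "(vector [x, y, z, t] :: 'a::zero ^ 4) $ 1 = x"
  "(vector [x, y, z, t] :: 'a ^ 4) $ 2 = y"
  "(vector [x, y, z, t] :: 'a ^ 4) $ 3 = z"
  "(vector [x, y, z, t] :: 'a ^ 4) $ 4 = t"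
  unfolding vector_def by simp_all

text \<open>The matrix sends the values arriving at the road ends, (w1(L), u2(-L), u1(0), w2(0)), to
  those leaving them, (w1(0), u2(0), u1(L), w2(-L)). Its two cycles have gains h * \<rho>1 / \<rho>2
  and k / \<rho>2. Test vectors bound the entries by ratios of weights; around each cycle the ratios
  cancel and leave \<open>\<kappa>\<close> * \<open>\<kappa>\<close>.\<close>

lemma Sp1_cycle_gain:
  fixes h k \<rho>1 \<rho>2 :: real
  assumes "Sp1 (vector [vector [0, 0, 0, 1], vector [0, 0, h, k],
      vector [\<rho>1, 0, 0, 0], vector [0, 1 / \<rho>2, 0, 0]] :: real ^ 4 ^ 4) < 1"
  shows "\<bar>h * \<rho>1 / \<rho>2\<bar> + \<bar>k / \<rho>2\<bar> < 1"
proof -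
  let ?H = "vector [vector [0, 0, 0, 1], vector [0, 0, h, k],
      vector [\<rho>1, 0, 0, 0], vector [0, 1 / \<rho>2, 0, 0]] :: real ^ 4 ^ 4"
  obtain d :: "4 \<Rightarrow> real" and \<kappa> where d: "\<And>i. 0 < d i" and \<kappa>: "0 \<le> \<kappa>" "\<kappa> < 1" and
    H: "\<And>x. (\<Sum>i\<in>UNIV. (d i * (?H *v x) $ i)\<^sup>2) \<le> \<kappa>\<^sup>2 * (\<Sum>i\<in>UNIV. (d i * x $ i)\<^sup>2)"
    using Sp1_lessE[OF assms] by blast
  have key: "(d 1 * x4)\<^sup>2 + (d 2 * (h * x3 + k * x4))\<^sup>2 + (d 3 * (\<rho>1 * x1))\<^sup>2 + (d 4 * (x2 / \<rho>2))\<^sup>2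
      \<le> \<kappa>\<^sup>2 * ((d 1 * x1)\<^sup>2 + (d 2 * x2)\<^sup>2 + (d 3 * x3)\<^sup>2 + (d 4 * x4)\<^sup>2)" for x1 x2 x3 x4
    using H[of "vector [x1, x2, x3, x4]"]
    by (simp add: sum_4 matrix_vector_mult_def vector_4)
  \<comment> \<open>The instantiations of \<open>key\<close> follow the order of occurrence in its
    statement: x4, x3, x1, x2. Setting only x1 = 1, and later only x2 = 1, isolates the entries
    \<open>\<rho>1\<close> and 1 / \<rho>2.\<close>
  have "(d 3 * \<rho>1)\<^sup>2 \<le> (\<kappa> * d 1)\<^sup>2"
    using key[of 0 0 1 0] by (simp add: power_mult_distrib)
  then have "\<bar>d 3 * \<rho>1\<bar> \<le> \<bar>\<kappa> * d 1\<bar>" by (simp only: abs_le_square_iff)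
  moreover have "\<kappa> * d 1 \<le> 1 * d 1" using \<kappa> d[of 1] by (intro mult_right_mono) auto
  ultimately have "\<bar>\<rho>1\<bar> * d 3 \<le> d 1"
    using d[of 1] d[of 3] \<kappa>(1) unfolding abs_mult by (simp only: abs_of_pos abs_of_nonneg mult.commute)
  then have 1: "\<bar>\<rho>1\<bar> \<le> d 1 / d 3"
    using d[of 3] by (simp add: pos_le_divide_eq)
  have "(d 4 / \<rho>2)\<^sup>2 \<le> (\<kappa> * d 2)\<^sup>2"
    using key[of 0 0 0 1] by (simp add: power_mult_distrib)
  then have "\<bar>d 4 / \<rho>2\<bar> \<le> \<bar>\<kappa> * d 2\<bar>" by (simp only: abs_le_square_iff)
  then have 2: "\<bar>1 / \<rho>2\<bar> \<le> \<kappa> * d 2 / d 4"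
    using d[of 2] d[of 4] \<kappa> by (simp add: abs_mult field_simps)
  have 3: "d 2 * (\<bar>h\<bar> * (d 1 / d 3) + \<bar>k\<bar>) \<le> \<kappa> * d 4"
  proof -
    \<comment> \<open>The size makes |d 3 * s| = d 1, so that the first row on the left outweighs
      the matching input term on the right. The sign aligns h * s with k, so that the modulus of
      their sum is the sum of the moduli.\<close>
    define s where "s = (if h * k \<ge> 0 then d 1 / d 3 else - (d 1 / d 3))"
    have s2: "(d 3 * s)\<^sup>2 = (d 1)\<^sup>2" using d[of 3] by (auto simp: s_def)
    have "\<bar>h * s + k\<bar> = \<bar>h\<bar> * (d 1 / d 3) + \<bar>k\<bar>"
    proof -
      have p: "0 < d 1 / d 3" using d by simp
      have "(h * s) * k \<ge> 0"
        using p by (auto simp: s_def mult.assoc mult_nonneg_nonneg mult_le_0_iff zero_le_mult_iff)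
      then have "\<bar>h * s + k\<bar> = \<bar>h * s\<bar> + \<bar>k\<bar>"
        by (auto simp: zero_le_mult_iff)
      moreover have "\<bar>s\<bar> = d 1 / d 3" using d[of 1] d[of 3] by (auto simp: s_def)
      ultimately show ?thesis by (simp add: abs_mult)
    qed
    moreover have "(d 2 * (h * s + k))\<^sup>2 \<le> (\<kappa> * d 4)\<^sup>2"
    proof -
      have "(d 1)\<^sup>2 + (d 2 * (h * s + k))\<^sup>2 \<le> \<kappa>\<^sup>2 * (d 1)\<^sup>2 + \<kappa>\<^sup>2 * (d 4)\<^sup>2"
        using key[of 1 s 0 0] s2 by (simp add: algebra_simps)
      moreover have "\<kappa>\<^sup>2 * (d 1)\<^sup>2 \<le> 1 * (d 1)\<^sup>2"
        using \<kappa> by (intro mult_right_mono) (auto simp: power_le_one)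
      ultimately show ?thesis by (simp add: power_mult_distrib)
    qed
    then have "\<bar>d 2 * (h * s + k)\<bar> \<le> \<bar>\<kappa> * d 4\<bar>" by (simp only: abs_le_square_iff)
    ultimately show ?thesis using d[of 2] d[of 4] \<kappa> by (simp add: abs_mult)
  qed
  have "\<bar>h * \<rho>1 / \<rho>2\<bar> + \<bar>k / \<rho>2\<bar> = (\<bar>h\<bar> * \<bar>\<rho>1\<bar> + \<bar>k\<bar>) * \<bar>1 / \<rho>2\<bar>"
    by (simp add: abs_mult field_simps add_divide_distrib)
  also have "\<dots> \<le> (\<bar>h\<bar> * (d 1 / d 3) + \<bar>k\<bar>) * (\<kappa> * d 2 / d 4)"
    using 1 2 d[of 1] d[of 3] by (intro mult_mono add_mono mult_left_mono) auto
  also have "\<dots> = (d 2 * (\<bar>h\<bar> * (d 1 / d 3) + \<bar>k\<bar>)) * (\<kappa> / d 4)" by simp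
  also have "\<dots> \<le> (\<kappa> * d 4) * (\<kappa> / d 4)"
    using 3 \<kappa> d[of 4] by (intro mult_right_mono) auto
  also have "\<dots> = \<kappa> * \<kappa>" using d[of 4] by simp
  also have "\<dots> < 1" using \<kappa> by (metis abs_of_nonneg abs_square_less_1 power2_eq_square)
  finally show ?thesis .
qed

section \<open>The kernels at $x = 0$\<close>

text \<open>
  In this section \<open>V s\<close> stands for \<open>w\<close> at \<open>x = L\<close> and time \<open>s\<close>, so that \<open>w(x, t) = V(t + (L - x) / a)\<close>, while \<open>g\<close>
  and \<open>f\<close> are \<open>w\<close> and \<open>u\<close> at time \<open>T = L / b\<close>; the \<open>u\<close>-characteristic arriving at \<open>(\<xi>, T)\<close> leaves \<open>x = L\<close> at time \<open>\<xi> / b\<close>.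
\<close>

lemma kernel_identity:
  fixes a b L \<rho> s :: real
  assumes pos: "0 < a" "0 < b" "0 < L"
    and ker: "kernel_equations (kernel_domain L 1) b a c Kvw Kvv"
    and diag: "\<forall>x\<in>{0..L}. Kvw x x = c x / (a + b)"
    and bc: "\<forall>x\<in>{0..L}. a * Kvw x L = b * \<rho> * Kvv x L"
    and s: "0 \<le> s" "s \<le> L / b + L / a"
  shows "a / (a + b) * c (L - b * (a * s) / (a + b))
    = (if s \<le> L / b then b * \<rho> * Kvv 0 (b * s) else a * Kvw 0 (L + a * (L / b) - a * s))
      + a / (a + b) * (LINT \<xi>:{0..min (b * s) ((a + b) * (L / b) - a * s)}|lborel.
          Kvv 0 \<xi> * c (L + \<xi> - b * (a * s + \<xi>) / (a + b)))"
proof -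
  \<comment> \<open>(x, y) is the point where the \<open>Kvw\<close> characteristic labelled by
    \<open>s\<close> enters the triangle: on the side \<xi> = L for s \<le> L / b, on the side x = 0
    afterwards. It meets the diagonal at parameter \<open>\<sigma>\<close>, having started at height
    \<open>m\<close> = y - x above it.\<close>
  define e where "e = min s (L / b)"
  define m where "m = (a + b) * e - a * s"
  define \<sigma> where "\<sigma> = m / (a + b)"
  define x where "x = L - b * e"
  define y where "y = L - a * (s - e)"
  have ab: "0 < a + b" using pos by simp
  have e: "0 \<le> e" "e \<le> s" "e \<le> L / b" using s pos by (auto simp: e_def)
  have m_eq: "m = min (b * s) ((a + b) * (L / b) - a * s)"
  proof -
    have "(a + b) * e = min ((a + b) * s) ((a + b) * (L / b))"
      using ab by (simp add: e_def min_mult_distrib_left del: times_divide_eq_right)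
    then show ?thesis by (auto simp: m_def min_def algebra_simps)
  qed
  have "(a + b) * (L / b) - a * s \<ge> 0"
  proof -
    have "a * s \<le> a * (L / b + L / a)" using s pos by (intro mult_left_mono) auto
    also have "\<dots> = (a + b) * (L / b)" using pos by (simp add: field_simps)
    finally show ?thesis by simp
  qed
  then have m0: "0 \<le> m" using s pos by (simp add: m_eq)
  then have \<sigma>0: "0 \<le> \<sigma>" using ab by (simp add: \<sigma>_def)
  have ms: "m = (a + b) * \<sigma>" using ab by (simp add: \<sigma>_def)
  have be: "b * e \<le> L" using e(3) pos by (simp add: field_simps)
  have x0: "0 \<le> x" "x \<le> L" using be e pos by (auto simp: x_def)
  have y0: "y \<le> L" using e pos by (auto simp: y_def)
  have yx: "y - x = m" by (simp add: x_def y_def m_def algebra_simps)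
  have dom: "(x, y) \<in> kernel_domain L 1"
    using x0 y0 yx m0 by (auto simp: kernel_domain_def road_def)
  have endp: "x + b * \<sigma> = y - a * \<sigma>" using yx ms by (simp add: algebra_simps)
  have mid: "(x + b * t, y - a * t) \<in> kernel_domain L 1" if "0 \<le> t" "t \<le> \<sigma>" for t
  proof -
    have "b * t \<le> b * \<sigma>" "a * t \<le> a * \<sigma>" "0 \<le> b * t" "0 \<le> a * t"
      using that pos by (auto intro!: mult_left_mono)
    then show ?thesis using endp x0 y0 by (auto simp: kernel_domain_def road_def)
  qed
  \<comment> \<open>\<open>Kvv\<close> depends only on the height above the diagonal, so it can be
    read off at x = 0; along a \<open>Kvw\<close> characteristic this height falls from
    \<open>m\<close> at rate a + b.\<close>
  have Kvv: "Kvv (x + b * t) (y - a * t) = Kvv 0 (m - (a + b) * t)" if "0 \<le> t" "t \<le> \<sigma>" for t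
  proof -
    let ?\<xi> = "m - (a + b) * t"
    have eq: "?\<xi> = (y - a * t) - (x + b * t)" using yx by (simp add: algebra_simps)
    note mid[OF that]
    then have "(0, ?\<xi>) \<in> kernel_domain L 1" "0 \<le> x + b * t"
      "(0 + (x + b * t), ?\<xi> + (x + b * t)) \<in> kernel_domain L 1"
      unfolding eq by (auto simp: kernel_domain_def road_def)
    then have "Kvv (0 + (x + b * t)) (?\<xi> + (x + b * t)) = Kvv 0 ?\<xi>"
      using ker unfolding kernel_equations_def by blast
    then show ?thesis unfolding eq by simp
  qed
  have y_arg: "y - a * t = L + (m - (a + b) * t) - b * (a * s + (m - (a + b) * t)) / (a + b)" for t
  proof -
    have "b * (a * s + (m - (a + b) * t)) / (a + b) = b * (e - t)"
      using ab by (simp add: m_def field_simps)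
    then show ?thesis by (simp add: y_def m_def algebra_simps)
  qed
  have "Kvw (x + b * \<sigma>) (y - a * \<sigma>) - Kvw x y
      = (LINT t:{0..\<sigma>}|lborel. c (y - a * t) * Kvv (x + b * t) (y - a * t))"
    using ker dom \<sigma>0 mid[of \<sigma>] unfolding kernel_equations_def by blast
  also have "\<dots> = (LINT t:{0..\<sigma>}|lborel. Kvv 0 (m - (a + b) * t)
      * c (L + (m - (a + b) * t) - b * (a * s + (m - (a + b) * t)) / (a + b)))"
  proof (intro set_lebesgue_integral_cong allI impI)
    fix t assume "t \<in> {0..\<sigma>}"
    then show "c (y - a * t) * Kvv (x + b * t) (y - a * t) = Kvv 0 (m - (a + b) * t)
        * c (L + (m - (a + b) * t) - b * (a * s + (m - (a + b) * t)) / (a + b))"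
      unfolding y_arg[symmetric] using Kvv[of t] by simp
  qed simp
  finally have e1: "Kvw (x + b * \<sigma>) (y - a * \<sigma>) - Kvw x y
      = (LINT t:{0..\<sigma>}|lborel. Kvv 0 (m - (a + b) * t)
      * c (L + (m - (a + b) * t) - b * (a * s + (m - (a + b) * t)) / (a + b)))" .
  have e2: "(LINT \<xi>:{0..m}|lborel. Kvv 0 \<xi> * c (L + \<xi> - b * (a * s + \<xi>) / (a + b)))
      = (a + b) * (LINT t:{0..\<sigma>}|lborel. Kvv 0 (m - (a + b) * t)
      * c (L + (m - (a + b) * t) - b * (a * s + (m - (a + b) * t)) / (a + b)))"
  proof -
    have "(m + - (a + b) * t \<in> {0..m}) \<longleftrightarrow> t \<in> {0..\<sigma>}" for t
    proof -
      define p where "p = a + b"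
      have "0 < p" "m = p * \<sigma>" using ab ms by (auto simp: p_def)
      then have "m + - p * t \<in> {0..m} \<longleftrightarrow> t \<in> {0..\<sigma>}"
        by (auto simp: mult_le_cancel_left_pos zero_le_mult_iff)
      then show ?thesis unfolding p_def .
    qed
    from set_integral_affine[OF _ this, of "\<lambda>\<xi>. Kvv 0 \<xi> * c (L + \<xi> - b * (a * s + \<xi>) / (a + b))"]
    moreover have "m + - (a + b) * t = m - (a + b) * t" for t by (simp add: algebra_simps)
    moreover have "\<bar>- (a + b)\<bar> = a + b" "- (a + b) \<noteq> 0" using ab by auto
    ultimately show ?thesis by simp
  qed
  have main: "(LINT \<xi>:{0..m}|lborel. Kvv 0 \<xi> * c (L + \<xi> - b * (a * s + \<xi>) / (a + b)))
      = (a + b) * (Kvw (x + b * \<sigma>) (y - a * \<sigma>) - Kvw x y)"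
    using e2 unfolding e1 .
  have pd: "x + b * \<sigma> = L - b * (a * s) / (a + b)"
    using ab by (simp add: x_def \<sigma>_def m_def field_simps)
  have "Kvw (x + b * \<sigma>) (y - a * \<sigma>) = c (L - b * (a * s) / (a + b)) / (a + b)"
  proof -
    have "x + b * \<sigma> \<in> {0..L}" using mid[of \<sigma>] \<sigma>0 by (auto simp: kernel_domain_def road_def)
    then show ?thesis using diag unfolding endp[symmetric] pd by auto
  qed
  \<comment> \<open>The side of entry decides the term: on \<xi> = L the kernel boundary condition
    converts \<open>Kvw\<close> into \<open>Kvv\<close>, while on x = 0 the value is already the
    trace used by the feedback.\<close>
  moreover have "a * Kvw x y =
      (if s \<le> L / b then b * \<rho> * Kvv 0 (b * s) else a * Kvw 0 (L + a * (L / b) - a * s))"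
  proof (cases "s \<le> L / b")
    case True
    then have "e = s" by (simp add: e_def)
    then have y: "y = L" "m = b * s" by (auto simp: y_def m_def algebra_simps)
    have "Kvv x L = Kvv 0 (b * s)" using Kvv[of 0] \<sigma>0 y by simp
    then show ?thesis using True bc x0 y by auto
  next
    case False
    then have "e = L / b" by (simp add: e_def)
    then have "x = 0" "y = L + a * (L / b) - a * s" using pos by (auto simp: x_def y_def algebra_simps)
    then show ?thesis using False by simp
  qed
  ultimately show ?thesis
    unfolding m_eq[symmetric] main using ab by (simp add: field_simps)
qed

text \<open>Both sides are linear in \<open>V\<close>. Each contribution is rewritten as the
  integral over {0..S} of \<open>V s\<close> against a weight, and \<open>id\<close> says that the
  weights agree. \<open>F\<close> and \<open>k\<close> stand for the two kernels at x = 0.\<close>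

lemma kernel_functional:
  fixes a b L \<rho> M :: real and c F k V f g :: "real \<Rightarrow> real"
  defines "T \<equiv> L / b" and "S \<equiv> L / b + L / a"
  assumes pos: "0 < a" "0 < b" "0 < L"
    and c: "continuous_on UNIV c"
    and F: "F \<in> borel_measurable borel" "\<And>x. \<bar>F x\<bar> \<le> M"
    and k: "k \<in> borel_measurable borel" "\<And>x. \<bar>k x\<bar> \<le> M"
    and V: "V \<in> borel_measurable borel" "set_integrable lborel {0..S} V"
    and g: "set_borel_measurable lborel {0..L} g"
      "AE \<xi> in lborel. \<xi> \<in> {0..L} \<longrightarrow> g \<xi> = V (T + (L - \<xi>) / a)"
    and f: "set_borel_measurable lborel {0..L} f"
      "AE \<xi> in lborel. \<xi> \<in> {0..L} \<longrightarrow> f \<xi> = \<rho> * V (\<xi> / b)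
        + (LINT \<sigma>:{\<xi> / b..T}|lborel. c (L + \<xi> - b * \<sigma>) * V (\<sigma> + (b * \<sigma> - \<xi>) / a))"
    and id: "\<And>s. 0 \<le> s \<Longrightarrow> s \<le> S \<Longrightarrow> a / (a + b) * c (L - b * (a * s) / (a + b))
      = (if s \<le> T then b * \<rho> * k (b * s) else a * F (L + a * T - a * s))
        + a / (a + b) * (LINT \<xi>:{0..min (b * s) ((a + b) * T - a * s)}|lborel.
            k \<xi> * c (L + \<xi> - b * (a * s + \<xi>) / (a + b)))"
  shows "(LINT \<xi>:{0..L}|lborel. F \<xi> * g \<xi> + k \<xi> * f \<xi>)
      = (LINT \<sigma>:{0..T}|lborel. c (L - b * \<sigma>) * V (\<sigma> + b * \<sigma> / a))"
proof -
  have ab: "0 < a + b" using pos by simp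
  have T: "0 < T" "T \<le> S" using pos by (auto simp: T_def S_def)
  have bT: "b * T = L" using pos by (simp add: T_def)
  have abT: "(a + b) * T = a * S" using pos by (simp add: T_def S_def field_simps)
  have [measurable]: "c \<in> borel_measurable borel"
    using c by (simp add: borel_measurable_continuous_onI)
  note [measurable] = F(1) k(1) V(1)
  obtain Mc where Mc: "\<And>x. x \<in> {0..L} \<Longrightarrow> \<bar>c x\<bar> \<le> Mc"
  proof -
    have "compact (c ` {0..L})"
      using c by (intro compact_continuous_image) (auto intro: continuous_on_subset)
    then obtain B where "\<forall>y \<in> c ` {0..L}. norm y \<le> B"
      using compact_imp_bounded bounded_iff by metis
    then show ?thesis using that[of B] by auto
  qed
  have Mc0: "0 \<le> Mc" using Mc[of 0] pos by force
  have M0: "0 \<le> M" using F(2)[of 0] by linarith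
  let ?g = "\<lambda>\<xi> s. c (L + \<xi> - b * (a * s + \<xi>) / (a + b))"
  \<comment> \<open>The substitution \<sigma> = (a * s + \<xi>) / (a + b) makes the argument of
    \<open>V\<close> equal to \<open>s\<close>. The two upper bounds on \<xi> are the conditions
    \<sigma> \<ge> \<xi> / b and \<sigma> \<le> T in the new variable.\<close>
  define D where "D = {(\<xi>, s). 0 \<le> \<xi> \<and> \<xi> \<le> b * s \<and> \<xi> \<le> (a + b) * T - a * s}"
  have D_meas[measurable]: "D \<in> sets (lborel \<Otimes>\<^sub>M lborel)"
  proof -
    have "Measurable.pred (borel \<Otimes>\<^sub>M borel) (\<lambda>z :: real \<times> real.
        0 \<le> fst z \<and> fst z \<le> b * snd z \<and> fst z \<le> (a + b) * T - a * snd z)"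
      by measurable
    then have "{z \<in> space (borel \<Otimes>\<^sub>M borel). 0 \<le> fst z \<and> fst z \<le> b * snd z
        \<and> fst z \<le> (a + b) * T - a * snd z} \<in> sets (borel \<Otimes>\<^sub>M borel)"
      by measurable
    moreover have "D = {z \<in> space (borel \<Otimes>\<^sub>M borel). 0 \<le> fst z \<and> fst z \<le> b * snd z
        \<and> fst z \<le> (a + b) * T - a * snd z}"
      by (auto simp: D_def space_pair_measure)
    moreover have "sets (lborel \<Otimes>\<^sub>M lborel :: (real \<times> real) measure) = sets (borel \<Otimes>\<^sub>M borel)"
      by (intro sets_pair_measure_cong) simp_all
    ultimately show ?thesis by (simp only:)
  qed
  \<comment> \<open>The last claim keeps the argument of \<open>c\<close> inside {0..L}, the only
    place where \<open>Mc\<close> bounds it.\<close>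
  have D_sub: "\<xi> \<in> {0..L}" "s \<in> {0..S}" "L + \<xi> - b * (a * s + \<xi>) / (a + b) \<in> {0..L}"
    if "(\<xi>, s) \<in> D" for \<xi> s
  proof -
    have 1: "0 \<le> \<xi>" "\<xi> \<le> b * s" "\<xi> \<le> (a + b) * T - a * s" using that by (auto simp: D_def)
    have "0 \<le> b * s" using 1 by simp
    then have s0: "0 \<le> s" using pos by (simp add: zero_le_mult_iff)
    have "a * s \<le> a * S" using 1 abT by simp
    then have sS: "s \<le> S" using pos by simp
    then show "s \<in> {0..S}" using s0 by simp
    have "b * \<xi> \<le> b * ((a + b) * T - a * s)" "a * \<xi> \<le> a * (b * s)"
      using 1 pos by (auto intro!: mult_left_mono)
    then have "(a + b) * \<xi> \<le> (a + b) * (b * T)" by (simp add: algebra_simps)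
    then have "\<xi> \<le> L" using ab bT by (simp add: mult_le_cancel_left_pos)
    then show "\<xi> \<in> {0..L}" using 1 by simp
    have "b * (a * s + \<xi>) / (a + b) \<le> b * ((a + b) * T) / (a + b)"
      using 1 ab pos by (intro divide_right_mono mult_left_mono) auto
    also have "\<dots> = L" using ab bT by simp
    finally have u: "b * (a * s + \<xi>) / (a + b) \<le> L" .
    have "\<xi> = ((a + b) * \<xi>) / (a + b)" using ab by simp
    also have "\<dots> \<le> b * (a * s + \<xi>) / (a + b)"
      using \<open>a * \<xi> \<le> a * (b * s)\<close> ab by (intro divide_right_mono) (auto simp: algebra_simps)
    finally show "L + \<xi> - b * (a * s + \<xi>) / (a + b) \<in> {0..L}" using u 1 by simp
  qed
  define H where "H = (\<lambda>\<xi> s. indicator D (\<xi>, s) * (k \<xi> * (?g \<xi> s * V s)))"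
  \<comment> \<open>A product majorant, bounded on {0..L} in one variable and a multiple of
    \<open>V\<close> on {0..S} in the other, justifies Fubini although \<open>V\<close> is merely
    integrable.\<close>
  have H_int: "integrable (lborel \<Otimes>\<^sub>M lborel) (\<lambda>(\<xi>, s). H \<xi> s)"
  proof (rule Bochner_Integration.integrable_bound)
    have "integrable lborel (\<lambda>s. Mc * (indicator {0..S} s * V s))"
      using V(2) by (simp add: set_integrable_def)
    moreover have "integrable lborel (\<lambda>\<xi>. M * indicator {0..L} \<xi>)"
      using borel_integrable_atLeastAtMost'[of 0 L "\<lambda>_. M"]
      by (simp add: set_integrable_def mult.commute)
    ultimately show "integrable (lborel \<Otimes>\<^sub>M lborel)
        (\<lambda>(\<xi>, s). (M * indicator {0..L} \<xi>) * (Mc * (indicator {0..S} s * V s)))"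
      by (intro integrable_lborel_pair_mult)
    show "(\<lambda>(\<xi>, s). H \<xi> s) \<in> borel_measurable (lborel \<Otimes>\<^sub>M lborel)"
      unfolding H_def by measurable
    show "AE z in lborel \<Otimes>\<^sub>M lborel. norm (case z of (\<xi>, s) \<Rightarrow> H \<xi> s)
        \<le> norm (case z of (\<xi>, s) \<Rightarrow> (M * indicator {0..L} \<xi>) * (Mc * (indicator {0..S} s * V s)))"
    proof (intro AE_I2, clarify)
      fix \<xi> s
      show "norm (H \<xi> s) \<le> norm ((M * indicator {0..L} \<xi>) * (Mc * (indicator {0..S} s * V s)))"
      proof (cases "(\<xi>, s) \<in> D")
        case True
        note d = D_sub[OF True]
        have "\<bar>k \<xi>\<bar> * (\<bar>?g \<xi> s\<bar> * \<bar>V s\<bar>) \<le> M * (Mc * \<bar>V s\<bar>)"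
          using k(2) Mc[OF d(3)] M0 Mc0 by (intro mult_mono mult_nonneg_nonneg) auto
        then show ?thesis using d True M0 Mc0 by (simp add: H_def abs_mult)
      qed (simp add: H_def)
    qed
  qed
  define \<Phi> where "\<Phi> = (\<lambda>\<xi>. LINT \<sigma>:{\<xi> / b..T}|lborel. c (L + \<xi> - b * \<sigma>) * V (\<sigma> + (b * \<sigma> - \<xi>) / a))"
  have \<Phi>: "indicator {0..L} \<xi> * (k \<xi> * \<Phi> \<xi>) = a / (a + b) * (\<integral>s. H \<xi> s \<partial>lborel)" for \<xi>
  proof (cases "\<xi> \<in> {0..L}")
    case True
    have "(\<xi> / (a + b) + a / (a + b) * s \<in> {\<xi> / b..T}) \<longleftrightarrow> s \<in> {s. (\<xi>, s) \<in> D}" for s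
    proof -
      have "\<xi> / (a + b) + a / (a + b) * s = (a * s + \<xi>) / (a + b)"
        by (simp add: add_divide_distrib)
      moreover have "\<xi> / b \<le> (a * s + \<xi>) / (a + b) \<longleftrightarrow> \<xi> * (a + b) \<le> (a * s + \<xi>) * b"
        using ab pos by (simp add: divide_le_eq pos_le_divide_eq mult.commute)
      moreover have "\<xi> * (a + b) \<le> (a * s + \<xi>) * b \<longleftrightarrow> a * \<xi> \<le> a * (b * s)"
        by (simp add: algebra_simps)
      moreover have "(a * s + \<xi>) / (a + b) \<le> T \<longleftrightarrow> a * s + \<xi> \<le> (a + b) * T"
        using ab by (simp add: pos_divide_le_eq mult.commute)
      ultimately show ?thesis using True pos by (auto simp: D_def)
    qed
    from set_integral_affine[OF _ this,
        of "\<lambda>\<sigma>. c (L + \<xi> - b * \<sigma>) * V (\<sigma> + (b * \<sigma> - \<xi>) / a)"]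
    have "\<Phi> \<xi> = a / (a + b) * (LINT s:{s. (\<xi>, s) \<in> D}|lborel.
        c (L + \<xi> - b * (\<xi> / (a + b) + a / (a + b) * s))
        * V ((\<xi> / (a + b) + a / (a + b) * s) + (b * (\<xi> / (a + b) + a / (a + b) * s) - \<xi>) / a))"
      using ab pos by (simp add: \<Phi>_def)
    also have "\<dots> = a / (a + b) * (LINT s:{s. (\<xi>, s) \<in> D}|lborel. ?g \<xi> s * V s)"
    proof -
      have "(\<xi> / (a + b) + a / (a + b) * s) + (b * (\<xi> / (a + b) + a / (a + b) * s) - \<xi>) / a = s" for s
      proof -
        define q where "q = \<xi> / (a + b) + a / (a + b) * s"
        have "q = (\<xi> + a * s) / (a + b)" by (simp add: q_def add_divide_distrib)
        then have "(a + b) * q = \<xi> + a * s" using ab by simp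
        then have "b * q - \<xi> = a * (s - q)" by (simp add: algebra_simps)
        then have "q + (b * q - \<xi>) / a = s" using pos by simp
        then show ?thesis by (simp add: q_def)
      qed
      moreover have "b * (\<xi> / (a + b) + a / (a + b) * s) = b * (a * s + \<xi>) / (a + b)" for s
        by (simp add: add_divide_distrib algebra_simps)
      ultimately show ?thesis by simp
    qed
    finally have 1: "\<Phi> \<xi> = a / (a + b) * (LINT s:{s. (\<xi>, s) \<in> D}|lborel. ?g \<xi> s * V s)" .
    have "(\<integral>s. H \<xi> s \<partial>lborel) = k \<xi> * (LINT s:{s. (\<xi>, s) \<in> D}|lborel. ?g \<xi> s * V s)"
      unfolding set_lebesgue_integral_def integral_mult_right_zero[symmetric]
      by (intro Bochner_Integration.integral_cong) (auto simp: H_def indicator_def)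
    then show ?thesis using True 1 by simp
  next
    case False
    then have "H \<xi> s = 0" for s using D_sub(1)[of \<xi> s] by (auto simp: H_def indicator_def)
    then show ?thesis using False by simp
  qed
  have I3_int: "set_integrable lborel {0..L} (\<lambda>\<xi>. k \<xi> * \<Phi> \<xi>)"
    unfolding set_integrable_def real_scaleR_def \<Phi>
    using lborel_pair.integrable_fst[OF H_int] by simp
  have "(LINT \<xi>:{0..L}|lborel. k \<xi> * \<Phi> \<xi>) = a / (a + b) * (\<integral>\<xi>. \<integral>s. H \<xi> s \<partial>lborel \<partial>lborel)"
    unfolding set_lebesgue_integral_def real_scaleR_def \<Phi> by simp
  also have "\<dots> = a / (a + b) * (\<integral>s. \<integral>\<xi>. H \<xi> s \<partial>lborel \<partial>lborel)"
    using lborel_pair.Fubini_integral[OF H_int] by simp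
  also have "(\<integral>s. \<integral>\<xi>. H \<xi> s \<partial>lborel \<partial>lborel)
      = (LINT s:{0..S}|lborel. (LINT \<xi>:{0..min (b * s) ((a + b) * T - a * s)}|lborel.
            k \<xi> * ?g \<xi> s) * V s)"
    unfolding set_lebesgue_integral_def
  proof (intro Bochner_Integration.integral_cong refl, goal_cases)
    case (1 s)
    show ?case
    proof (cases "s \<in> {0..S}")
      case True
      have "(\<integral>\<xi>. H \<xi> s \<partial>lborel) = (\<integral>\<xi>. indicator {0..min (b * s) ((a + b) * T - a * s)} \<xi>
          * (k \<xi> * ?g \<xi> s) * V s \<partial>lborel)"
        by (intro Bochner_Integration.integral_cong) (auto simp: H_def D_def indicator_def)
      then show ?thesis using True by simp
    next
      case False
      then have "H \<xi> s = 0" for \<xi> using D_sub(2)[of \<xi> s] by (auto simp: H_def indicator_def)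
      then show ?thesis using False by simp
    qed
  qed
  finally have I3: "(LINT \<xi>:{0..L}|lborel. k \<xi> * \<Phi> \<xi>)
      = (LINT s:{0..S}|lborel. a / (a + b) * (LINT \<xi>:{0..min (b * s) ((a + b) * T - a * s)}|lborel.
            k \<xi> * ?g \<xi> s) * V s)"
    by (simp add: mult.assoc)
  have V_sub: "set_integrable lborel {0..T} V" "set_integrable lborel {T..S} V"
    using T by (auto intro: set_integrable_subset[OF V(2)])
  \<comment> \<open>The part with \<open>g\<close> covers s in {T..S} through \<xi> = L + a * T - a
    * s, the reflected part of \<open>f\<close> covers {0..T} through \<xi> = b * s. Together they
    tile {0..S}, which is the case distinction in \<open>id\<close>.\<close>
  have dom1: "(L + a * T) + - a * s \<in> {0..L} \<longleftrightarrow> s \<in> {T..S}" for s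
  proof -
    have "L + a * T = a * S" using pos by (simp add: T_def S_def field_simps)
    then have "0 \<le> L + a * T - a * s \<longleftrightarrow> s \<le> S" using pos by (simp add: mult_le_cancel_left_pos)
    moreover have "L + a * T - a * s \<le> L \<longleftrightarrow> T \<le> s" using pos by (simp add: mult_le_cancel_left_pos)
    ultimately show ?thesis by auto
  qed
  have dom2: "0 + b * s \<in> {0..L} \<longleftrightarrow> s \<in> {0..T}" for s
    using pos by (auto simp: T_def zero_le_mult_iff pos_le_divide_eq mult.commute)
  have arg1: "T + (L - ((L + a * T) + - a * s)) / a = s" for s
    using pos by (simp add: field_simps)
  have int1': "set_integrable lborel {T..S} (\<lambda>s. a * F (L + a * T - a * s) * V s)"
    using F(2) pos V_sub(2)
    by (intro set_integrable_mult_bounded[where M = "a * M"]) (auto simp: abs_mult intro!: mult_left_mono)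
  have int2': "set_integrable lborel {0..T} (\<lambda>s. b * \<rho> * k (b * s) * V s)"
    using k(2) pos V_sub(1)
    by (intro set_integrable_mult_bounded[where M = "\<bar>b * \<rho>\<bar> * M"]) (auto simp: abs_mult intro!: mult_left_mono)
  have int1: "set_integrable lborel {0..L} (\<lambda>\<xi>. F \<xi> * V (T + (L - \<xi>) / a))"
    using int1' pos set_integrable_affine[OF _ dom1, of "\<lambda>\<xi>. F \<xi> * V (T + (L - \<xi>) / a)"]
    unfolding arg1 by (simp add: mult.assoc)
  have I1: "(LINT \<xi>:{0..L}|lborel. F \<xi> * V (T + (L - \<xi>) / a))
      = (LINT s:{T..S}|lborel. a * F (L + a * T - a * s) * V s)"
    using pos set_integral_affine[OF _ dom1, of "\<lambda>\<xi>. F \<xi> * V (T + (L - \<xi>) / a)"]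
    unfolding arg1 by (simp add: mult.assoc)
  have int2: "set_integrable lborel {0..L} (\<lambda>\<xi>. k \<xi> * (\<rho> * V (\<xi> / b)))"
  proof (cases "\<rho> = 0")
    case False
    have "(\<lambda>s. b * \<rho> * k (b * s) * V s) = (\<lambda>s. b * (k (b * s) * (\<rho> * V s)))"
      by (auto simp: mult_ac)
    with int2' have "set_integrable lborel {0..T} (\<lambda>s. k (b * s) * (\<rho> * V s))"
      using pos by (simp only: set_integrable_mult_right_iff)
    then show ?thesis
      using pos set_integrable_affine[OF _ dom2, of "\<lambda>\<xi>. k \<xi> * (\<rho> * V (\<xi> / b))"] by simp
  qed (simp add: set_integrable_def)
  have I2: "(LINT \<xi>:{0..L}|lborel. k \<xi> * (\<rho> * V (\<xi> / b)))
      = (LINT s:{0..T}|lborel. b * \<rho> * k (b * s) * V s)"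
    using pos set_integral_affine[OF _ dom2, of "\<lambda>\<xi>. k \<xi> * (\<rho> * V (\<xi> / b))"]
    by (simp flip: set_integral_mult_right) (simp add: mult_ac)
  let ?B = "\<lambda>s. if s \<le> T then b * \<rho> * k (b * s) else a * F (L + a * T - a * s)"
  have I12_int: "set_integrable lborel {0..S} (\<lambda>s. ?B s * V s)"
  proof (rule set_integrable_mult_bounded[OF V(2), where M = "\<bar>b * \<rho>\<bar> * M + a * M"])
    show "?B \<in> borel_measurable borel" by measurable
    show "\<bar>?B s\<bar> \<le> \<bar>b * \<rho>\<bar> * M + a * M" for s
    proof (cases "s \<le> T")
      case True
      have "\<bar>b * \<rho> * k (b * s)\<bar> \<le> \<bar>b * \<rho>\<bar> * M"
        unfolding abs_mult[of "b * \<rho>"] by (rule mult_left_mono[OF k(2) abs_ge_zero])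
      moreover have "0 \<le> a * M" using pos M0 by simp
      ultimately show ?thesis unfolding if_P[OF True] by linarith
    next
      case False
      have "\<bar>a * F (L + a * T - a * s)\<bar> \<le> \<bar>a\<bar> * M"
        unfolding abs_mult by (rule mult_left_mono[OF F(2) abs_ge_zero])
      moreover have "\<bar>a\<bar> = a" "0 \<le> \<bar>b * \<rho>\<bar> * M" using pos M0 by simp_all
      ultimately show ?thesis unfolding if_not_P[OF False] by simp
    qed
  qed
  have I12: "(LINT s:{0..T}|lborel. b * \<rho> * k (b * s) * V s)
      + (LINT s:{T..S}|lborel. a * F (L + a * T - a * s) * V s) = (LINT s:{0..S}|lborel. ?B s * V s)"
  proof -
    have U: "{0..S} = {0..T} \<union> {T<..S}" using T by auto
    have "(LINT s:{0..S}|lborel. ?B s * V s)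
        = (LINT s:{0..T}|lborel. ?B s * V s) + (LINT s:{T<..S}|lborel. ?B s * V s)"
      unfolding U using I12_int
      by (intro set_integral_Un) (auto intro: set_integrable_subset simp: U)
    also have "(LINT s:{0..T}|lborel. ?B s * V s) = (LINT s:{0..T}|lborel. b * \<rho> * k (b * s) * V s)"
      by (intro set_lebesgue_integral_cong) auto
    also have "(LINT s:{T<..S}|lborel. ?B s * V s)
        = (LINT s:{T<..S}|lborel. a * F (L + a * T - a * s) * V s)"
      by (intro set_lebesgue_integral_cong) auto
    also have "\<dots> = (LINT s:{T..S}|lborel. a * F (L + a * T - a * s) * V s)"
      using AE_lborel_singleton[of T]
      by (intro set_integral_cong_set) (auto simp: set_borel_measurable_def)
    finally show ?thesis by simp
  qed
  have dom3: "0 + a / (a + b) * s \<in> {0..T} \<longleftrightarrow> s \<in> {0..S}" for s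
  proof -
    have "a / (a + b) * s \<le> T \<longleftrightarrow> a * s \<le> a * S"
      using ab abT by (simp add: pos_divide_le_eq mult.commute)
    then show ?thesis using pos ab by (auto simp: zero_le_mult_iff mult_le_cancel_left_pos zero_le_divide_iff)
  qed
  have arg3: "(0 + a / (a + b) * s) + b * (0 + a / (a + b) * s) / a = s" for s
  proof -
    define q where "q = 0 + a / (a + b) * s"
    have "(a + b) * q = a * s" using ab by (simp add: q_def)
    then have "b * q = a * (s - q)" by (simp add: algebra_simps)
    then have "q + b * q / a = s" using pos by simp
    then show ?thesis by (simp only: q_def)
  qed
  have R: "(LINT \<sigma>:{0..T}|lborel. c (L - b * \<sigma>) * V (\<sigma> + b * \<sigma> / a))
      = (LINT s:{0..S}|lborel. a / (a + b) * c (L - b * (a * s) / (a + b)) * V s)"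
    using pos ab set_integral_affine[OF _ dom3, of "\<lambda>\<sigma>. c (L - b * \<sigma>) * V (\<sigma> + b * \<sigma> / a)"]
    unfolding arg3 by (simp add: mult.assoc)
  have R_int: "set_integrable lborel {0..S} (\<lambda>s. a / (a + b) * c (L - b * (a * s) / (a + b)) * V s)"
  proof (rule set_integrable_mult_bounded[OF V(2), where M = "a / (a + b) * Mc"])
    fix s assume "s \<in> {0..S}"
    then have "0 + a / (a + b) * s \<in> {0..T}" using dom3 by blast
    then have "b * (a * s / (a + b)) \<le> b * T" "0 \<le> b * (a * s / (a + b))"
      using pos by (auto intro!: mult_left_mono simp del: times_divide_eq_right)
    then have "L - b * (a * s) / (a + b) \<in> {0..L}" using bT by simp
    then have "\<bar>a / (a + b)\<bar> * \<bar>c (L - b * (a * s) / (a + b))\<bar> \<le> \<bar>a / (a + b)\<bar> * Mc"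
      by (intro mult_left_mono Mc) simp_all
    moreover have "\<bar>a / (a + b)\<bar> = a / (a + b)" using pos ab by simp
    ultimately show "\<bar>a / (a + b) * c (L - b * (a * s) / (a + b))\<bar> \<le> a / (a + b) * Mc"
      by (simp only: abs_mult)
  qed measurable
  have "(LINT \<xi>:{0..L}|lborel. F \<xi> * g \<xi> + k \<xi> * f \<xi>)
      = (LINT \<xi>:{0..L}|lborel. F \<xi> * V (T + (L - \<xi>) / a) + (k \<xi> * (\<rho> * V (\<xi> / b)) + k \<xi> * \<Phi> \<xi>))"
    unfolding set_lebesgue_integral_def
  proof (rule integral_cong_AE)
    have "set_integrable lborel {0..L}
        (\<lambda>\<xi>. F \<xi> * V (T + (L - \<xi>) / a) + (k \<xi> * (\<rho> * V (\<xi> / b)) + k \<xi> * \<Phi> \<xi>))"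
      using int1 int2 I3_int by (intro set_integral_add)
    then show "(\<lambda>\<xi>. indicator {0..L} \<xi> *\<^sub>R
        (F \<xi> * V (T + (L - \<xi>) / a) + (k \<xi> * (\<rho> * V (\<xi> / b)) + k \<xi> * \<Phi> \<xi>))) \<in> borel_measurable lborel"
      unfolding set_integrable_def by (rule borel_measurable_integrable)
    have "(\<lambda>\<xi>. F \<xi> * (indicator {0..L} \<xi> *\<^sub>R g \<xi>) + k \<xi> * (indicator {0..L} \<xi> *\<^sub>R f \<xi>))
        \<in> borel_measurable lborel"
      using f(1) g(1) unfolding set_borel_measurable_def by measurable
    then show "(\<lambda>\<xi>. indicator {0..L} \<xi> *\<^sub>R (F \<xi> * g \<xi> + k \<xi> * f \<xi>))
        \<in> borel_measurable lborel"
      by (simp add: algebra_simps)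
    show "AE \<xi> in lborel. indicator {0..L} \<xi> *\<^sub>R (F \<xi> * g \<xi> + k \<xi> * f \<xi>)
        = indicator {0..L} \<xi> *\<^sub>R
          (F \<xi> * V (T + (L - \<xi>) / a) + (k \<xi> * (\<rho> * V (\<xi> / b)) + k \<xi> * \<Phi> \<xi>))"
      using f(2) g(2)
    proof eventually_elim
      case (elim \<xi>)
      then show ?case
        by (cases "\<xi> \<in> {0..L}") (simp_all add: \<Phi>_def distrib_left)
    qed
  qed
  also have "\<dots> = (LINT s:{0..S}|lborel. ?B s * V s) + (LINT \<xi>:{0..L}|lborel. k \<xi> * \<Phi> \<xi>)"
    using int1 int2 I3_int I12 by (simp add: set_integral_add I1 I2)
  also have "(LINT \<xi>:{0..L}|lborel. k \<xi> * \<Phi> \<xi>)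
      = (LINT s:{0..S}|lborel. a / (a + b) * c (L - b * (a * s) / (a + b)) * V s - ?B s * V s)"
    unfolding I3
  proof (intro set_lebesgue_integral_cong allI impI)
    fix s assume "s \<in> {0..S}"
    then have s: "0 \<le> s" "s \<le> S" by auto
    show "a / (a + b) * (LINT \<xi>:{0..min (b * s) ((a + b) * T - a * s)}|lborel. k \<xi> * ?g \<xi> s) * V s
        = a / (a + b) * c (L - b * (a * s) / (a + b)) * V s - ?B s * V s"
      unfolding id[OF s] by (simp add: algebra_simps)
  qed simp
  also have "\<dots> = (LINT s:{0..S}|lborel. a / (a + b) * c (L - b * (a * s) / (a + b)) * V s)
      - (LINT s:{0..S}|lborel. ?B s * V s)"
    using R_int I12_int by (rule set_integral_diff(2))
  finally show ?thesis using R by simp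
qed

text \<open>The square splits into a reflected part, handled by \<xi> = b * s, and a collected
  source, bounded uniformly in \<xi> by \<open>Mc\<close> times the L1 norm of \<open>V\<close>. The
  factor \<open>S\<close> in the constant comes from Cauchy-Schwarz on the window, the factor
  \<open>L\<close> from integrating the uniform bound over the road.\<close>

lemma outflow_energy:
  fixes a b L \<rho> Mc :: real and c V f :: "real \<Rightarrow> real"
  defines "T \<equiv> L / b" and "S \<equiv> L / b + L / a"
  assumes pos: "0 < a" "0 < b" "0 < L"
    and c: "\<And>x. x \<in> {0..L} \<Longrightarrow> \<bar>c x\<bar> \<le> Mc"
    and V: "V \<in> borel_measurable borel" "set_integrable lborel {0..S} (\<lambda>s. (V s)\<^sup>2)"
    and f: "set_integrable lborel {0..L} (\<lambda>\<xi>. (f \<xi>)\<^sup>2)"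
      "AE \<xi> in lborel. \<xi> \<in> {0..L} \<longrightarrow> f \<xi> = \<rho> * V (\<xi> / b)
        + (LINT \<sigma>:{\<xi> / b..T}|lborel. c (L + \<xi> - b * \<sigma>) * V (\<sigma> + (b * \<sigma> - \<xi>) / a))"
  shows "(LINT \<xi>:{0..L}|lborel. (f \<xi>)\<^sup>2)
    \<le> (2 * \<rho>\<^sup>2 * b + 2 * Mc\<^sup>2 * S * L) * (LINT s:{0..S}|lborel. (V s)\<^sup>2)"
proof -
  have ab: "0 < a + b" using pos by simp
  have Mc0: "0 \<le> Mc" using c[of 0] pos by force
  have T: "0 < T" "T < S" using pos by (auto simp: T_def S_def)
  let ?N = "LINT s:{0..S}|lborel. \<bar>V s\<bar>" and ?E = "LINT s:{0..S}|lborel. (V s)\<^sup>2"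
  have Vabs: "set_integrable lborel {0..S} (\<lambda>x. \<bar>V x\<bar>)"
    using set_integrable_of_square[OF V] by (rule set_integrable_abs)
  have CS: "?N\<^sup>2 \<le> S * ?E"
    using Cauchy_Schwarz_interval[OF _ V] T by simp
  have \<Phi>: "\<bar>LINT \<sigma>:{\<xi> / b..T}|lborel. c (L + \<xi> - b * \<sigma>) * V (\<sigma> + (b * \<sigma> - \<xi>) / a)\<bar> \<le> Mc * ?N"
    if \<xi>: "\<xi> \<in> {0..L}" for \<xi>
  proof (cases "set_integrable lborel {\<xi> / b..T} (\<lambda>\<sigma>. c (L + \<xi> - b * \<sigma>) * V (\<sigma> + (b * \<sigma> - \<xi>) / a))")
    case True
    let ?A = "{\<xi> / b..T}" and ?B = "{\<xi> / b..T + (b * T - \<xi>) / a}"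
    have dom: "(- \<xi> / a + (a + b) / a * \<sigma> \<in> ?B) \<longleftrightarrow> \<sigma> \<in> ?A" for \<sigma>
    proof -
      have 1: "- \<xi> / a + (a + b) / a * \<sigma> - \<xi> / b = (a + b) / a * (\<sigma> - \<xi> / b)"
        using pos by (simp add: field_simps)
      have 2: "T + (b * T - \<xi>) / a - (- \<xi> / a + (a + b) / a * \<sigma>) = (a + b) / a * (T - \<sigma>)"
        using pos by (simp add: field_simps)
      have "0 \<le> (a + b) / a * (\<sigma> - \<xi> / b) \<longleftrightarrow> 0 \<le> \<sigma> - \<xi> / b"
        "0 \<le> (a + b) / a * (T - \<sigma>) \<longleftrightarrow> 0 \<le> T - \<sigma>"
        using pos ab by (auto simp: zero_le_mult_iff zero_le_divide_iff)
      then show ?thesis unfolding 1[symmetric] 2[symmetric] by auto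
    qed
    have arg: "- \<xi> / a + (a + b) / a * \<sigma> = \<sigma> + (b * \<sigma> - \<xi>) / a" for \<sigma>
      using pos by (simp add: field_simps)
    have "T + (b * T - \<xi>) / a \<le> S"
      using \<xi> pos by (simp add: T_def S_def divide_right_mono)
    then have BS: "?B \<subseteq> {0..S}" using \<xi> pos by auto
    then have intB: "set_integrable lborel ?B (\<lambda>s. \<bar>V s\<bar>)"
      by (intro set_integrable_subset[OF Vabs]) auto
    have intA: "set_integrable lborel ?A (\<lambda>\<sigma>. \<bar>V (\<sigma> + (b * \<sigma> - \<xi>) / a)\<bar>)"
      using set_integrable_affine[OF _ dom, of "\<lambda>s. \<bar>V s\<bar>"] intB pos ab unfolding arg by simp
    have "\<bar>LINT \<sigma>:?A|lborel. c (L + \<xi> - b * \<sigma>) * V (\<sigma> + (b * \<sigma> - \<xi>) / a)\<bar>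
        \<le> (LINT \<sigma>:?A|lborel. \<bar>c (L + \<xi> - b * \<sigma>) * V (\<sigma> + (b * \<sigma> - \<xi>) / a)\<bar>)"
      using set_integral_norm_bound[OF True] by simp
    also have "\<dots> \<le> (LINT \<sigma>:?A|lborel. Mc * \<bar>V (\<sigma> + (b * \<sigma> - \<xi>) / a)\<bar>)"
    proof (rule set_integral_mono)
      fix \<sigma> assume "\<sigma> \<in> ?A"
      then have "\<xi> \<le> b * \<sigma>" "b * \<sigma> \<le> L" using pos by (auto simp: T_def field_simps)
      then have "\<bar>c (L + \<xi> - b * \<sigma>)\<bar> \<le> Mc" using \<xi> by (intro c) auto
      then show "\<bar>c (L + \<xi> - b * \<sigma>) * V (\<sigma> + (b * \<sigma> - \<xi>) / a)\<bar> \<le> Mc * \<bar>V (\<sigma> + (b * \<sigma> - \<xi>) / a)\<bar>"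
        by (simp add: abs_mult mult_right_mono)
    qed (use intA set_integrable_abs[OF True] in auto)
    also have "\<dots> = Mc * (LINT \<sigma>:?A|lborel. \<bar>V (\<sigma> + (b * \<sigma> - \<xi>) / a)\<bar>)"
      by simp
    \<comment> \<open>The substitution has slope (a + b) / a \<ge> 1, so its Jacobian can be
      inserted at no cost.\<close>
    also have "\<dots> \<le> Mc * (LINT s:?B|lborel. \<bar>V s\<bar>)"
    proof -
      have "(LINT \<sigma>:?A|lborel. \<bar>V (\<sigma> + (b * \<sigma> - \<xi>) / a)\<bar>) * 1
          \<le> (LINT \<sigma>:?A|lborel. \<bar>V (\<sigma> + (b * \<sigma> - \<xi>) / a)\<bar>) * ((a + b) / a)"
        using pos by (intro mult_left_mono set_integral_nonneg_real) auto
      also have "\<dots> = (LINT s:?B|lborel. \<bar>V s\<bar>)"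
        using set_integral_affine[OF _ dom, of "\<lambda>s. \<bar>V s\<bar>"] pos ab unfolding arg by (simp add: mult.commute)
      finally show ?thesis using Mc0 by (intro mult_left_mono) auto
    qed
    also have "\<dots> \<le> Mc * ?N"
      using Vabs intB BS Mc0 by (intro mult_left_mono set_integral_mono_set) auto
    finally show ?thesis .
  next
    \<comment> \<open>The integral of a non-integrable function is 0 by default, and the bound holds
      trivially.\<close>
    case False
    then show ?thesis
      using Mc0 set_integral_nonneg_real[of "\<lambda>s. \<bar>V s\<bar>" "{0..S}"]
      by (simp add: set_lebesgue_integral_def set_integrable_def not_integrable_integral_eq)
  qed
  have dom2: "0 + b * s \<in> {0..L} \<longleftrightarrow> s \<in> {0..T}" for s
    using pos by (auto simp: T_def zero_le_mult_iff pos_le_divide_eq mult.commute)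
  have VT: "set_integrable lborel {0..T} (\<lambda>s. (V s)\<^sup>2)"
    using T by (intro set_integrable_subset[OF V(2)]) auto
  have i1: "set_integrable lborel {0..L} (\<lambda>\<xi>. (V (\<xi> / b))\<^sup>2)"
    using set_integrable_affine[OF _ dom2, of "\<lambda>\<xi>. (V (\<xi> / b))\<^sup>2"] VT pos by simp
  have i2: "set_integrable lborel {0..L} (\<lambda>_. 2 * (Mc * ?N)\<^sup>2)"
    using borel_integrable_atLeastAtMost'[of 0 L "\<lambda>_. 2 * (Mc * ?N)\<^sup>2"] by simp
  have "(LINT \<xi>:{0..L}|lborel. (f \<xi>)\<^sup>2)
      \<le> (LINT \<xi>:{0..L}|lborel. 2 * \<rho>\<^sup>2 * (V (\<xi> / b))\<^sup>2 + 2 * (Mc * ?N)\<^sup>2)"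
  proof (rule set_integral_mono_AE)
    show "AE \<xi>\<in>{0..L} in lborel. (f \<xi>)\<^sup>2 \<le> 2 * \<rho>\<^sup>2 * (V (\<xi> / b))\<^sup>2 + 2 * (Mc * ?N)\<^sup>2"
      using f(2)
    proof (eventually_elim, intro impI)
      fix \<xi> assume h: "\<xi> \<in> {0..L} \<longrightarrow> f \<xi> = \<rho> * V (\<xi> / b)
        + (LINT \<sigma>:{\<xi> / b..T}|lborel. c (L + \<xi> - b * \<sigma>) * V (\<sigma> + (b * \<sigma> - \<xi>) / a))" "\<xi> \<in> {0..L}"
      let ?p = "\<rho> * V (\<xi> / b)"
        and ?q = "LINT \<sigma>:{\<xi> / b..T}|lborel. c (L + \<xi> - b * \<sigma>) * V (\<sigma> + (b * \<sigma> - \<xi>) / a)"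
      have "\<bar>?q\<bar> \<le> \<bar>Mc * ?N\<bar>" using \<Phi>[OF h(2)] by linarith
      then have "?q\<^sup>2 \<le> (Mc * ?N)\<^sup>2" by (simp only: abs_le_square_iff)
      moreover have "(?p + ?q)\<^sup>2 \<le> 2 * ?p\<^sup>2 + 2 * ?q\<^sup>2" using sum_squares_bound[of ?p ?q] by (simp add: power2_sum)
      ultimately show "(f \<xi>)\<^sup>2 \<le> 2 * \<rho>\<^sup>2 * (V (\<xi> / b))\<^sup>2 + 2 * (Mc * ?N)\<^sup>2"
        using h by (simp add: power_mult_distrib)
    qed
  qed (use f(1) i1 i2 in \<open>auto intro!: set_integral_add\<close>)
  also have "\<dots> = 2 * \<rho>\<^sup>2 * (LINT \<xi>:{0..L}|lborel. (V (\<xi> / b))\<^sup>2) + L * (2 * (Mc * ?N)\<^sup>2)"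
    using i1 i2 pos by (simp add: set_integral_add) (simp add: set_lebesgue_integral_def)
  also have "(LINT \<xi>:{0..L}|lborel. (V (\<xi> / b))\<^sup>2) = b * (LINT s:{0..T}|lborel. (V s)\<^sup>2)"
    using set_integral_affine[OF _ dom2, of "\<lambda>\<xi>. (V (\<xi> / b))\<^sup>2"] pos by simp
  also have "2 * \<rho>\<^sup>2 * (b * (LINT s:{0..T}|lborel. (V s)\<^sup>2)) + L * (2 * (Mc * ?N)\<^sup>2)
      \<le> 2 * \<rho>\<^sup>2 * (b * ?E) + L * (2 * (Mc\<^sup>2 * (S * ?E)))"
    unfolding power_mult_distrib using pos T CS VT V(2)
    by (intro add_mono mult_left_mono set_integral_mono_set) auto
  finally show ?thesis by (simp add: algebra_simps)
qed

text \<open>The line x = 0 is a null set of the plane, so the section must be obtained from Borel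
  measurability, by composing with the map \<xi> to (0, \<xi>). The indicator is needed because the
  kernel is controlled only on its triangle.\<close>

lemma bounded_measurable_section:
  assumes K: "bounded_measurable_on (kernel_domain L 1) K" and "0 \<le> L"
  obtains M where "(\<lambda>\<xi>. indicator {0..L} \<xi> * K 0 \<xi>) \<in> borel_measurable borel"
    "\<And>\<xi>. \<bar>indicator {0..L} \<xi> * K 0 \<xi>\<bar> \<le> M"
proof -
  obtain B where B: "\<And>x \<xi>. (x, \<xi>) \<in> kernel_domain L 1 \<Longrightarrow> \<bar>K x \<xi>\<bar> \<le> B"
    using K unfolding bounded_measurable_on_def by blast
  have dom: "(0, \<xi>) \<in> kernel_domain L 1 \<longleftrightarrow> \<xi> \<in> {0..L}" for \<xi>
    using assms(2) by (auto simp: kernel_domain_def road_def)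
  have 1: "(\<lambda>z. indicator (kernel_domain L 1) z *\<^sub>R (case z of (x, \<xi>) \<Rightarrow> K x \<xi>)) \<in> borel_measurable borel"
    using K unfolding bounded_measurable_on_def set_borel_measurable_def by blast
  have 2: "(\<lambda>\<xi>. (0, \<xi>) :: real \<times> real) \<in> borel_measurable borel"
    by (intro borel_measurable_continuous_onI continuous_intros)
  have "(\<lambda>\<xi>. indicator (kernel_domain L 1) (0, \<xi>) *\<^sub>R K 0 \<xi>) \<in> borel_measurable borel"
    using measurable_compose[OF 2 1] by (simp only: prod.case)
  moreover have "indicator (kernel_domain L 1) (0, \<xi>) = (indicator {0..L} \<xi> :: real)" for \<xi>
    unfolding indicator_def dom ..
  ultimately have "(\<lambda>\<xi>. indicator {0..L} \<xi> * K 0 \<xi>) \<in> borel_measurable borel"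
    by simp
  moreover have "\<bar>indicator {0..L} \<xi> * K 0 \<xi>\<bar> \<le> \<bar>B\<bar>" for \<xi>
    using B[of 0 \<xi>] dom by (auto simp: indicator_def)
  ultimately show thesis using that by blast
qed

text \<open>The right-hand side is the source that \<open>u\<close> collects on its way from x = L
  at time 0 to x = 0 at time \<open>T\<close>. The kernel integral at x = 0 compensates exactly this
  amount.\<close>

lemma backstepping_trace:
  fixes a b L \<rho> :: real and c V f g :: "real \<Rightarrow> real" and Kvw Kvv :: "real \<Rightarrow> real \<Rightarrow> real"
  defines "T \<equiv> L / b" and "S \<equiv> L / b + L / a"
  assumes pos: "0 < a" "0 < b" "0 < L"
    and c: "continuous_on UNIV c"
    and bdd: "bounded_measurable_on (kernel_domain L 1) Kvw" "bounded_measurable_on (kernel_domain L 1) Kvv"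
    and ker: "kernel_equations (kernel_domain L 1) b a c Kvw Kvv"
    and diag: "\<forall>x\<in>{0..L}. Kvw x x = c x / (a + b)"
    and bc: "\<forall>x\<in>{0..L}. a * Kvw x L = b * \<rho> * Kvv x L"
    and V: "V \<in> borel_measurable borel" "set_integrable lborel {0..S} V"
    and g: "set_borel_measurable lborel {0..L} g"
      "AE \<xi> in lborel. \<xi> \<in> {0..L} \<longrightarrow> g \<xi> = V (T + (L - \<xi>) / a)"
    and f: "set_borel_measurable lborel {0..L} f"
      "AE \<xi> in lborel. \<xi> \<in> {0..L} \<longrightarrow> f \<xi> = \<rho> * V (\<xi> / b)
        + (LINT \<sigma>:{\<xi> / b..T}|lborel. c (L + \<xi> - b * \<sigma>) * V (\<sigma> + (b * \<sigma> - \<xi>) / a))"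
  shows "(LINT \<xi>:{0..L}|lborel. Kvw 0 \<xi> * g \<xi> + Kvv 0 \<xi> * f \<xi>)
      = (LINT \<sigma>:{0..T}|lborel. c (L - b * \<sigma>) * V (\<sigma> + b * \<sigma> / a))"
proof -
  let ?F = "\<lambda>\<xi>. indicator {0..L} \<xi> * Kvw 0 \<xi>" and ?k = "\<lambda>\<xi>. indicator {0..L} \<xi> * Kvv 0 \<xi>"
  have L: "0 \<le> L" using pos by simp
  obtain M1 where F: "?F \<in> borel_measurable borel" "\<And>\<xi>. \<bar>?F \<xi>\<bar> \<le> M1"
    using bounded_measurable_section[OF bdd(1) L] by blast
  obtain M2 where k: "?k \<in> borel_measurable borel" "\<And>\<xi>. \<bar>?k \<xi>\<bar> \<le> M2"
    using bounded_measurable_section[OF bdd(2) L] by blast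
  have F': "\<bar>?F \<xi>\<bar> \<le> max M1 M2" for \<xi> using F(2)[of \<xi>] by linarith
  have k': "\<bar>?k \<xi>\<bar> \<le> max M1 M2" for \<xi> using k(2)[of \<xi>] by linarith
  have "(LINT \<xi>:{0..L}|lborel. Kvw 0 \<xi> * g \<xi> + Kvv 0 \<xi> * f \<xi>)
      = (LINT \<xi>:{0..L}|lborel. ?F \<xi> * g \<xi> + ?k \<xi> * f \<xi>)"
    by (intro set_lebesgue_integral_cong) auto
  also have "\<dots> = (LINT \<sigma>:{0..T}|lborel. c (L - b * \<sigma>) * V (\<sigma> + b * \<sigma> / a))"
    unfolding T_def
  proof (rule kernel_functional[OF pos c F(1) F' k(1) k' V[unfolded S_def] g[unfolded T_def] f[unfolded T_def]])
    fix s assume s: "0 \<le> s" "s \<le> L / b + L / a"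
    \<comment> \<open>The cut-off kernels agree with the original ones at every point where
      \<open>kernel_identity\<close> evaluates them.\<close>
    have 1: "\<xi> \<in> {0..L}" if "\<xi> \<in> {0..min (b * s) ((a + b) * (L / b) - a * s)}" for \<xi>
    proof -
      have h: "0 \<le> \<xi>" "\<xi> \<le> b * s" "\<xi> \<le> (a + b) * (L / b) - a * s" using that by auto
      have "a * \<xi> \<le> a * (b * s)" "b * \<xi> \<le> b * ((a + b) * (L / b) - a * s)"
        using h pos by (auto intro!: mult_left_mono simp del: times_divide_eq_right)
      moreover have "b * ((a + b) * (L / b) - a * s) = (a + b) * L - a * (b * s)"
        using pos by (simp add: right_diff_distrib)
      ultimately have "(a + b) * \<xi> \<le> (a + b) * L" by (simp add: distrib_right)
      then show ?thesis using h pos by (simp add: mult_le_cancel_left_pos)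
    qed
    have 2: "b * s \<in> {0..L}" if "s \<le> L / b" using that s pos by (simp add: field_simps)
    have 3: "L + a * (L / b) - a * s \<in> {0..L}" if "\<not> s \<le> L / b"
    proof -
      have "a * s \<le> a * (L / b + L / a)" using s pos by (intro mult_left_mono) auto
      moreover have "a * (L / b + L / a) = a * (L / b) + L" using pos by (simp add: distrib_left)
      moreover have "a * (L / b) \<le> a * s" using that pos by (intro mult_left_mono) auto
      ultimately show ?thesis by auto
    qed
    have "(LINT \<xi>:{0..min (b * s) ((a + b) * (L / b) - a * s)}|lborel.
            ?k \<xi> * c (L + \<xi> - b * (a * s + \<xi>) / (a + b)))
        = (LINT \<xi>:{0..min (b * s) ((a + b) * (L / b) - a * s)}|lborel.
            Kvv 0 \<xi> * c (L + \<xi> - b * (a * s + \<xi>) / (a + b)))"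
      using 1 by (intro set_lebesgue_integral_cong) (auto simp: indicator_def)
    moreover have "(if s \<le> L / b then b * \<rho> * ?k (b * s) else a * ?F (L + a * (L / b) - a * s))
      = (if s \<le> L / b then b * \<rho> * Kvv 0 (b * s) else a * Kvw 0 (L + a * (L / b) - a * s))"
      using 2 3 by simp
    ultimately show "a / (a + b) * c (L - b * (a * s) / (a + b))
      = (if s \<le> L / b then b * \<rho> * ?k (b * s) else a * ?F (L + a * (L / b) - a * s))
        + a / (a + b) * (LINT \<xi>:{0..min (b * s) ((a + b) * (L / b) - a * s)}|lborel.
            ?k \<xi> * c (L + \<xi> - b * (a * s + \<xi>) / (a + b)))"
      using kernel_identity[OF pos ker diag bc s] by (simp only:)
  qed
  finally show ?thesis .
qed

section \<open>Reflection of the upstream kernels\<close>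

lemma kernel_domain_reflect:
  "(- x, - \<xi>) \<in> kernel_domain L 2 \<longleftrightarrow> (x, \<xi>) \<in> kernel_domain L 1"
  by (auto simp: kernel_domain_def road_def)

lemma bounded_measurable_reflect:
  assumes "bounded_measurable_on (kernel_domain L 2) K"
  shows "bounded_measurable_on (kernel_domain L 1) (\<lambda>x \<xi>. K (- x) (- \<xi>))"
proof -
  have 1: "(\<lambda>z. indicator (kernel_domain L 2) z *\<^sub>R (case z of (x, \<xi>) \<Rightarrow> K x \<xi>)) \<in> borel_measurable borel"
    using assms unfolding bounded_measurable_on_def set_borel_measurable_def by blast
  have 2: "uminus \<in> borel_measurable (borel :: (real \<times> real) measure)"
    by (intro borel_measurable_continuous_onI continuous_intros)
  have "(\<lambda>z. indicator (kernel_domain L 2) (- z) *\<^sub>R (case - z of (x, \<xi>) \<Rightarrow> K x \<xi>))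
      \<in> borel_measurable borel"
    by (rule measurable_compose[OF 2 1])
  moreover have "(\<lambda>z. indicator (kernel_domain L 2) (- z) *\<^sub>R (case - z of (x, \<xi>) \<Rightarrow> K x \<xi>))
      = (\<lambda>z. indicator (kernel_domain L 1) z *\<^sub>R (case z of (x, \<xi>) \<Rightarrow> K (- x) (- \<xi>)))"
    by (auto simp: fun_eq_iff indicator_def kernel_domain_reflect)
  moreover obtain B where "\<And>x \<xi>. (x, \<xi>) \<in> kernel_domain L 2 \<Longrightarrow> \<bar>K x \<xi>\<bar> \<le> B"
    using assms unfolding bounded_measurable_on_def by blast
  then have "\<forall>(x, \<xi>)\<in>kernel_domain L 1. \<bar>K (- x) (- \<xi>)\<bar> \<le> B"
    using kernel_domain_reflect by blast
  ultimately show ?thesis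
    unfolding bounded_measurable_on_def set_borel_measurable_def by auto
qed

text \<open>Reflection reverses the direction of the characteristics, hence the substitution of s -
  \<sigma> for \<sigma> and the change of sign of the increment of \<open>Kvw\<close>, which is
  absorbed by the source coefficient -c(-x).\<close>

lemma kernel_equations_reflect:
  assumes "kernel_equations (kernel_domain L 2) b a c Kvw Kvv"
  shows "kernel_equations (kernel_domain L 1) b a (\<lambda>x. - c (- x))
    (\<lambda>x \<xi>. Kvw (- x) (- \<xi>)) (\<lambda>x \<xi>. Kvv (- x) (- \<xi>))"
  unfolding kernel_equations_def
proof (intro conjI allI impI, goal_cases)
  case (1 x \<xi> s)
  let ?x = "- (x + b * s)" and ?\<xi> = "- (\<xi> - a * s)"
  have e: "?x + b * s = - x" "?\<xi> - a * s = - \<xi>" by auto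
  have "(?x, ?\<xi>) \<in> kernel_domain L 2 \<and> 0 \<le> s \<and> (?x + b * s, ?\<xi> - a * s) \<in> kernel_domain L 2"
    unfolding e using 1 by (simp only: kernel_domain_reflect)
  then have "Kvw (?x + b * s) (?\<xi> - a * s) - Kvw ?x ?\<xi>
      = (LINT \<sigma>:{0..s}|lborel. c (?\<xi> - a * \<sigma>) * Kvv (?x + b * \<sigma>) (?\<xi> - a * \<sigma>))"
    using assms unfolding kernel_equations_def by blast
  then have "Kvw ?x ?\<xi> - Kvw (- x) (- \<xi>)
      = - (LINT \<sigma>:{0..s}|lborel. c (?\<xi> - a * \<sigma>) * Kvv (?x + b * \<sigma>) (?\<xi> - a * \<sigma>))"
    unfolding e by simp
  also have "(LINT \<sigma>:{0..s}|lborel. c (?\<xi> - a * \<sigma>) * Kvv (?x + b * \<sigma>) (?\<xi> - a * \<sigma>))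
      = (LINT \<sigma>:{0..s}|lborel. c (- (\<xi> - a * \<sigma>)) * Kvv (- (x + b * \<sigma>)) (- (\<xi> - a * \<sigma>)))"
  proof -
    have "(s + - 1 * \<sigma> \<in> {0..s}) \<longleftrightarrow> \<sigma> \<in> {0..s}" for \<sigma> by auto
    from set_integral_affine[OF _ this, of "\<lambda>\<sigma>. c (?\<xi> - a * \<sigma>) * Kvv (?x + b * \<sigma>) (?\<xi> - a * \<sigma>)"]
    have "(LINT \<sigma>:{0..s}|lborel. c (?\<xi> - a * \<sigma>) * Kvv (?x + b * \<sigma>) (?\<xi> - a * \<sigma>))
      = (LINT \<sigma>:{0..s}|lborel. c (?\<xi> - a * (s + - 1 * \<sigma>))
          * Kvv (?x + b * (s + - 1 * \<sigma>)) (?\<xi> - a * (s + - 1 * \<sigma>)))" by simp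
    moreover have "?\<xi> - a * (s + - 1 * \<sigma>) = - (\<xi> - a * \<sigma>)" "?x + b * (s + - 1 * \<sigma>) = - (x + b * \<sigma>)" for \<sigma>
      by (auto simp: algebra_simps)
    ultimately show ?thesis by (simp only:)
  qed
  finally show ?case by (simp add: set_lebesgue_integral_def)
next
  case (2 x \<xi> s)
  let ?x = "- (x + s)" and ?\<xi> = "- (\<xi> + s)"
  have e: "?x + s = - x" "?\<xi> + s = - \<xi>" by auto
  have "(?x, ?\<xi>) \<in> kernel_domain L 2 \<and> 0 \<le> s \<and> (?x + s, ?\<xi> + s) \<in> kernel_domain L 2"
    unfolding e using 2 by (simp only: kernel_domain_reflect)
  then have "Kvv (?x + s) (?\<xi> + s) = Kvv ?x ?\<xi>"
    using assms unfolding kernel_equations_def by blast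
  then show ?case unfolding e by simp
qed

section \<open>Riemann coordinates along their characteristics\<close>

text \<open>The label s = t - (x - l) / a is the time at which a characteristic passes x = l.
  \<open>e s\<close> is its entry point into space-time: (l, s) for s \<ge> 0, and (l - a * s, 0)
  for s < 0. Quantifying over x and t inside a single almost-everywhere statement in the label
  allows every transversal slice to be taken later.\<close>

lemma transport_profile:
  fixes l h a :: real
  assumes w: "mild_transport {l..h} a (\<lambda>x t. 0) w" and a: "0 < a" and lh: "l < h"
  obtains G where "G \<in> borel_measurable borel"
    "AE s in lborel. \<forall>x t. x \<in> {l..h} \<and> 0 \<le> t \<and> s = t - (x - l) / a \<longrightarrow> w x t = G s"
proof -
  let ?X = "{l..h} \<times> {0..} :: (real \<times> real) set"
  define e where "e = (\<lambda>s. (l - a * min s 0, max s 0))"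
  define G where "G = (\<lambda>s. indicator ?X (e s) *\<^sub>R (case e s of (x, t) \<Rightarrow> w x t))"
  have 1: "(\<lambda>z. indicator ?X z *\<^sub>R (case z of (x, t) \<Rightarrow> w x t)) \<in> borel_measurable borel"
    using w unfolding mild_transport_def set_borel_measurable_def by blast
  have 2: "e \<in> borel_measurable borel"
    unfolding e_def by (intro borel_measurable_continuous_onI continuous_intros)
  have "G \<in> borel_measurable borel"
    unfolding G_def by (rule measurable_compose[OF 2 1])
  moreover have "AE s in lborel. \<forall>x t. x \<in> {l..h} \<and> 0 \<le> t \<and> s = t - (x - l) / a \<longrightarrow> w x t = G s"
  proof -
    have "AE y in lborel. \<forall>s t. 0 \<le> s \<and> s \<le> t \<and> y + a * s \<in> {l..h} \<and> y + a * t \<in> {l..h} \<longrightarrow>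
        w (y + a * t) t = w (y + a * s) s"
      using w unfolding mild_transport_def by (auto elim!: eventually_mono)
    then have "AE r in lborel. \<forall>s t. 0 \<le> s \<and> s \<le> t \<and> (l + - a * r) + a * s \<in> {l..h}
        \<and> (l + - a * r) + a * t \<in> {l..h} \<longrightarrow>
        w ((l + - a * r) + a * t) t = w ((l + - a * r) + a * s) s"
      using a by (intro AE_lborel_affine[where c = "- a" and t = l]) auto
    then show ?thesis
    proof (eventually_elim, intro allI impI)
      fix r x t
      assume h: "\<forall>s t. 0 \<le> s \<and> s \<le> t \<and> (l + - a * r) + a * s \<in> {l..h}
        \<and> (l + - a * r) + a * t \<in> {l..h} \<longrightarrow>
        w ((l + - a * r) + a * t) t = w ((l + - a * r) + a * s) s"
        and xt: "x \<in> {l..h} \<and> 0 \<le> t \<and> r = t - (x - l) / a"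
      have ar: "a * r = a * t - (x - l)" using xt a by (simp add: field_simps)
      have 1: "(l + - a * r) + a * t = x" using ar by simp
      have 2: "(l + - a * r) + a * max r 0 = l - a * min r 0"
        by (auto simp: max_def min_def)
      have 3: "max r 0 \<le> t" using xt a by (auto simp: zero_le_divide_iff)
      have 4: "l - a * min r 0 \<in> {l..h}"
      proof (cases "0 \<le> r")
        case False
        have "0 \<le> a * t" using xt a by simp
        moreover have "a * r \<le> 0" using False a by (simp add: mult_le_0_iff)
        ultimately show ?thesis using False ar xt by simp
      qed (use lh in simp)
      have "w x t = w (l - a * min r 0) (max r 0)"
        using h[rule_format, of "max r 0" t] 3 4 xt unfolding 1 2 by auto
      also have "\<dots> = G r" using 4 by (simp add: G_def e_def)
      finally show "w x t = G r" .
    qed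
  qed
  ultimately show thesis using that by blast
qed

text \<open>Along lines t = const, lines x = const and \<open>u\<close> characteristics the label is
  affine with slopes -1 / a, 1 and 1 + b / a. None of them is zero, so a null set of labels meets
  each such line in a null set.\<close>

lemma profile_slice:
  fixes a :: real
  assumes "0 < a" "AE s in lborel. \<forall>x t. x \<in> X \<and> 0 \<le> t \<and> s = t - (x - l) / a \<longrightarrow> w x t = G s"
  shows "0 \<le> t \<Longrightarrow> AE x in lborel. x \<in> X \<longrightarrow> w x t = G (t - (x - l) / a)"
    and "x \<in> X \<Longrightarrow> AE t in lborel. 0 \<le> t \<longrightarrow> w x t = G (t - (x - l) / a)"
    and "0 < b \<Longrightarrow> AE \<sigma> in lborel. y - b * \<sigma> \<in> X \<and> 0 \<le> \<sigma> \<longrightarrow>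
        w (y - b * \<sigma>) \<sigma> = G (\<sigma> - (y - b * \<sigma> - l) / a)"
proof -
  have s: "- 1 / a \<noteq> 0" using assms(1) by simp
  have e: "(t + l / a) + (- 1 / a) * x = t - (x - l) / a" for x t
    by (simp add: diff_divide_distrib)
  show "AE x in lborel. x \<in> X \<longrightarrow> w x t = G (t - (x - l) / a)" if "0 \<le> t"
    using AE_lborel_affine[OF s assms(2), of "t + l / a"] unfolding e
    by eventually_elim (use that in auto)
  have e: "(- (x - l) / a) + 1 * t = t - (x - l) / a" for t
    by (simp add: diff_divide_distrib)
  show "AE t in lborel. 0 \<le> t \<longrightarrow> w x t = G (t - (x - l) / a)" if "x \<in> X"
    using AE_lborel_affine[OF one_neq_zero assms(2), of "- (x - l) / a"] unfolding e
    by eventually_elim (use that in auto)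
  have e: "(- (y - l) / a) + (1 + b / a) * \<sigma> = \<sigma> - (y - b * \<sigma> - l) / a" for \<sigma>
    by (simp add: diff_divide_distrib distrib_right)
  show "AE \<sigma> in lborel. y - b * \<sigma> \<in> X \<and> 0 \<le> \<sigma> \<longrightarrow>
        w (y - b * \<sigma>) \<sigma> = G (\<sigma> - (y - b * \<sigma> - l) / a)" if "0 < b"
  proof -
    have "0 < b / a" using that assms(1) by simp
    then have "1 + b / a \<noteq> 0" by linarith
    from AE_lborel_affine[OF this assms(2), of "- (y - l) / a"] show ?thesis unfolding e
      by eventually_elim auto
  qed
qed

text \<open>At time t the road displays exactly the window of \<open>G\<close> of length (h - l) / a
  ending at t. The third claim glues consecutive windows, starting from the one given by the initial
  values.\<close>

lemma profile_L2:
  fixes l h a :: real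
  assumes w: "mild_transport {l..h} a (\<lambda>x t. 0) w" and a: "0 < a" and lh: "l < h"
    and G: "G \<in> borel_measurable borel"
      "AE s in lborel. \<forall>x t. x \<in> {l..h} \<and> 0 \<le> t \<and> s = t - (x - l) / a \<longrightarrow> w x t = G s"
  shows "0 \<le> t \<Longrightarrow> set_integrable lborel {t - (h - l) / a..t} (\<lambda>s. (G s)\<^sup>2)"
    and "0 \<le> t \<Longrightarrow> (L2_norm {l..h} (\<lambda>x. w x t))\<^sup>2 = a * (LINT s:{t - (h - l) / a..t}|lborel. (G s)\<^sup>2)"
    and "set_integrable lborel {- ((h - l) / a)..N} (\<lambda>s. (G s)\<^sup>2)"
proof -
  have dom: "(t + l / a) + (- 1 / a) * x \<in> {t - (h - l) / a..t} \<longleftrightarrow> x \<in> {l..h}" for x t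
  proof -
    have 1: "(t + l / a) + (- 1 / a) * x = t - (x - l) / a"
      by (simp add: diff_divide_distrib)
    show ?thesis unfolding 1 using a by (auto simp: divide_le_cancel zero_le_divide_iff)
  qed
  have arg: "(t + l / a) + (- 1 / a) * x = t - (x - l) / a" for x t
    by (simp add: diff_divide_distrib)
  have s: "- 1 / a \<noteq> 0" using a by simp
  note aff = set_integrable_affine[OF s dom, where f = "\<lambda>s. (G s)\<^sup>2", unfolded arg]
    set_integral_affine[OF s dom, where f = "\<lambda>s. (G s)\<^sup>2", unfolded arg]
  have slice: "set_integrable lborel {l..h} (\<lambda>x. (G (t - (x - l) / a))\<^sup>2)
    \<and> (L2_norm {l..h} (\<lambda>x. w x t))\<^sup>2 = (LINT x:{l..h}|lborel. (G (t - (x - l) / a))\<^sup>2)" if "0 \<le> t" for t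
  proof -
    have L2: "in_L2 {l..h} (\<lambda>x. w x t)"
      using w that unfolding mild_transport_def continuous_in_L2_def by blast
    then have i: "integrable lborel (\<lambda>x. indicator {l..h} x *\<^sub>R (w x t)\<^sup>2)"
      unfolding in_L2_def set_integrable_def by simp
    have m: "(\<lambda>x. indicator {l..h} x *\<^sub>R (G (t - (x - l) / a))\<^sup>2) \<in> borel_measurable lborel"
      using G(1) by measurable
    have ae: "AE x in lborel. indicator {l..h} x *\<^sub>R (w x t)\<^sup>2 = indicator {l..h} x *\<^sub>R (G (t - (x - l) / a))\<^sup>2"
      using profile_slice(1)[OF a G(2) that] by eventually_elim (auto simp: indicator_def)
    have "integrable lborel (\<lambda>x. indicator {l..h} x *\<^sub>R (G (t - (x - l) / a))\<^sup>2)"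
      using integrable_cong_AE[OF borel_measurable_integrable[OF i] m ae] i by simp
    moreover have "(\<integral>x. indicator {l..h} x *\<^sub>R (w x t)\<^sup>2 \<partial>lborel)
        = (\<integral>x. indicator {l..h} x *\<^sub>R (G (t - (x - l) / a))\<^sup>2 \<partial>lborel)"
      by (rule integral_cong_AE[OF borel_measurable_integrable[OF i] m ae])
    ultimately show ?thesis
      using L2_norm_square[OF L2] by (simp add: set_integrable_def set_lebesgue_integral_def)
  qed
  show window: "set_integrable lborel {t - (h - l) / a..t} (\<lambda>s. (G s)\<^sup>2)" if "0 \<le> t" for t
    using slice[OF that] aff(1) by blast
  show "(L2_norm {l..h} (\<lambda>x. w x t))\<^sup>2 = a * (LINT s:{t - (h - l) / a..t}|lborel. (G s)\<^sup>2)" if "0 \<le> t"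
    using slice[OF that] aff(2)[of t] a by simp
  define d where "d = (h - l) / a"
  have d: "0 < d" using a lh by (simp add: d_def)
  have 1: "set_integrable lborel {- d..real n * d} (\<lambda>s. (G s)\<^sup>2)" for n
  proof (induction n)
    case 0
    show ?case using window[of 0] by (simp add: d_def)
  next
    case (Suc n)
    have "set_integrable lborel {real (Suc n) * d - d..real (Suc n) * d} (\<lambda>s. (G s)\<^sup>2)"
      using window[of "real (Suc n) * d"] d unfolding d_def[symmetric] by simp
    then have "set_integrable lborel ({- d..real n * d} \<union> {real (Suc n) * d - d..real (Suc n) * d})
        (\<lambda>s. (G s)\<^sup>2)"
      using Suc by (intro set_integrable_Un) auto
    moreover have "{- d..real n * d} \<union> {real (Suc n) * d - d..real (Suc n) * d} = {- d..real (Suc n) * d}"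
    proof -
      define q where "q = real n * d"
      have "0 \<le> q" "real (Suc n) * d = q + d" using d by (simp_all add: q_def distrib_right)
      then show ?thesis using d unfolding q_def[symmetric] by auto
    qed
    ultimately show ?case by simp
  qed
  obtain n where n: "N \<le> real n * d" using reals_Archimedean3[OF d] less_imp_le by blast
  show "set_integrable lborel {- ((h - l) / a)..N} (\<lambda>s. (G s)\<^sup>2)"
    unfolding d_def[symmetric] using n by (intro set_integrable_subset[OF 1[of n]]) auto
qed

text \<open>The exceptional set of y comes from \<open>u\<close> alone: on every single
  \<open>u\<close> characteristic inside the domain, \<open>w\<close> differs from its profile only
  at a null set of times, which the source integral does not see.\<close>

lemma driven_characteristics:
  fixes l h a b :: real and c :: "real \<Rightarrow> real"
  assumes u: "mild_transport {l..h} (- b) (\<lambda>x t. c x * w x t) u" and pos: "0 < a" "0 < b"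
    and c: "continuous_on UNIV c"
    and G: "G \<in> borel_measurable borel"
      "AE s in lborel. \<forall>x t. x \<in> {l..h} \<and> 0 \<le> t \<and> s = t - (x - l) / a \<longrightarrow> w x t = G s"
  shows "AE y in lborel. \<forall>s t. 0 \<le> s \<and> s \<le> t \<and> y - b * s \<in> {l..h} \<and> y - b * t \<in> {l..h} \<longrightarrow>
      u (y - b * t) t - u (y - b * s) s
        = (LINT \<sigma>:{s..t}|lborel. c (y - b * \<sigma>) * G (\<sigma> - (y - b * \<sigma> - l) / a))"
proof -
  have cm[measurable]: "c \<in> borel_measurable borel"
    using c by (simp add: borel_measurable_continuous_onI)
  note [measurable] = G(1)
  have "AE y in lborel. \<forall>s t. 0 \<le> s \<and> s \<le> t \<and> y - b * s \<in> {l..h} \<and> y - b * t \<in> {l..h} \<longrightarrow>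
      set_integrable lborel {s..t} (\<lambda>\<sigma>. c (y - b * \<sigma>) * w (y - b * \<sigma>) \<sigma>) \<and>
      u (y - b * t) t - u (y - b * s) s
        = (LINT \<sigma>:{s..t}|lborel. c (y - b * \<sigma>) * w (y - b * \<sigma>) \<sigma>)"
    using u unfolding mild_transport_def by simp
  then show ?thesis
  proof (eventually_elim, intro allI impI, goal_cases)
    case (1 y s t)
    then have i: "set_integrable lborel {s..t} (\<lambda>\<sigma>. c (y - b * \<sigma>) * w (y - b * \<sigma>) \<sigma>)"
      and eq: "u (y - b * t) t - u (y - b * s) s
        = (LINT \<sigma>:{s..t}|lborel. c (y - b * \<sigma>) * w (y - b * \<sigma>) \<sigma>)" by blast+
    have inX: "y - b * \<sigma> \<in> {l..h} \<and> 0 \<le> \<sigma>" if "\<sigma> \<in> {s..t}" for \<sigma>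
    proof -
      have "b * s \<le> b * \<sigma>" "b * \<sigma> \<le> b * t" using that pos by auto
      then show ?thesis using 1(3) that by auto
    qed
    have "(LINT \<sigma>:{s..t}|lborel. c (y - b * \<sigma>) * w (y - b * \<sigma>) \<sigma>)
        = (LINT \<sigma>:{s..t}|lborel. c (y - b * \<sigma>) * G (\<sigma> - (y - b * \<sigma> - l) / a))"
      unfolding set_lebesgue_integral_def
    proof (rule integral_cong_AE)
      show "(\<lambda>\<sigma>. indicator {s..t} \<sigma> *\<^sub>R (c (y - b * \<sigma>) * w (y - b * \<sigma>) \<sigma>)) \<in> borel_measurable lborel"
        using i unfolding set_integrable_def by (rule borel_measurable_integrable)
      show "AE \<sigma> in lborel. indicator {s..t} \<sigma> *\<^sub>R (c (y - b * \<sigma>) * w (y - b * \<sigma>) \<sigma>)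
          = indicator {s..t} \<sigma> *\<^sub>R (c (y - b * \<sigma>) * G (\<sigma> - (y - b * \<sigma> - l) / a))"
        using profile_slice(3)[OF pos(1) G(2) pos(2), of y]
      proof eventually_elim
        case (elim \<sigma>)
        then show ?case using inX[of \<sigma>] by (cases "\<sigma> \<in> {s..t}") auto
      qed
    qed measurable
    then show ?case using eq by simp
  qed
qed

section \<open>The two roads\<close>

lemma set_integrable_profile_window:
  fixes G :: "real \<Rightarrow> real"
  assumes "\<And>N. set_integrable lborel {t0..N} (\<lambda>s. (G s)\<^sup>2)" "t0 \<le> p"
  shows "set_integrable lborel {p..q} (\<lambda>s. (G s)\<^sup>2)"
  using assms(2) by (intro set_integrable_subset[OF assms(1)[of q]]) auto

section \<open>The outgoing road, where \<open>u\<close> enters at x = L\<close>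

context
  fixes a b L \<rho> :: real and c G :: "real \<Rightarrow> real" and w u :: "real \<Rightarrow> real \<Rightarrow> real"
  assumes pos: "0 < a" "0 < b" "0 < L"
    and c: "continuous_on UNIV c"
    and w: "mild_transport {0..L} a (\<lambda>x t. 0) w"
    and u: "mild_transport {0..L} (- b) (\<lambda>x t. c x * w x t) u"
    and G: "G \<in> borel_measurable borel"
      "AE s in lborel. \<forall>x t. x \<in> {0..L} \<and> 0 \<le> t \<and> s = t - (x - 0) / a \<longrightarrow> w x t = G s"
    and inflow: "AE t in lborel. 0 \<le> t \<longrightarrow> u L t = \<rho> * w L t"
begin

text \<open>After one transit time L / b, every \<open>u\<close> characteristic on the road has left
  x = L at the nonnegative time t0 + \<xi> / b, so the initial values of \<open>u\<close> have been
  flushed out. The shifted profile G (t0 - L / a + s) is the \<open>V s\<close> of the kernel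
  computation.\<close>

lemma downstream_outflow:
  assumes "0 \<le> t0"
  shows "AE \<xi> in lborel. \<xi> \<in> {0..L} \<longrightarrow> u \<xi> (t0 + L / b) = \<rho> * G (t0 - L / a + \<xi> / b)
    + (LINT \<sigma>:{\<xi> / b..L / b}|lborel. c (L + \<xi> - b * \<sigma>) * G (t0 - L / a + (\<sigma> + (b * \<sigma> - \<xi>) / a)))"
proof -
  have b1: "1 / b \<noteq> 0" using pos by simp
  have "L \<in> {0..L}" using pos by simp
  note w_L = profile_slice(2)[OF pos(1) G(2) this]
  note D = driven_characteristics[OF u pos(1,2) c G]
  show ?thesis
    using AE_lborel_affine[OF one_neq_zero D, of "b * (t0 + L / b)"]
      AE_lborel_affine[OF b1 w_L, of t0] AE_lborel_affine[OF b1 inflow, of t0]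
  proof (eventually_elim, intro impI)
    fix \<xi>
    let ?y = "b * (t0 + L / b) + 1 * \<xi>"
    assume D: "\<forall>s t. 0 \<le> s \<and> s \<le> t \<and> ?y - b * s \<in> {0..L} \<and> ?y - b * t \<in> {0..L} \<longrightarrow>
      u (?y - b * t) t - u (?y - b * s) s
        = (LINT \<sigma>:{s..t}|lborel. c (?y - b * \<sigma>) * G (\<sigma> - (?y - b * \<sigma> - 0) / a))"
      and 1: "0 \<le> t0 + 1 / b * \<xi> \<longrightarrow> w L (t0 + 1 / b * \<xi>) = G (t0 + 1 / b * \<xi> - (L - 0) / a)"
        "0 \<le> t0 + 1 / b * \<xi> \<longrightarrow> u L (t0 + 1 / b * \<xi>) = \<rho> * w L (t0 + 1 / b * \<xi>)"
      and \<xi>: "\<xi> \<in> {0..L}"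
    have s0: "0 \<le> \<xi> / b" "\<xi> / b \<le> L / b" using \<xi> pos by (auto simp: divide_right_mono)
    have y: "?y - b * (t0 + L / b) = \<xi>" "?y - b * (t0 + \<xi> / b) = L"
      using pos by (simp_all add: distrib_left)
    have "u \<xi> (t0 + L / b) - u L (t0 + \<xi> / b)
        = (LINT \<sigma>:{t0 + \<xi> / b..t0 + L / b}|lborel. c (?y - b * \<sigma>) * G (\<sigma> - (?y - b * \<sigma> - 0) / a))"
      using D[rule_format, of "t0 + \<xi> / b" "t0 + L / b"] s0 assms \<xi> pos unfolding y by simp
    also have "\<dots> = (LINT \<sigma>:{\<xi> / b..L / b}|lborel.
        c (L + \<xi> - b * \<sigma>) * G (t0 - L / a + (\<sigma> + (b * \<sigma> - \<xi>) / a)))"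
    proof -
      have "t0 + 1 * \<sigma> \<in> {t0 + \<xi> / b..t0 + L / b} \<longleftrightarrow> \<sigma> \<in> {\<xi> / b..L / b}" for \<sigma> by auto
      note aff = set_integral_affine[OF one_neq_zero this,
          where f = "\<lambda>\<sigma>. c (?y - b * \<sigma>) * G (\<sigma> - (?y - b * \<sigma> - 0) / a)"]
      have 1: "?y - b * (t0 + 1 * \<sigma>) = L + \<xi> - b * \<sigma>" for \<sigma>
        using pos by (simp add: distrib_left)
      have 2: "t0 + 1 * \<sigma> - (L + \<xi> - b * \<sigma> - 0) / a = t0 - L / a + (\<sigma> + (b * \<sigma> - \<xi>) / a)" for \<sigma>
        by (simp add: diff_divide_distrib add_divide_distrib)
      show ?thesis using aff unfolding 1 2 by simp
    qed
    finally show "u \<xi> (t0 + L / b) = \<rho> * G (t0 - L / a + \<xi> / b)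
      + (LINT \<sigma>:{\<xi> / b..L / b}|lborel. c (L + \<xi> - b * \<sigma>) * G (t0 - L / a + (\<sigma> + (b * \<sigma> - \<xi>) / a)))"
      using 1 s0 assms by (simp add: algebra_simps)
  qed
qed

lemma downstream_in_L2:
  assumes "0 \<le> t"
  shows "in_L2 {0..L} (\<lambda>x. w x t)" "in_L2 {0..L} (\<lambda>x. u x t)"
  using w u assms unfolding mild_transport_def continuous_in_L2_def by blast+

text \<open>The window runs from the label of \<open>w\<close> at x = L, time \<open>t0\<close>, to
  that at x = 0, time t0 + L / b: the labels crossed by a \<open>u\<close> characteristic on a full
  transit.\<close>

lemma downstream_window:
  assumes "0 \<le> t0"
  shows "set_integrable lborel {0..L / b + L / a} (\<lambda>s. (G (t0 - L / a + s))\<^sup>2)"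
    and "(LINT s:{0..L / b + L / a}|lborel. (G (t0 - L / a + s))\<^sup>2)
      = (LINT s:{t0 - L / a..t0 + L / b}|lborel. (G s)\<^sup>2)"
proof -
  have dom: "(t0 - L / a) + 1 * s \<in> {t0 - L / a..t0 + L / b} \<longleftrightarrow> s \<in> {0..L / b + L / a}" for s
    by auto
  have "set_integrable lborel {t0 - L / a..t0 + L / b} (\<lambda>s. (G s)\<^sup>2)"
    using assms by (intro set_integrable_profile_window[OF profile_L2(3)[OF w pos(1,3) G]]) simp
  then show "set_integrable lborel {0..L / b + L / a} (\<lambda>s. (G (t0 - L / a + s))\<^sup>2)"
    using set_integrable_affine[OF one_neq_zero dom, where f = "\<lambda>s. (G s)\<^sup>2"] by simp
  show "(LINT s:{0..L / b + L / a}|lborel. (G (t0 - L / a + s))\<^sup>2)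
      = (LINT s:{t0 - L / a..t0 + L / b}|lborel. (G s)\<^sup>2)"
    using set_integral_affine[OF one_neq_zero dom, where f = "\<lambda>s. (G s)\<^sup>2"] by simp
qed

lemma downstream_energy:
  assumes "\<And>x. x \<in> {0..L} \<Longrightarrow> \<bar>c x\<bar> \<le> Mc" "0 \<le> t0"
  shows "(L2_norm {0..L} (\<lambda>x. u x (t0 + L / b)))\<^sup>2
    \<le> (2 * \<rho>\<^sup>2 * b + 2 * Mc\<^sup>2 * (L / b + L / a) * L) * (LINT s:{t0 - L / a..t0 + L / b}|lborel. (G s)\<^sup>2)"
proof -
  have t: "0 \<le> t0 + L / b" using assms(2) pos by simp
  have V: "(\<lambda>s. G (t0 - L / a + s)) \<in> borel_measurable borel" using G(1) by measurable
  have "set_integrable lborel {0..L} (\<lambda>x. (u x (t0 + L / b))\<^sup>2)"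
    using downstream_in_L2(2)[OF t] by (simp add: in_L2_def)
  from outflow_energy[OF pos assms(1) V downstream_window(1)[OF assms(2)] this
      downstream_outflow[OF assms(2)]]
  show ?thesis
    unfolding L2_norm_square[OF downstream_in_L2(2)[OF t]] downstream_window(2)[OF assms(2)] .
qed

text \<open>The values of \<open>u\<close> at the two ends of one characteristic differ by the
  collected source, which \<open>backstepping_trace\<close> identifies with the kernel
  integral.\<close>

lemma downstream_trace:
  assumes bdd: "bounded_measurable_on (kernel_domain L 1) Kvw" "bounded_measurable_on (kernel_domain L 1) Kvv"
    and ker: "kernel_equations (kernel_domain L 1) b a c Kvw Kvv"
    and diag: "\<forall>x\<in>{0..L}. Kvw x x = c x / (a + b)"
    and bc: "\<forall>x\<in>{0..L}. a * Kvw x L = b * \<rho> * Kvv x L"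
  shows "AE t0 in lborel. 0 \<le> t0 \<longrightarrow>
    u 0 (t0 + L / b) - (LINT \<xi>:{0..L}|lborel. Kvw 0 \<xi> * w \<xi> (t0 + L / b) + Kvv 0 \<xi> * u \<xi> (t0 + L / b))
      = u L t0"
proof -
  have b0: "b \<noteq> 0" using pos by simp
  note D = driven_characteristics[OF u pos(1,2) c G]
  show ?thesis
    using AE_lborel_affine[OF b0 D, of L]
  proof (eventually_elim, intro impI)
    fix t0
    let ?y = "L + b * t0"
    assume D: "\<forall>s t. 0 \<le> s \<and> s \<le> t \<and> ?y - b * s \<in> {0..L} \<and> ?y - b * t \<in> {0..L} \<longrightarrow>
      u (?y - b * t) t - u (?y - b * s) s
        = (LINT \<sigma>:{s..t}|lborel. c (?y - b * \<sigma>) * G (\<sigma> - (?y - b * \<sigma> - 0) / a))"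
      and t0: "0 \<le> t0"
    have t: "0 \<le> t0 + L / b" using t0 pos by simp
    define V where "V = (\<lambda>s. G (t0 - L / a + s))"
    have V: "V \<in> borel_measurable borel" unfolding V_def using G(1) by measurable
    have y: "?y - b * (t0 + L / b) = 0" "?y - b * t0 = L"
      using pos by (simp_all add: distrib_left)
    have "u 0 (t0 + L / b) - u L t0
        = (LINT \<sigma>:{t0..t0 + L / b}|lborel. c (?y - b * \<sigma>) * G (\<sigma> - (?y - b * \<sigma> - 0) / a))"
      using D[rule_format, of t0 "t0 + L / b"] t0 pos unfolding y by simp
    also have "\<dots> = (LINT \<sigma>:{0..L / b}|lborel. c (L - b * \<sigma>) * V (\<sigma> + b * \<sigma> / a))"
    proof -
      have "t0 + 1 * \<sigma> \<in> {t0..t0 + L / b} \<longleftrightarrow> \<sigma> \<in> {0..L / b}" for \<sigma> by auto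
      note aff = set_integral_affine[OF one_neq_zero this,
          where f = "\<lambda>\<sigma>. c (?y - b * \<sigma>) * G (\<sigma> - (?y - b * \<sigma> - 0) / a)"]
      have 1: "?y - b * (t0 + 1 * \<sigma>) = L - b * \<sigma>" for \<sigma>
        by (simp add: distrib_left)
      have 2: "t0 + 1 * \<sigma> - (L - b * \<sigma> - 0) / a = t0 - L / a + (\<sigma> + b * \<sigma> / a)" for \<sigma>
        by (simp add: diff_divide_distrib)
      show ?thesis using aff unfolding 1 2 V_def by simp
    qed
    also have "\<dots> = (LINT \<xi>:{0..L}|lborel. Kvw 0 \<xi> * w \<xi> (t0 + L / b) + Kvv 0 \<xi> * u \<xi> (t0 + L / b))"
    proof (rule backstepping_trace[OF pos c bdd ker diag bc V, symmetric])
      show "set_integrable lborel {0..L / b + L / a} V"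
        using downstream_window(1)[OF t0] V unfolding V_def by (rule set_integrable_of_square[rotated])
      show "set_borel_measurable lborel {0..L} (\<lambda>\<xi>. w \<xi> (t0 + L / b))"
        "set_borel_measurable lborel {0..L} (\<lambda>\<xi>. u \<xi> (t0 + L / b))"
        using downstream_in_L2[OF t] by (auto simp: in_L2_def)
      show "AE \<xi> in lborel. \<xi> \<in> {0..L} \<longrightarrow> w \<xi> (t0 + L / b) = V (L / b + (L - \<xi>) / a)"
        using profile_slice(1)[OF pos(1) G(2) t]
        by eventually_elim (auto simp: V_def diff_divide_distrib algebra_simps)
      show "AE \<xi> in lborel. \<xi> \<in> {0..L} \<longrightarrow> u \<xi> (t0 + L / b) = \<rho> * V (\<xi> / b)
        + (LINT \<sigma>:{\<xi> / b..L / b}|lborel. c (L + \<xi> - b * \<sigma>) * V (\<sigma> + (b * \<sigma> - \<xi>) / a))"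
        using downstream_outflow[OF t0] unfolding V_def .
    qed
    finally show "u 0 (t0 + L / b) - (LINT \<xi>:{0..L}|lborel. Kvw 0 \<xi> * w \<xi> (t0 + L / b)
        + Kvv 0 \<xi> * u \<xi> (t0 + L / b)) = u L t0" by linarith
  qed
qed

end

text \<open>
  The substitution \<open>(x, t) \<mapsto> (-x, -t)\<close> turns the upstream road into a downstream one with source
  coefficient \<open>x \<mapsto> -c (-x)\<close>; the trace of the Riemann coordinate at time \<open>t\<close> is then expressed through
  the future boundary values at \<open>x = -L\<close> up to time \<open>t + L / b\<close>.
\<close>

context
  fixes a b L \<rho> :: real and c G :: "real \<Rightarrow> real" and w u :: "real \<Rightarrow> real \<Rightarrow> real"
  assumes pos: "0 < a" "0 < b" "0 < L"
    and c: "continuous_on UNIV c"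
    and w: "mild_transport {- L..0} a (\<lambda>x t. 0) w"
    and u: "mild_transport {- L..0} (- b) (\<lambda>x t. c x * w x t) u"
    and G: "G \<in> borel_measurable borel"
      "AE s in lborel. \<forall>x t. x \<in> {- L..0} \<and> 0 \<le> t \<and> s = t - (x - (- L)) / a \<longrightarrow> w x t = G s"
    and outflow: "AE t in lborel. 0 \<le> t \<longrightarrow> u (- L) t = \<rho> * w (- L) t"
begin

text \<open>The characteristic through (-\<xi>, t) is followed forward to its exit at x = -L, at
  time t + L / b - \<xi> / b, where \<open>outflow\<close> ties \<open>u\<close> to
  \<open>w\<close>. Since the exit lies in the future, the formula holds from t = 0 on.\<close>

lemma upstream_outflow:
  assumes "0 \<le> t"
  shows "AE \<xi> in lborel. \<xi> \<in> {0..L} \<longrightarrow> u (- \<xi>) t = \<rho> * G (t + L / b - \<xi> / b)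
    + (LINT \<sigma>:{\<xi> / b..L / b}|lborel.
        - c (- (L + \<xi> - b * \<sigma>)) * G (t + L / b - (\<sigma> + (b * \<sigma> - \<xi>) / a)))"
proof -
  have b1: "- 1 / b \<noteq> 0" using pos by simp
  have m1: "(- 1 :: real) \<noteq> 0" by simp
  have "- L \<in> {- L..0}" using pos by simp
  note w_L = profile_slice(2)[OF pos(1) G(2) this]
  note D = driven_characteristics[OF u pos(1,2) c G]
  show ?thesis
    using AE_lborel_affine[OF m1 D, of "b * t"]
      AE_lborel_affine[OF b1 w_L, of "t + L / b"] AE_lborel_affine[OF b1 outflow, of "t + L / b"]
  proof (eventually_elim, intro impI)
    fix \<xi>
    let ?y = "b * t + - 1 * \<xi>" and ?t = "t + L / b + - 1 / b * \<xi>"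
    assume D: "\<forall>s t. 0 \<le> s \<and> s \<le> t \<and> ?y - b * s \<in> {- L..0} \<and> ?y - b * t \<in> {- L..0} \<longrightarrow>
      u (?y - b * t) t - u (?y - b * s) s
        = (LINT \<sigma>:{s..t}|lborel. c (?y - b * \<sigma>) * G (\<sigma> - (?y - b * \<sigma> - (- L)) / a))"
      and 1: "0 \<le> ?t \<longrightarrow> w (- L) ?t = G (?t - (- L - (- L)) / a)"
        "0 \<le> ?t \<longrightarrow> u (- L) ?t = \<rho> * w (- L) ?t"
      and \<xi>: "\<xi> \<in> {0..L}"
    have t_eq: "?t = t + L / b - \<xi> / b" by simp
    have s0: "0 \<le> \<xi> / b" "\<xi> / b \<le> L / b" using \<xi> pos by (auto simp: divide_right_mono)
    have y: "?y - b * t = - \<xi>" "?y - b * (t + L / b - \<xi> / b) = - L"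
      using pos by (simp_all add: distrib_left right_diff_distrib)
    have "u (- L) (t + L / b - \<xi> / b) - u (- \<xi>) t
        = (LINT \<sigma>:{t..t + L / b - \<xi> / b}|lborel. c (?y - b * \<sigma>) * G (\<sigma> - (?y - b * \<sigma> - (- L)) / a))"
      using D[rule_format, of t "t + L / b - \<xi> / b"] s0 assms \<xi> pos unfolding y by simp
    also have "\<dots> = (LINT \<sigma>:{\<xi> / b..L / b}|lborel.
        c (- (L + \<xi> - b * \<sigma>)) * G (t + L / b - (\<sigma> + (b * \<sigma> - \<xi>) / a)))"
    proof -
      have "(t + L / b) + - 1 * \<sigma> \<in> {t..t + L / b - \<xi> / b} \<longleftrightarrow> \<sigma> \<in> {\<xi> / b..L / b}" for \<sigma> by auto
      note aff = set_integral_affine[OF m1 this,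
          where f = "\<lambda>\<sigma>. c (?y - b * \<sigma>) * G (\<sigma> - (?y - b * \<sigma> - (- L)) / a)"]
      have 1: "?y - b * (t + L / b + - 1 * \<sigma>) = - (L + \<xi> - b * \<sigma>)" for \<sigma>
        using pos by (simp add: distrib_left right_diff_distrib)
      have 2: "t + L / b + - 1 * \<sigma> - (- (L + \<xi> - b * \<sigma>) - (- L)) / a
          = t + L / b - (\<sigma> + (b * \<sigma> - \<xi>) / a)" for \<sigma>
        by (simp add: diff_divide_distrib add_divide_distrib)
      show ?thesis using aff unfolding 1 2 by simp
    qed
    finally have "u (- \<xi>) t = u (- L) (t + L / b - \<xi> / b) - (LINT \<sigma>:{\<xi> / b..L / b}|lborel.
        c (- (L + \<xi> - b * \<sigma>)) * G (t + L / b - (\<sigma> + (b * \<sigma> - \<xi>) / a)))"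
      by linarith
    then show "u (- \<xi>) t = \<rho> * G (t + L / b - \<xi> / b)
      + (LINT \<sigma>:{\<xi> / b..L / b}|lborel.
          - c (- (L + \<xi> - b * \<sigma>)) * G (t + L / b - (\<sigma> + (b * \<sigma> - \<xi>) / a)))"
      using 1 s0 assms unfolding t_eq by (simp add: set_lebesgue_integral_def)
  qed
qed

lemma upstream_in_L2:
  assumes "0 \<le> t"
  shows "in_L2 {- L..0} (\<lambda>x. w x t)" "in_L2 {- L..0} (\<lambda>x. u x t)"
  using w u assms unfolding mild_transport_def continuous_in_L2_def by blast+

lemma upstream_window:
  assumes "0 \<le> t"
  shows "set_integrable lborel {0..L / b + L / a} (\<lambda>s. (G (t + L / b - s))\<^sup>2)"
    and "(LINT s:{0..L / b + L / a}|lborel. (G (t + L / b - s))\<^sup>2)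
      = (LINT s:{t - L / a..t + L / b}|lborel. (G s)\<^sup>2)"
proof -
  have m1: "(- 1 :: real) \<noteq> 0" by simp
  have dom: "(t + L / b) + - 1 * s \<in> {t - L / a..t + L / b} \<longleftrightarrow> s \<in> {0..L / b + L / a}" for s
    by auto
  have lh: "- L < 0" using pos by simp
  have "set_integrable lborel {t - L / a..t + L / b} (\<lambda>s. (G s)\<^sup>2)"
    using assms by (intro set_integrable_profile_window[OF profile_L2(3)[OF w pos(1) lh G]]) simp
  then show "set_integrable lborel {0..L / b + L / a} (\<lambda>s. (G (t + L / b - s))\<^sup>2)"
    using set_integrable_affine[OF m1 dom, where f = "\<lambda>s. (G s)\<^sup>2"] by simp
  show "(LINT s:{0..L / b + L / a}|lborel. (G (t + L / b - s))\<^sup>2)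
      = (LINT s:{t - L / a..t + L / b}|lborel. (G s)\<^sup>2)"
    using set_integral_affine[OF m1 dom, where f = "\<lambda>s. (G s)\<^sup>2"] by simp
qed

lemma upstream_reflect:
  fixes f :: "real \<Rightarrow> real"
  shows "(LINT x:{- L..0}|lborel. f x) = (LINT x:{0..L}|lborel. f (- x))"
    and "set_integrable lborel {- L..0} f \<longleftrightarrow> set_integrable lborel {0..L} (\<lambda>x. f (- x))"
    and "set_borel_measurable lborel {- L..0} f \<Longrightarrow> set_borel_measurable lborel {0..L} (\<lambda>x. f (- x))"
proof -
  have m1: "(- 1 :: real) \<noteq> 0" by simp
  have dom: "0 + - 1 * x \<in> {- L..0} \<longleftrightarrow> x \<in> {0..L}" for x by auto
  show "(LINT x:{- L..0}|lborel. f x) = (LINT x:{0..L}|lborel. f (- x))"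
    using set_integral_affine[OF m1 dom, where f = f] by simp
  show "set_integrable lborel {- L..0} f \<longleftrightarrow> set_integrable lborel {0..L} (\<lambda>x. f (- x))"
    using set_integrable_affine[OF m1 dom, where f = f] by simp
  assume "set_borel_measurable lborel {- L..0} f"
  then have 1: "(\<lambda>x. indicator {- L..0} x *\<^sub>R f x) \<in> borel_measurable borel"
    unfolding set_borel_measurable_def by simp
  have 2: "uminus \<in> borel_measurable (borel :: real measure)" by measurable
  have "indicator {- L..0} (- x) = (indicator {0..L} x :: real)" for x
    by (auto simp: indicator_def)
  then show "set_borel_measurable lborel {0..L} (\<lambda>x. f (- x))"
    using measurable_compose[OF 2 1] unfolding set_borel_measurable_def by simp
qed

lemma upstream_energy:
  assumes "\<And>x. x \<in> {- L..0} \<Longrightarrow> \<bar>c x\<bar> \<le> Mc" "0 \<le> t"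
  shows "(L2_norm {- L..0} (\<lambda>x. u x t))\<^sup>2
    \<le> (2 * \<rho>\<^sup>2 * b + 2 * Mc\<^sup>2 * (L / b + L / a) * L) * (LINT s:{t - L / a..t + L / b}|lborel. (G s)\<^sup>2)"
proof -
  have V: "(\<lambda>s. G (t + L / b - s)) \<in> borel_measurable borel" using G(1) by measurable
  have Mc: "\<bar>- c (- x)\<bar> \<le> Mc" if "x \<in> {0..L}" for x using assms(1)[of "- x"] that by simp
  have "set_integrable lborel {0..L} (\<lambda>x. (u (- x) t)\<^sup>2)"
    using upstream_in_L2(2)[OF assms(2)] unfolding in_L2_def upstream_reflect(2) by simp
  from outflow_energy[where c = "\<lambda>x. - c (- x)", OF pos Mc V upstream_window(1)[OF assms(2)] this
      upstream_outflow[OF assms(2)]]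
  show ?thesis
    unfolding L2_norm_square[OF upstream_in_L2(2)[OF assms(2)]] upstream_window(2)[OF assms(2)]
      upstream_reflect(1) .
qed

text \<open>From the junction to the exit \<open>u\<close> gains the source, and the kernel integral
  is its negative: the minus sign is that of the reflected source coefficient -c(-x) in
  \<open>backstepping_trace\<close>.\<close>

lemma upstream_trace:
  assumes bdd: "bounded_measurable_on (kernel_domain L 2) Kvw" "bounded_measurable_on (kernel_domain L 2) Kvv"
    and ker: "kernel_equations (kernel_domain L 2) b a c Kvw Kvv"
    and diag: "\<forall>x\<in>{- L..0}. Kvw x x = - c x / (a + b)"
    and bc: "\<forall>x\<in>{- L..0}. a * Kvw x (- L) = b * \<rho> * Kvv x (- L)"
  shows "AE t in lborel. 0 \<le> t \<longrightarrow>
    u 0 t - (LINT \<xi>:{- L..0}|lborel. Kvw 0 \<xi> * w \<xi> t + Kvv 0 \<xi> * u \<xi> t) = u (- L) (t + L / b)"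
proof -
  have b0: "b \<noteq> 0" using pos by simp
  have m1: "(- 1 :: real) \<noteq> 0" by simp
  note D = driven_characteristics[OF u pos(1,2) c G]
  have c': "continuous_on UNIV (\<lambda>x. - c (- x))"
    by (intro continuous_intros continuous_on_compose2[OF c]) auto
  have diag': "\<forall>x\<in>{0..L}. Kvw (- x) (- x) = - c (- x) / (a + b)" using diag by auto
  have bc': "\<forall>x\<in>{0..L}. a * Kvw (- x) (- L) = b * \<rho> * Kvv (- x) (- L)" using bc by auto
  show ?thesis
    using AE_lborel_affine[OF b0 D, of 0]
  proof (eventually_elim, intro impI)
    fix t0
    let ?y = "0 + b * t0"
    assume D: "\<forall>s t. 0 \<le> s \<and> s \<le> t \<and> ?y - b * s \<in> {- L..0} \<and> ?y - b * t \<in> {- L..0} \<longrightarrow>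
      u (?y - b * t) t - u (?y - b * s) s
        = (LINT \<sigma>:{s..t}|lborel. c (?y - b * \<sigma>) * G (\<sigma> - (?y - b * \<sigma> - (- L)) / a))"
      and t0: "0 \<le> t0"
    define V where "V = (\<lambda>s. G (t0 + L / b - s))"
    have V: "V \<in> borel_measurable borel" unfolding V_def using G(1) by measurable
    have y: "?y - b * (t0 + L / b) = - L" "?y - b * t0 = 0"
      using pos by (simp_all add: distrib_left)
    have "u (- L) (t0 + L / b) - u 0 t0
        = (LINT \<sigma>:{t0..t0 + L / b}|lborel. c (?y - b * \<sigma>) * G (\<sigma> - (?y - b * \<sigma> - (- L)) / a))"
      using D[rule_format, of t0 "t0 + L / b"] t0 pos unfolding y by simp
    also have "\<dots> = (LINT \<sigma>:{0..L / b}|lborel. c (- (L - b * \<sigma>)) * V (\<sigma> + b * \<sigma> / a))"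
    proof -
      have "(t0 + L / b) + - 1 * \<sigma> \<in> {t0..t0 + L / b} \<longleftrightarrow> \<sigma> \<in> {0..L / b}" for \<sigma> by auto
      note aff = set_integral_affine[OF m1 this,
          where f = "\<lambda>\<sigma>. c (?y - b * \<sigma>) * G (\<sigma> - (?y - b * \<sigma> - (- L)) / a)"]
      have 1: "?y - b * (t0 + L / b + - 1 * \<sigma>) = - (L - b * \<sigma>)" for \<sigma>
        using pos by (simp add: distrib_left right_diff_distrib)
      have 2: "t0 + L / b + - 1 * \<sigma> - (- (L - b * \<sigma>) - (- L)) / a = t0 + L / b - (\<sigma> + b * \<sigma> / a)" for \<sigma>
        by simp
      show ?thesis using aff unfolding 1 2 V_def by simp
    qed
    also have "\<dots> = - (LINT \<sigma>:{0..L / b}|lborel. - c (- (L - b * \<sigma>)) * V (\<sigma> + b * \<sigma> / a))"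
      by (simp add: set_lebesgue_integral_def)
    also have "(LINT \<sigma>:{0..L / b}|lborel. - c (- (L - b * \<sigma>)) * V (\<sigma> + b * \<sigma> / a))
        = (LINT \<xi>:{0..L}|lborel. Kvw (- 0) (- \<xi>) * w (- \<xi>) t0 + Kvv (- 0) (- \<xi>) * u (- \<xi>) t0)"
    proof (rule backstepping_trace[OF pos c' bdd[THEN bounded_measurable_reflect]
          kernel_equations_reflect[OF ker] diag' bc' V, symmetric])
      show "set_integrable lborel {0..L / b + L / a} V"
        using upstream_window(1)[OF t0] V unfolding V_def by (rule set_integrable_of_square[rotated])
      show "set_borel_measurable lborel {0..L} (\<lambda>\<xi>. w (- \<xi>) t0)"
        "set_borel_measurable lborel {0..L} (\<lambda>\<xi>. u (- \<xi>) t0)"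
        using upstream_in_L2[OF t0] by (auto simp: in_L2_def intro: upstream_reflect(3))
      show "AE \<xi> in lborel. \<xi> \<in> {0..L} \<longrightarrow> w (- \<xi>) t0 = V (L / b + (L - \<xi>) / a)"
        using AE_lborel_affine[OF m1 profile_slice(1)[OF pos(1) G(2) t0], of 0]
        by eventually_elim (auto simp: V_def)
      show "AE \<xi> in lborel. \<xi> \<in> {0..L} \<longrightarrow> u (- \<xi>) t0 = \<rho> * V (\<xi> / b)
        + (LINT \<sigma>:{\<xi> / b..L / b}|lborel. - c (- (L + \<xi> - b * \<sigma>)) * V (\<sigma> + (b * \<sigma> - \<xi>) / a))"
        using upstream_outflow[OF t0] unfolding V_def .
    qed
    also have "\<dots> = (LINT \<xi>:{- L..0}|lborel. Kvw 0 \<xi> * w \<xi> t0 + Kvv 0 \<xi> * u \<xi> t0)"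
      unfolding upstream_reflect(1) by simp
    finally show "u 0 t0 - (LINT \<xi>:{- L..0}|lborel. Kvw 0 \<xi> * w \<xi> t0 + Kvv 0 \<xi> * u \<xi> t0)
        = u (- L) (t0 + L / b)" by linarith
  qed
qed

end

section \<open>Exponential decay\<close>

text \<open>On {p..q} the weight is at least exp (\<mu> * p). This is the step from a finite
  weighted energy to exponential decay of the energy in a moving window.\<close>

lemma weighted_window:
  fixes G :: "real \<Rightarrow> real"
  assumes E: "set_integrable lborel {t0..} (\<lambda>t. exp (\<mu> * t) * (G t)\<^sup>2)" and "0 \<le> \<mu>" "t0 \<le> p"
    and G: "set_integrable lborel {p..q} (\<lambda>t. (G t)\<^sup>2)"
  shows "(LINT t:{p..q}|lborel. (G t)\<^sup>2)
    \<le> exp (- \<mu> * p) * (LINT t:{t0..}|lborel. exp (\<mu> * t) * (G t)\<^sup>2)"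
proof -
  have i: "set_integrable lborel {p..q} (\<lambda>t. exp (\<mu> * t) * (G t)\<^sup>2)"
    using assms(3) by (intro set_integrable_subset[OF E]) auto
  have "(LINT t:{p..q}|lborel. (G t)\<^sup>2)
      \<le> (LINT t:{p..q}|lborel. exp (- \<mu> * p) * (exp (\<mu> * t) * (G t)\<^sup>2))"
  proof (rule set_integral_mono[OF G])
    show "set_integrable lborel {p..q} (\<lambda>t. exp (- \<mu> * p) * (exp (\<mu> * t) * (G t)\<^sup>2))"
      using i by simp
    fix t assume "t \<in> {p..q}"
    then have "0 \<le> \<mu> * (t - p)" using assms(2) by simp
    then have "1 \<le> exp (\<mu> * (t - p))" by simp
    also have "exp (\<mu> * (t - p)) = exp (- \<mu> * p) * exp (\<mu> * t)"
      by (simp add: exp_add[symmetric] algebra_simps)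
    finally have "1 * (G t)\<^sup>2 \<le> (exp (- \<mu> * p) * exp (\<mu> * t)) * (G t)\<^sup>2"
      by (intro mult_right_mono) auto
    then show "(G t)\<^sup>2 \<le> exp (- \<mu> * p) * (exp (\<mu> * t) * (G t)\<^sup>2)" by simp
  qed
  also have "\<dots> = exp (- \<mu> * p) * (LINT t:{p..q}|lborel. exp (\<mu> * t) * (G t)\<^sup>2)"
    by simp
  also have "\<dots> \<le> exp (- \<mu> * p) * (LINT t:{t0..}|lborel. exp (\<mu> * t) * (G t)\<^sup>2)"
    using E i assms(3) by (intro mult_left_mono set_integral_mono_set) auto
  finally show ?thesis .
qed

text \<open>Near each t0 the squared norm is at most 2 + 2 * (norm at t0)^2, by continuity;
  bisection makes the bound uniform on the compact interval.\<close>

lemma continuous_in_L2_bounded: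
  assumes "continuous_in_L2 X u" "0 \<le> T"
  shows "\<exists>B. \<forall>t\<in>{0..T}. (L2_norm X (\<lambda>x. u x t))\<^sup>2 \<le> B"
proof -
  have in_L2: "in_L2 X (\<lambda>x. u x t)" if "0 \<le> t" for t
    using assms(1) that unfolding continuous_in_L2_def by blast
  \<comment> \<open>The guard 0 \<le> t is there because the small intervals around t0 in
    \<open>Bolzano\<close> may reach negative times, where nothing is known about
    \<open>u\<close>.\<close>
  let ?P = "\<lambda>p q. \<exists>B. \<forall>t\<in>{p..q}. 0 \<le> t \<longrightarrow> (L2_norm X (\<lambda>x. u x t))\<^sup>2 \<le> B"
  have "?P 0 T"
    using assms(2)
  proof (rule Bolzano[where P = ?P])
    fix p q r :: real assume "?P p q" "?P q r"
    then obtain B1 B2 where "\<forall>t\<in>{p..q}. 0 \<le> t \<longrightarrow> (L2_norm X (\<lambda>x. u x t))\<^sup>2 \<le> B1"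
      "\<forall>t\<in>{q..r}. 0 \<le> t \<longrightarrow> (L2_norm X (\<lambda>x. u x t))\<^sup>2 \<le> B2" by blast
    then have "\<forall>t\<in>{p..r}. 0 \<le> t \<longrightarrow> (L2_norm X (\<lambda>x. u x t))\<^sup>2 \<le> max B1 B2"
      by (auto simp: le_max_iff_disj)
    then show "?P p r" by blast
  next
    fix t0 :: real assume "0 \<le> t0"
    then have "((\<lambda>t. L2_norm X (\<lambda>x. u x t - u x t0)) \<longlongrightarrow> 0) (at t0 within {0..})"
      using assms(1) unfolding continuous_in_L2_def by blast
    then have "\<forall>\<^sub>F t in at t0 within {0..}. dist (L2_norm X (\<lambda>x. u x t - u x t0)) 0 < 1"
      by (rule tendstoD) simp
    then obtain d where d: "0 < d" "\<And>t. 0 \<le> t \<Longrightarrow> t \<noteq> t0 \<Longrightarrow> dist t t0 < d \<Longrightarrow>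
        \<bar>L2_norm X (\<lambda>x. u x t - u x t0)\<bar> < 1"
      unfolding eventually_at by auto
    have "(L2_norm X (\<lambda>x. u x t))\<^sup>2 \<le> 2 + 2 * (L2_norm X (\<lambda>x. u x t0))\<^sup>2"
      if t: "0 \<le> t" "dist t t0 < d" for t
    proof (cases "t = t0")
      case False
      let ?D = "\<lambda>x. u x t - u x t0"
      note t_L2 = in_L2[OF t(1)] and t0_L2 = in_L2[OF \<open>0 \<le> t0\<close>]
      have sq: "integrable lborel (\<lambda>x. indicator X x *\<^sub>R (u x t)\<^sup>2)"
        "integrable lborel (\<lambda>x. indicator X x *\<^sub>R (u x t0)\<^sup>2)"
        using t_L2 t0_L2 unfolding in_L2_def set_integrable_def by blast+
      have m: "(\<lambda>x. indicator X x *\<^sub>R u x t) \<in> borel_measurable lborel"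
        "(\<lambda>x. indicator X x *\<^sub>R u x t0) \<in> borel_measurable lborel"
        using t_L2 t0_L2 unfolding in_L2_def set_borel_measurable_def by blast+
      have "(\<lambda>x. indicator X x *\<^sub>R u x t - indicator X x *\<^sub>R u x t0) \<in> borel_measurable lborel"
        using m by (rule borel_measurable_diff)
      then have D_m: "(\<lambda>x. indicator X x *\<^sub>R ?D x) \<in> borel_measurable lborel"
        by (simp add: right_diff_distrib)
      have "(\<lambda>x. (indicator X x *\<^sub>R ?D x)\<^sup>2) \<in> borel_measurable lborel"
        using D_m by (rule borel_measurable_power)
      moreover have "(indicator X x *\<^sub>R ?D x)\<^sup>2 = indicator X x *\<^sub>R (?D x)\<^sup>2" for x
        by (simp add: indicator_def)
      ultimately have D_m2: "(\<lambda>x. indicator X x *\<^sub>R (?D x)\<^sup>2) \<in> borel_measurable lborel"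
        by simp
      \<comment> \<open>Without square integrability of the difference, \<open>L2_norm\<close> would
        take the default value 0 and its smallness would carry no information.\<close>
      have D: "integrable lborel (\<lambda>x. indicator X x *\<^sub>R (?D x)\<^sup>2)"
      proof (rule Bochner_Integration.integrable_bound[OF _ D_m2])
        show "integrable lborel (\<lambda>x. 2 * (indicator X x *\<^sub>R (u x t)\<^sup>2) + 2 * (indicator X x *\<^sub>R (u x t0)\<^sup>2))"
          using sq by (intro Bochner_Integration.integrable_add integrable_mult_right)
        have "(p - q)\<^sup>2 \<le> 2 * p\<^sup>2 + 2 * q\<^sup>2" for p q :: real
          using zero_le_power2[of "p + q"] by (simp add: power2_sum power2_diff)
        then show "AE x in lborel. norm (indicator X x *\<^sub>R (?D x)\<^sup>2)
            \<le> norm (2 * (indicator X x *\<^sub>R (u x t)\<^sup>2) + 2 * (indicator X x *\<^sub>R (u x t0)\<^sup>2))"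
          by (intro AE_I2) (simp add: indicator_def)
      qed
      have "in_L2 X ?D"
        using D D_m unfolding in_L2_def set_borel_measurable_def set_integrable_def by blast
      then have "(LINT x:X|lborel. (?D x)\<^sup>2) = (L2_norm X ?D)\<^sup>2"
        by (rule L2_norm_square[symmetric])
      also have "\<dots> \<le> 1"
        using d(2)[OF t(1) False t(2)] by (simp add: abs_square_le_1)
      finally have D1: "(LINT x:X|lborel. (?D x)\<^sup>2) \<le> 1" .
      have "(L2_norm X (\<lambda>x. u x t))\<^sup>2 = (\<integral>x. indicator X x *\<^sub>R (u x t)\<^sup>2 \<partial>lborel)"
        unfolding L2_norm_square[OF t_L2] set_lebesgue_integral_def ..
      also have "\<dots> \<le> (\<integral>x. 2 * (indicator X x *\<^sub>R (?D x)\<^sup>2) + 2 * (indicator X x *\<^sub>R (u x t0)\<^sup>2) \<partial>lborel)"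
      proof (rule integral_mono)
        show "integrable lborel (\<lambda>x. 2 * (indicator X x *\<^sub>R (?D x)\<^sup>2) + 2 * (indicator X x *\<^sub>R (u x t0)\<^sup>2))"
          using D sq by (intro Bochner_Integration.integrable_add integrable_mult_right)
        have "p\<^sup>2 \<le> 2 * (p - q)\<^sup>2 + 2 * q\<^sup>2" for p q :: real
          using zero_le_power2[of "p - 2 * q"] by (simp add: power2_diff power_mult_distrib)
        then show "indicator X x *\<^sub>R (u x t)\<^sup>2
            \<le> 2 * (indicator X x *\<^sub>R (?D x)\<^sup>2) + 2 * (indicator X x *\<^sub>R (u x t0)\<^sup>2)" for x
          by (simp add: indicator_def)
      qed (rule sq)
      also have "\<dots> = 2 * (LINT x:X|lborel. (?D x)\<^sup>2) + 2 * (L2_norm X (\<lambda>x. u x t0))\<^sup>2"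
        unfolding L2_norm_square[OF t0_L2] set_lebesgue_integral_def using D sq by simp
      finally show ?thesis using D1 by linarith
    qed simp
    then have "?P p q" if "p \<le> t0 \<and> t0 \<le> q \<and> q - p < d" for p q
      using that by (intro exI[of _ "2 + 2 * (L2_norm X (\<lambda>x. u x t0))\<^sup>2"]) (auto simp: dist_real_def)
    then show "\<exists>d>0. \<forall>p q. p \<le> t0 \<and> t0 \<le> q \<and> q - p < d \<longrightarrow> ?P p q"
      using d(1) by blast
  qed
  then show ?thesis by auto
qed

text \<open>\<open>eq1\<close> is the continuity of \<open>w\<close> at the junction.
  \<open>eq2\<close> is the junction condition for the transformed \<open>u\<close>, whose traces
  were moved by the transit times \<open>T1\<close> and \<open>T2\<close> to the far ends of the
  roads.\<close>

lemma interconnected_profiles_decay: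
  fixes G1 G2 :: "real \<Rightarrow> real"
  assumes pos: "0 < a1" "0 < a2" "0 < T1" "0 < T2" "0 < (L :: real)"
    and meas: "G1 \<in> borel_measurable borel" "G2 \<in> borel_measurable borel"
    and L2: "\<And>N. set_integrable lborel {- (L / a1)..N} (\<lambda>s. (G1 s)\<^sup>2)"
      "\<And>N. set_integrable lborel {- (L / a2)..N} (\<lambda>s. (G2 s)\<^sup>2)"
    and eq1: "AE t in lborel. 0 \<le> t \<longrightarrow> G1 t = G2 (t - L / a2)"
    and eq2: "AE t in lborel. T1 \<le> t \<longrightarrow>
      \<rho>2 * G2 (t + T2) = h * (\<rho>1 * G1 (t - T1 - L / a1)) + k * G2 (t - L / a2)"
    and gain: "\<rho>2 \<noteq> 0" "\<bar>h * \<rho>1 / \<rho>2\<bar> + \<bar>k / \<rho>2\<bar> < 1"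
  shows "\<exists>\<mu>>0. set_integrable lborel {- (L / a1)..} (\<lambda>t. exp (\<mu> * t) * (G1 t)\<^sup>2)
    \<and> set_integrable lborel {- (L / a2)..} (\<lambda>t. exp (\<mu> * t) * (G2 t)\<^sup>2)"
proof -
  have p: "0 < L / a1" "0 < L / a2" using pos by auto
  \<comment> \<open>\<open>G1\<close> is eliminated by using \<open>eq2\<close> at t - T2 and
    \<open>eq1\<close> at the argument of \<open>G1\<close> that results. The threshold T1 + T2 + L
    / a1 is the start -(L / a2) of the data plus the longer delay, as
    \<open>delay_equation_bound\<close> demands.\<close>
  have "AE t in lborel. T1 + T2 + L / a1 \<le> t \<longrightarrow>
    G2 t = h * \<rho>1 / \<rho>2 * G2 (t - (T1 + T2 + L / a1 + L / a2)) + k / \<rho>2 * G2 (t - (T2 + L / a2))"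
    using AE_lborel_affine[OF one_neq_zero eq2, of "- T2"]
      AE_lborel_affine[OF one_neq_zero eq1, of "- (T1 + T2 + L / a1)"]
  proof (eventually_elim, intro impI)
    fix t
    assume 1: "T1 \<le> - T2 + 1 * t \<longrightarrow> \<rho>2 * G2 (- T2 + 1 * t + T2)
        = h * (\<rho>1 * G1 (- T2 + 1 * t - T1 - L / a1)) + k * G2 (- T2 + 1 * t - L / a2)"
      and 2: "0 \<le> - (T1 + T2 + L / a1) + 1 * t \<longrightarrow>
        G1 (- (T1 + T2 + L / a1) + 1 * t) = G2 (- (T1 + T2 + L / a1) + 1 * t - L / a2)"
      and t: "T1 + T2 + L / a1 \<le> t"
    have e: "- T2 + 1 * t + T2 = t" "- T2 + 1 * t - T1 - L / a1 = t - (T1 + T2 + L / a1)"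
      "- (T1 + T2 + L / a1) + 1 * t = t - (T1 + T2 + L / a1)"
      "- T2 + 1 * t - L / a2 = t - (T2 + L / a2)" by auto
    have "\<rho>2 * G2 t = h * (\<rho>1 * G1 (t - (T1 + T2 + L / a1))) + k * G2 (t - (T2 + L / a2))"
      using 1 t p unfolding e by auto
    moreover have "G1 (t - (T1 + T2 + L / a1)) = G2 (t - (T1 + T2 + L / a1 + L / a2))"
      using 2 t unfolding e by (simp add: diff_diff_eq)
    ultimately have "\<rho>2 * G2 t
        = h * (\<rho>1 * G2 (t - (T1 + T2 + L / a1 + L / a2))) + k * G2 (t - (T2 + L / a2))" by simp
    then have "G2 t = (h * (\<rho>1 * G2 (t - (T1 + T2 + L / a1 + L / a2))) + k * G2 (t - (T2 + L / a2))) / \<rho>2"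
      using gain(1) by (simp add: eq_divide_eq mult.commute)
    then show "G2 t = h * \<rho>1 / \<rho>2 * G2 (t - (T1 + T2 + L / a1 + L / a2)) + k / \<rho>2 * G2 (t - (T2 + L / a2))"
      by (simp add: add_divide_distrib mult.assoc)
  qed
  from delay_equation_bound[OF L2(2) meas(2) _ _ _ this gain(2)] pos p
  obtain \<mu> C where \<mu>: "0 < \<mu>"
    and C: "\<And>T. (LINT t:{- (L / a2)..T}|lborel. exp (\<mu> * t) * (G2 t)\<^sup>2) \<le> C"
    by (auto simp: add_increasing)
  have loc: "set_integrable lborel {s..T} (\<lambda>t. exp (\<mu> * t) * (G t)\<^sup>2)"
    if "set_integrable lborel {s..T} (\<lambda>t. (G t)\<^sup>2)" for G and s T :: real
  proof (rule set_integrable_mult_bounded[OF that])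
    show "(\<lambda>t. exp (\<mu> * t)) \<in> borel_measurable borel" by measurable
    show "\<bar>exp (\<mu> * t)\<bar> \<le> exp (\<mu> * T)" if "t \<in> {s..T}" for t using that \<mu> by simp
  qed
  have E2: "set_integrable lborel {- (L / a2)..} (\<lambda>t. exp (\<mu> * t) * (G2 t)\<^sup>2)"
    using loc[OF L2(2)] C by (intro set_integrable_atLeast_bounded[of _ _ C]) auto
  \<comment> \<open>From time 0 on, \<open>G1\<close> is \<open>G2\<close> delayed by L / a2, which
    costs the factor exp (\<mu> * (L / a2)); negative times carry initial data over a bounded
    interval.\<close>
  have "set_integrable lborel {0..} (\<lambda>t. exp (\<mu> * t) * (G1 t)\<^sup>2)"
  proof -
    have dom: "- (L / a2) + 1 * t \<in> {- (L / a2)..} \<longleftrightarrow> t \<in> {0..}" for t by auto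
    have "set_integrable lborel {0..} (\<lambda>t. exp (\<mu> * (- (L / a2) + 1 * t)) * (G2 (- (L / a2) + 1 * t))\<^sup>2)"
      using E2 set_integrable_affine[OF one_neq_zero dom, where f = "\<lambda>t. exp (\<mu> * t) * (G2 t)\<^sup>2"] by blast
    then have "set_integrable lborel {0..}
        (\<lambda>t. exp (\<mu> * (L / a2)) * (exp (\<mu> * (- (L / a2) + 1 * t)) * (G2 (- (L / a2) + 1 * t))\<^sup>2))"
      by (rule set_integrable_mult_right)
    moreover have e: "exp (\<mu> * (L / a2)) * (exp (\<mu> * (- (L / a2) + 1 * t)) * (G2 (- (L / a2) + 1 * t))\<^sup>2)
        = exp (\<mu> * t) * (G2 (t - L / a2))\<^sup>2" for t
    proof -
      have "exp (\<mu> * (L / a2)) * exp (\<mu> * (- (L / a2) + 1 * t)) = exp (\<mu> * t)"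
        unfolding exp_add[symmetric] by (simp add: algebra_simps)
      then show ?thesis by (simp flip: mult.assoc)
    qed
    ultimately have "set_integrable lborel {0..} (\<lambda>t. exp (\<mu> * t) * (G2 (t - L / a2))\<^sup>2)"
      by (simp only: e)
    moreover have "set_integrable lborel {0..} (\<lambda>t. exp (\<mu> * t) * (G1 t)\<^sup>2)
        \<longleftrightarrow> set_integrable lborel {0..} (\<lambda>t. exp (\<mu> * t) * (G2 (t - L / a2))\<^sup>2)"
    proof (rule set_integrable_cong_AE)
      show "AE t\<in>{0..} in lborel. exp (\<mu> * t) * (G1 t)\<^sup>2 = exp (\<mu> * t) * (G2 (t - L / a2))\<^sup>2"
        using eq1 by eventually_elim auto
    qed (use meas in measurable)
    ultimately show ?thesis by simp
  qed
  then have "set_integrable lborel ({- (L / a1)..0} \<union> {0..}) (\<lambda>t. exp (\<mu> * t) * (G1 t)\<^sup>2)"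
    using loc[OF L2(1)] by (intro set_integrable_Un) auto
  moreover have "{- (L / a1)..0} \<union> {0..} = {- (L / a1)..}" using p by auto
  ultimately show ?thesis using \<mu> E2 by auto
qed

section \<open>The closed loop\<close>

text \<open>In terms of y, the \<open>\<gamma>\<close>-th power of \<rho> / \<rho>m, the two
  quantities are vm * (1 - y) and vm * ((1 + \<gamma>) * y - 1). Below maximal density y < 1, and
  congestion means y > 1 / (1 + \<gamma>).\<close>

lemma congested_speeds:
  fixes vm \<gamma> \<rho>m \<rho> v p :: real
  assumes pos: "0 < vm" "0 < \<gamma>" "0 < \<rho>m" "0 < \<rho>" "\<rho> < \<rho>m"
    and v: "v = steady_velocity vm \<gamma> \<rho>m \<rho>" and p: "p = steady_pressure vm \<gamma> \<rho>m \<rho>"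
    and congested: "\<rho>m / (1 + \<gamma>) powr (1 / \<gamma>) < \<rho>"
  shows "0 < v" "0 < \<gamma> * p - v"
proof -
  define y where "y = (\<rho> / \<rho>m) powr \<gamma>"
  have "y < 1 powr \<gamma>"
    unfolding y_def using pos by (intro powr_less_mono2) auto
  then show "0 < v" using pos by (simp add: v steady_velocity_def y_def)
  have P: "0 < (1 + \<gamma>) powr (1 / \<gamma>)" using pos by simp
  then have "1 / (1 + \<gamma>) powr (1 / \<gamma>) < \<rho> / \<rho>m"
    using congested pos by (simp add: field_simps)
  then have "(1 / (1 + \<gamma>) powr (1 / \<gamma>)) powr \<gamma> < y"
    unfolding y_def using pos P by (intro powr_less_mono2) auto
  also have "(1 / (1 + \<gamma>) powr (1 / \<gamma>)) powr \<gamma> = 1 / (1 + \<gamma>)"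
    using pos by (simp add: powr_divide powr_powr)
  finally have "1 < (1 + \<gamma>) * y" using pos by (simp add: field_simps)
  then have "0 < vm * ((1 + \<gamma>) * y - 1)" using pos by simp
  also have "\<dots> = \<gamma> * p - v"
    by (simp add: v p steady_velocity_def steady_pressure_def y_def algebra_simps)
  finally show "0 < \<gamma> * p - v" .
qed

lemma source_coeff_continuous: "continuous_on UNIV (source_coeff \<tau> v)"
proof -
  have "continuous_on UNIV (\<lambda>x. - (1 / \<tau>) * exp (- inverse (\<tau> * v) * x))"
    by (intro continuous_on_mult continuous_on_const continuous_on_exp continuous_on_id)
  then show ?thesis by (simp add: source_coeff_def divide_inverse mult.commute)
qed

lemma L2_norm_le_exp:
  assumes "(L2_norm X f)\<^sup>2 \<le> K * exp (- \<mu> * t)" "0 \<le> K"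
  shows "L2_norm X f \<le> sqrt K * exp (- (\<mu> / 2) * t)"
proof -
  have "(sqrt K * exp (- (\<mu> / 2) * t))\<^sup>2 = K * exp (- \<mu> * t)"
  proof -
    have "(exp (- (\<mu> / 2) * t))\<^sup>2 = exp (- \<mu> * t)"
      unfolding power2_eq_square exp_add[symmetric] by simp
    then show ?thesis using assms(2) by (simp add: power_mult_distrib)
  qed
  then have "(L2_norm X f)\<^sup>2 \<le> (sqrt K * exp (- (\<mu> / 2) * t))\<^sup>2"
    using assms(1) by (simp only:)
  then show ?thesis by (rule power2_le_imp_le) (use assms(2) in simp)
qed

theorem theorem1:
  fixes L vm q :: real
    and \<gamma> \<rho>m \<tau> \<rho> v p r :: "nat \<Rightarrow> real"
    and c :: "nat \<Rightarrow> real \<Rightarrow> real"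
    and Kvw Kvv :: "nat \<Rightarrow> real \<Rightarrow> real \<Rightarrow> real"
    and winit uinit :: "nat \<Rightarrow> real \<Rightarrow> real"
    and w u :: "nat \<Rightarrow> real \<Rightarrow> real \<Rightarrow> real"
  assumes "L > 0" and "vm > 0" and "q > 0"
    and "\<forall>i\<in>{1, 2}. \<gamma> i > 0 \<and> \<tau> i > 0 \<and> \<rho>m i > 0 \<and> 0 < \<rho> i \<and> \<rho> i < \<rho>m i"
    and "\<rho>m 2 > \<rho>m 1"
    and "\<forall>i\<in>{1, 2}. v i = steady_velocity vm (\<gamma> i) (\<rho>m i) (\<rho> i)"
    and "\<forall>i\<in>{1, 2}. p i = steady_pressure vm (\<gamma> i) (\<rho>m i) (\<rho> i)"
    and "\<forall>i\<in>{1, 2}. \<rho> i * v i = q"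
    and congested: "\<forall>i\<in>{1, 2}. \<rho> i > \<rho>m i / (1 + \<gamma> i) powr (1 / \<gamma> i)"
    and "\<forall>i\<in>{1, 2}. r i = refl_coeff (\<gamma> i) (v i) (p i)"
    and "\<forall>i\<in>{1, 2}. c i = source_coeff (\<tau> i) (v i)"
    and kernels: "is_kernel_solution L \<gamma> \<tau> v p c Kvw Kvv"
    and Sp1_less: "Sp1 (vector [
           vector [0, 0, 0, 1],
           vector [0, 0, r 2 / r 1, (r 1 - r 2) / (1 - r 1)],
           vector [r 1 * exp (- L / (\<tau> 1 * v 1)), 0, 0, 0],
           vector [0, 1 / r 2 * exp (- L / (\<tau> 2 * v 2)), 0, 0]] :: real ^ 4 ^ 4) < 1"
    and init: "\<forall>i\<in>{1, 2}. in_L2 (road L i) (winit i) \<and> in_L2 (road L i) (uinit i)"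
    and closed_loop: "is_mild_solution L q \<gamma> \<tau> v p r c
           (feedback_law L q v r Kvw Kvv w u) winit uinit w u"
  shows "\<exists>C \<nu>. C > 0 \<and> \<nu> > 0 \<and>
           (\<forall>t\<ge>0. L2_norm (road L 1) (\<lambda>x. w 1 x t) + L2_norm (road L 1) (\<lambda>x. u 1 x t)
                 + L2_norm (road L 2) (\<lambda>x. w 2 x t) + L2_norm (road L 2) (\<lambda>x. u 2 x t)
                 \<le> C * exp (- \<nu> * t))"
proof -
  note [simp del] = One_nat_def

  \<comment> \<open>Speeds, reflection factors and junction conditions\<close>
  define a1 a2 b1 b2 where "a1 = v 1" and "a2 = v 2"
    and "b1 = \<gamma> 1 * p 1 - v 1" and "b2 = \<gamma> 2 * p 2 - v 2"
  note ab_defs = a1_def a2_def b1_def b2_def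
  have speeds: "0 < v i \<and> 0 < \<gamma> i * p i - v i" if i: "i \<in> {1, 2}" for i
    using congested_speeds[OF assms(2) _ _ _ _ bspec[OF assms(6) i] bspec[OF assms(7) i]
        bspec[OF congested i]] bspec[OF assms(4) i] by blast
  have a: "0 < a1" "0 < a2" and b: "0 < b1" "0 < b2"
    using speeds[of 1] speeds[of 2] unfolding ab_defs by blast+
  have L: "0 < L" by fact
  have LT: "0 < L / b1" "0 < L / b2" using L b by auto
  have r: "r 1 = - a1 / b1" "r 2 = - a2 / b2"
    using assms(10) by (auto simp: refl_coeff_def ab_defs)
  have r_neg: "r 1 < 0" "r 2 < 0" using a b by (simp_all add: r divide_neg_pos)
  have road: "road L 1 = {0..L}" "road L 2 = {- L..0}" by (auto simp: road_def)
  \<comment> \<open>\<open>\<rho>2\<close> inverts the coefficient in the condition for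
    \<open>w 2\<close> at x = -L, which then has the same shape u = \<rho>2 * w as the condition at
    x = L.\<close>
  define \<rho>1 \<rho>2 where "\<rho>1 = r 1 * exp (- L / (\<tau> 1 * v 1))" and "\<rho>2 = r 2 * exp (L / (\<tau> 2 * v 2))"
  define h k where "h = r 2 / r 1" and "k = (r 1 - r 2) / (1 - r 1)"
  have \<rho>2: "\<rho>2 \<noteq> 0" using r_neg by (simp add: \<rho>2_def)
  have \<rho>2_inv: "1 / r 2 * exp (- L / (\<tau> 2 * v 2)) = 1 / \<rho>2"
    by (simp add: \<rho>2_def exp_minus divide_inverse)
  have gain: "\<bar>h * \<rho>1 / \<rho>2\<bar> + \<bar>k / \<rho>2\<bar> < 1"
    using Sp1_less unfolding \<rho>1_def[symmetric] \<rho>2_inv h_def[symmetric] k_def[symmetric]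
    by (rule Sp1_cycle_gain)

  have c: "continuous_on UNIV (c 1)" "continuous_on UNIV (c 2)"
    using assms(11) source_coeff_continuous by auto
  have sol: "mild_transport {0..L} a1 (\<lambda>x t. 0) (w 1)" "mild_transport {- L..0} a2 (\<lambda>x t. 0) (w 2)"
    "mild_transport {0..L} (- b1) (\<lambda>x t. c 1 x * w 1 x t) (u 1)"
    "mild_transport {- L..0} (- b2) (\<lambda>x t. c 2 x * w 2 x t) (u 2)"
    using closed_loop unfolding is_mild_solution_def ab_defs road[symmetric] by auto
  define I1 I2 where "I1 = (\<lambda>t. LINT \<xi>:{0..L}|lborel. Kvw 1 0 \<xi> * w 1 \<xi> t + Kvv 1 0 \<xi> * u 1 \<xi> t)"
    and "I2 = (\<lambda>t. LINT \<xi>:{- L..0}|lborel. Kvw 2 0 \<xi> * w 2 \<xi> t + Kvv 2 0 \<xi> * u 2 \<xi> t)"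
  have bc: "AE t in lborel. 0 \<le> t \<longrightarrow> u 1 L t = \<rho>1 * w 1 L t \<and> w 1 0 t = w 2 0 t
      \<and> u 2 (- L) t = \<rho>2 * w 2 (- L) t \<and> u 2 0 t = h * u 1 0 t + k * w 2 0 t + (I2 t - h * I1 t)"
  proof -
    have "AE t in lborel. 0 \<le> t \<longrightarrow>
        u 1 L t = r 1 * exp (- L / (\<tau> 1 * v 1)) * w 1 L t \<and>
        w 1 0 t = w 2 0 t \<and>
        w 2 (- L) t = exp (- L / (\<tau> 2 * v 2)) * (1 / r 2) * u 2 (- L) t \<and>
        u 2 0 t = r 2 / r 1 * u 1 0 t + (r 1 - r 2) / (1 - r 1) * w 2 0 t
          + v 2 * (1 - r 2) / q * feedback_law L q v r Kvw Kvv w u t"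
      using closed_loop unfolding is_mild_solution_def by blast
    then show ?thesis
    proof (eventually_elim, intro impI)
      fix t :: real
      assume "0 \<le> t" and *: "0 \<le> t \<longrightarrow>
        u 1 L t = r 1 * exp (- L / (\<tau> 1 * v 1)) * w 1 L t \<and>
        w 1 0 t = w 2 0 t \<and>
        w 2 (- L) t = exp (- L / (\<tau> 2 * v 2)) * (1 / r 2) * u 2 (- L) t \<and>
        u 2 0 t = r 2 / r 1 * u 1 0 t + (r 1 - r 2) / (1 - r 1) * w 2 0 t
          + v 2 * (1 - r 2) / q * feedback_law L q v r Kvw Kvv w u t"
      have "v 2 * (1 - r 2) \<noteq> 0" "q \<noteq> 0" using a r_neg assms(3) by (auto simp: ab_defs)
      \<comment> \<open>The prefactors of the control and of the feedback law are inverse to each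
        other.\<close>
      then have "v 2 * (1 - r 2) / q * feedback_law L q v r Kvw Kvv w u t = I2 t - h * I1 t"
        by (simp add: feedback_law_def road I1_def I2_def h_def)
      moreover have "w 2 (- L) t = 1 / \<rho>2 * u 2 (- L) t"
        using * \<open>0 \<le> t\<close> unfolding \<rho>2_inv[symmetric] by (simp add: mult.commute)
      then have "u 2 (- L) t = \<rho>2 * w 2 (- L) t" using \<rho>2 by simp
      ultimately show "u 1 L t = \<rho>1 * w 1 L t \<and> w 1 0 t = w 2 0 t
        \<and> u 2 (- L) t = \<rho>2 * w 2 (- L) t \<and> u 2 0 t = h * u 1 0 t + k * w 2 0 t + (I2 t - h * I1 t)"
        using * \<open>0 \<le> t\<close> by (simp add: \<rho>1_def h_def k_def)
    qed
  qed
  have inflow: "AE t in lborel. 0 \<le> t \<longrightarrow> u 1 L t = \<rho>1 * w 1 L t"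
    and outflow: "AE t in lborel. 0 \<le> t \<longrightarrow> u 2 (- L) t = \<rho>2 * w 2 (- L) t"
    using bc by (auto elim: eventually_mono)

  \<comment> \<open>Profiles of \<open>w\<close> and traces of \<open>u\<close> at the
    junction\<close>
  obtain G1 where G1: "G1 \<in> borel_measurable borel"
    "AE s in lborel. \<forall>x t. x \<in> {0..L} \<and> 0 \<le> t \<and> s = t - (x - 0) / a1 \<longrightarrow> w 1 x t = G1 s"
    using transport_profile[OF sol(1) a(1) L] by blast
  have L0: "- L < 0" using L by simp
  obtain G2 where G2: "G2 \<in> borel_measurable borel"
    "AE s in lborel. \<forall>x t. x \<in> {- L..0} \<and> 0 \<le> t \<and> s = t - (x - (- L)) / a2 \<longrightarrow> w 2 x t = G2 s"
    using transport_profile[OF sol(2) a(2) L0] by blast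

  have ker1: "bounded_measurable_on (kernel_domain L 1) (Kvw 1)"
    "bounded_measurable_on (kernel_domain L 1) (Kvv 1)"
    "kernel_equations (kernel_domain L 1) b1 a1 (c 1) (Kvw 1) (Kvv 1)"
    and ker2: "bounded_measurable_on (kernel_domain L 2) (Kvw 2)"
    "bounded_measurable_on (kernel_domain L 2) (Kvv 2)"
    "kernel_equations (kernel_domain L 2) b2 a2 (c 2) (Kvw 2) (Kvv 2)"
    using kernels unfolding is_kernel_solution_def ab_defs by auto
  have diag1: "\<forall>x\<in>{0..L}. Kvw 1 x x = c 1 x / (a1 + b1)"
    and diag2: "\<forall>x\<in>{- L..0}. Kvw 2 x x = - c 2 x / (a2 + b2)"
    using kernels unfolding is_kernel_solution_def ab_defs road by auto
  \<comment> \<open>Since r 1 = - a1 / b1, the exponential in \<open>\<rho>1\<close> cancels the one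
    in the kernel condition, which thereby matches the physical reflection at x = L.\<close>
  have bc1: "\<forall>x\<in>{0..L}. a1 * Kvw 1 x L = b1 * \<rho>1 * Kvv 1 x L"
  proof
    fix x assume "x \<in> {0..L}"
    then have "Kvv 1 x L = - exp (L / (\<tau> 1 * v 1)) * Kvw 1 x L"
      using kernels unfolding is_kernel_solution_def road by blast
    moreover have "b1 * \<rho>1 * (- exp (L / (\<tau> 1 * v 1)) * Kvw 1 x L)
        = a1 * (exp (- L / (\<tau> 1 * v 1)) * exp (L / (\<tau> 1 * v 1))) * Kvw 1 x L"
      using b by (simp add: \<rho>1_def r)
    ultimately show "a1 * Kvw 1 x L = b1 * \<rho>1 * Kvv 1 x L"
      by (simp add: exp_add[symmetric])
  qed
  have bc2: "\<forall>x\<in>{- L..0}. a2 * Kvw 2 x (- L) = b2 * \<rho>2 * Kvv 2 x (- L)"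
  proof
    fix x assume "x \<in> {- L..0}"
    then have "Kvv 2 x (- L) = - exp (- L / (\<tau> 2 * v 2)) * Kvw 2 x (- L)"
      using kernels unfolding is_kernel_solution_def road by blast
    moreover have "b2 * \<rho>2 * (- exp (- L / (\<tau> 2 * v 2)) * Kvw 2 x (- L))
        = a2 * (exp (L / (\<tau> 2 * v 2)) * exp (- L / (\<tau> 2 * v 2))) * Kvw 2 x (- L)"
      using b by (simp add: \<rho>2_def r)
    ultimately show "a2 * Kvw 2 x (- L) = b2 * \<rho>2 * Kvv 2 x (- L)"
      by (simp add: exp_add[symmetric])
  qed
  have tr1: "AE t in lborel. 0 \<le> t \<longrightarrow> u 1 0 (t + L / b1) - I1 (t + L / b1) = u 1 L t"
    unfolding I1_def
    by (rule downstream_trace[OF a(1) b(1) L c(1) sol(1,3) G1 inflow ker1 diag1 bc1])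
  have tr2: "AE t in lborel. 0 \<le> t \<longrightarrow> u 2 0 t - I2 t = u 2 (- L) (t + L / b2)"
    unfolding I2_def
    by (rule upstream_trace[OF a(2) b(2) L c(2) sol(2,4) G2 outflow ker2 diag2 bc2])

  \<comment> \<open>Delay relations between the two profiles\<close>
  have ends: "0 \<in> {0..L}" "L \<in> {0..L}" "0 \<in> {- L..0}" "- L \<in> {- L..0}" using L by auto
  note w1 = profile_slice(2)[OF a(1) G1(2)] and w2 = profile_slice(2)[OF a(2) G2(2)]
  have eq1: "AE t in lborel. 0 \<le> t \<longrightarrow> G1 t = G2 (t - L / a2)"
    using w1[OF ends(1)] w2[OF ends(3)] bc by eventually_elim auto
  have eq2: "AE t in lborel. L / b1 \<le> t \<longrightarrow>
      \<rho>2 * G2 (t + L / b2) = h * (\<rho>1 * G1 (t - L / b1 - L / a1)) + k * G2 (t - L / a2)"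
    using bc tr2 w2[OF ends(3)] AE_lborel_affine[OF one_neq_zero tr1, of "- (L / b1)"]
      AE_lborel_affine[OF one_neq_zero inflow, of "- (L / b1)"]
      AE_lborel_affine[OF one_neq_zero w1[OF ends(2)], of "- (L / b1)"]
      AE_lborel_affine[OF one_neq_zero outflow, of "L / b2"]
      AE_lborel_affine[OF one_neq_zero w2[OF ends(4)], of "L / b2"]
  proof eventually_elim
    case (elim t)
    show ?case
    proof
      assume t: "L / b1 \<le> t"
      have e: "- (L / b1) + 1 * t = t - L / b1" "L / b2 + 1 * t = t + L / b2" by auto
      have t': "0 \<le> t" "0 \<le> t - L / b1" "0 \<le> t + L / b2" using t LT by auto
      \<comment> \<open>Fact 1 holds the boundary conditions, 2 and 4 the traces of the incoming and
        the outgoing road, 3, 6 and 8 the profile values at x = 0, L and -L, 5 and 7 the reflections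
        at x = L and x = -L.\<close>
      note elim' = elim[unfolded e, THEN mp]
      have "\<rho>2 * G2 (t + L / b2) = u 2 (- L) (t + L / b2)"
        using elim'(7,8)[OF t'(3)] by simp
      also have "\<dots> = u 2 0 t - I2 t" using elim'(2)[OF t'(1)] by simp
      also have "\<dots> = h * (u 1 0 t - I1 t) + k * w 2 0 t"
        using elim'(1)[OF t'(1)] by (simp add: algebra_simps)
      also have "u 1 0 t - I1 t = \<rho>1 * G1 (t - L / b1 - L / a1)"
        using elim'(4,5,6)[OF t'(2)] by simp
      also have "w 2 0 t = G2 (t - L / a2)" using elim'(3)[OF t'(1)] by simp
      finally show "\<rho>2 * G2 (t + L / b2) = h * (\<rho>1 * G1 (t - L / b1 - L / a1)) + k * G2 (t - L / a2)" .
    qed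
  qed

  \<comment> \<open>Weighted energy and decay of the four norms\<close>
  have G1_L2: "set_integrable lborel {- (L / a1)..N} (\<lambda>s. (G1 s)\<^sup>2)" for N
    using profile_L2(3)[OF sol(1) a(1) L G1] by simp
  have G2_L2: "set_integrable lborel {- (L / a2)..N} (\<lambda>s. (G2 s)\<^sup>2)" for N
    using profile_L2(3)[OF sol(2) a(2) L0 G2] by simp
  obtain \<mu> where \<mu>: "0 < \<mu>"
    and E1: "set_integrable lborel {- (L / a1)..} (\<lambda>t. exp (\<mu> * t) * (G1 t)\<^sup>2)"
    and E2: "set_integrable lborel {- (L / a2)..} (\<lambda>t. exp (\<mu> * t) * (G2 t)\<^sup>2)"
    using interconnected_profiles_decay[OF a LT L G1(1) G2(1) G1_L2 G2_L2 eq1 eq2 \<rho>2 gain] by blast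

  define F1 F2 where "F1 = (LINT t:{- (L / a1)..}|lborel. exp (\<mu> * t) * (G1 t)\<^sup>2)"
    and "F2 = (LINT t:{- (L / a2)..}|lborel. exp (\<mu> * t) * (G2 t)\<^sup>2)"
  have F: "0 \<le> F1" "0 \<le> F2" unfolding F1_def F2_def by (auto intro!: set_integral_nonneg_real)
  \<comment> \<open>The window starts one transit time before t, which costs the factor exp (\<mu> *
    (L / a1)).\<close>
  have win1: "(LINT s:{t - L / a1..T}|lborel. (G1 s)\<^sup>2) \<le> exp (\<mu> * (L / a1)) * F1 * exp (- \<mu> * t)"
    if "0 \<le> t" for t T
  proof -
    have "- (L / a1) \<le> t - L / a1" using that by simp
    from weighted_window[OF E1 _ this set_integrable_profile_window[OF G1_L2 this], of T]
    have "(LINT s:{t - L / a1..T}|lborel. (G1 s)\<^sup>2) \<le> exp (- \<mu> * (t - L / a1)) * F1"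
      using \<mu> unfolding F1_def by simp
    also have "exp (- \<mu> * (t - L / a1)) = exp (\<mu> * (L / a1)) * exp (- \<mu> * t)"
      unfolding exp_add[symmetric] by (simp add: algebra_simps)
    finally show ?thesis by (simp add: mult_ac)
  qed
  have win2: "(LINT s:{t - L / a2..T}|lborel. (G2 s)\<^sup>2) \<le> exp (\<mu> * (L / a2)) * F2 * exp (- \<mu> * t)"
    if "0 \<le> t" for t T
  proof -
    have "- (L / a2) \<le> t - L / a2" using that by simp
    from weighted_window[OF E2 _ this set_integrable_profile_window[OF G2_L2 this], of T]
    have "(LINT s:{t - L / a2..T}|lborel. (G2 s)\<^sup>2) \<le> exp (- \<mu> * (t - L / a2)) * F2"
      using \<mu> unfolding F2_def by simp
    also have "exp (- \<mu> * (t - L / a2)) = exp (\<mu> * (L / a2)) * exp (- \<mu> * t)"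
      unfolding exp_add[symmetric] by (simp add: algebra_simps)
    finally show ?thesis by (simp add: mult_ac)
  qed

  define Q1 Q2 where "Q1 = exp (\<mu> * (L / a1)) * F1" and "Q2 = exp (\<mu> * (L / a2)) * F2"
  have Q: "0 \<le> Q1" "0 \<le> Q2" using F by (auto simp: Q1_def Q2_def)
  have w1_decay: "(L2_norm {0..L} (\<lambda>x. w 1 x t))\<^sup>2 \<le> a1 * Q1 * exp (- \<mu> * t)" if "0 \<le> t" for t
    using profile_L2(2)[OF sol(1) a(1) L G1 that] mult_left_mono[OF win1[OF that, of t], of a1] a
    by (simp add: Q1_def mult_ac)
  have w2_decay: "(L2_norm {- L..0} (\<lambda>x. w 2 x t))\<^sup>2 \<le> a2 * Q2 * exp (- \<mu> * t)" if "0 \<le> t" for t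
    using profile_L2(2)[OF sol(2) a(2) L0 G2 that] mult_left_mono[OF win2[OF that, of t], of a2] a
    by (simp add: Q2_def mult_ac)
  have bound: "\<exists>M. \<forall>x\<in>{l..h}. \<bar>f x\<bar> \<le> M" if "continuous_on UNIV f" for f :: "real \<Rightarrow> real" and l h
  proof -
    have "bounded (f ` {l..h})"
      using that by (intro compact_imp_bounded compact_continuous_image continuous_on_subset[OF that]) auto
    then show ?thesis by (auto simp: bounded_iff)
  qed
  obtain M1 M2 where M1: "\<And>x. x \<in> {0..L} \<Longrightarrow> \<bar>c 1 x\<bar> \<le> M1" and M2: "\<And>x. x \<in> {- L..0} \<Longrightarrow> \<bar>c 2 x\<bar> \<le> M2"
    using bound[OF c(1), of 0 L] bound[OF c(2), of "- L" 0] by blast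
  define D1 D2 where "D1 = 2 * \<rho>1\<^sup>2 * b1 + 2 * M1\<^sup>2 * (L / b1 + L / a1) * L"
    and "D2 = 2 * \<rho>2\<^sup>2 * b2 + 2 * M2\<^sup>2 * (L / b2 + L / a2) * L"
  have D: "0 \<le> D1" "0 \<le> D2" using a b L by (auto simp: D1_def D2_def)
  have u2_decay: "(L2_norm {- L..0} (\<lambda>x. u 2 x t))\<^sup>2 \<le> D2 * Q2 * exp (- \<mu> * t)" if "0 \<le> t" for t
  proof -
    have "(L2_norm {- L..0} (\<lambda>x. u 2 x t))\<^sup>2 \<le> D2 * (LINT s:{t - L / a2..t + L / b2}|lborel. (G2 s)\<^sup>2)"
      unfolding D2_def using upstream_energy[OF a(2) b(2) L c(2) sol(2,4) G2 outflow M2 that] .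
    also have "\<dots> \<le> D2 * (Q2 * exp (- \<mu> * t))"
      unfolding Q2_def using D by (intro mult_left_mono win2 that)
    finally show ?thesis by simp
  qed
  have "continuous_in_L2 {0..L} (u 1)" using sol(3) unfolding mild_transport_def by blast
  then obtain B where B: "\<forall>t\<in>{0..L / b1}. (L2_norm {0..L} (\<lambda>x. u 1 x t))\<^sup>2 \<le> B"
    using continuous_in_L2_bounded[OF _ less_imp_le[OF LT(1)]] by blast
  \<comment> \<open>\<open>N\<close> serves both ranges of t: \<open>B\<close> bounds the squared
    norm up to time L / b1, and D1 * Q1 bounds it afterwards through the time t - L / b1. The
    exponential pays for that shift in either case; the modulus makes nonnegativity
    immediate.\<close>
  define N where "N = (\<bar>B\<bar> + D1 * Q1) * exp (\<mu> * (L / b1))"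
  have u1_decay: "(L2_norm {0..L} (\<lambda>x. u 1 x t))\<^sup>2 \<le> N * exp (- \<mu> * t)" if "0 \<le> t" for t
  proof (cases "t \<le> L / b1")
    case True
    have D1Q1: "0 \<le> D1 * Q1" using D Q by simp
    have "(L2_norm {0..L} (\<lambda>x. u 1 x t))\<^sup>2 \<le> B" using B that True by simp
    also have "\<dots> \<le> (\<bar>B\<bar> + D1 * Q1) * 1" using D1Q1 by simp
    also have "\<dots> \<le> (\<bar>B\<bar> + D1 * Q1) * exp (\<mu> * (L / b1 - t))"
    proof (rule mult_left_mono)
      have "0 \<le> \<mu> * (L / b1 - t)" using True \<mu> by (intro mult_nonneg_nonneg) auto
      then show "1 \<le> exp (\<mu> * (L / b1 - t))" by simp
    qed (use D1Q1 in simp)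
    also have "\<dots> = N * exp (- \<mu> * t)"
      unfolding N_def mult.assoc exp_add[symmetric] by (simp add: algebra_simps)
    finally show ?thesis .
  next
    case False
    define t0 where "t0 = t - L / b1"
    have t0: "0 \<le> t0" "t = t0 + L / b1" using False by (auto simp: t0_def)
    have "(L2_norm {0..L} (\<lambda>x. u 1 x t))\<^sup>2 \<le> D1 * (LINT s:{t0 - L / a1..t0 + L / b1}|lborel. (G1 s)\<^sup>2)"
      unfolding D1_def t0(2) using downstream_energy[OF a(1) b(1) L c(1) sol(1,3) G1 inflow M1 t0(1)] .
    also have "\<dots> \<le> D1 * (Q1 * exp (- \<mu> * t0))"
      unfolding Q1_def using D by (intro mult_left_mono win1 t0)
    also have "\<dots> \<le> (\<bar>B\<bar> + D1 * Q1) * exp (- \<mu> * t0)"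
      by (simp add: distrib_right)
    also have "\<dots> = N * exp (- \<mu> * t)"
      unfolding N_def mult.assoc exp_add[symmetric] by (simp add: t0_def algebra_simps)
    finally show ?thesis .
  qed
  have N: "0 \<le> N" using D Q by (simp add: N_def)
  \<comment> \<open>The roots come from passing from squared norms to norms, which halves the rate
    to \<mu> / 2. The summand 1 keeps \<open>C\<close> positive when all the energies
    vanish.\<close>
  define C where "C = sqrt (a1 * Q1) + sqrt N + sqrt (a2 * Q2) + sqrt (D2 * Q2) + 1"
  have "L2_norm (road L 1) (\<lambda>x. w 1 x t) + L2_norm (road L 1) (\<lambda>x. u 1 x t)
      + L2_norm (road L 2) (\<lambda>x. w 2 x t) + L2_norm (road L 2) (\<lambda>x. u 2 x t)
      \<le> C * exp (- (\<mu> / 2) * t)" if "0 \<le> t" for t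
  proof -
    have "0 \<le> 1 * exp (- (\<mu> / 2) * t)" by simp
    moreover have "0 \<le> a1 * Q1" "0 \<le> a2 * Q2" "0 \<le> D2 * Q2" using a D Q by auto
    note L2_norm_le_exp[OF w1_decay[OF that] this(1)] L2_norm_le_exp[OF u1_decay[OF that] N]
      L2_norm_le_exp[OF w2_decay[OF that] this(2)] L2_norm_le_exp[OF u2_decay[OF that] this(3)]
    ultimately show ?thesis
      unfolding road C_def distrib_right by linarith
  qed
  moreover have "0 < C" using a D Q N by (simp add: C_def add_nonneg_pos)
  ultimately show ?thesis using \<mu> by (intro exI[of _ C] exI[of _ "\<mu> / 2"]) simp
qed

end
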